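(* Let $X$ be a $2$-dimensional smooth connected Riemannian manifold without boundary. Let $Y_1\subset X$ be a $2$-dimensional compact connected $C^0$-submanifold with boundary $\partial Y_1\ne\varnothing$ which satisfies condition (i) and has property $(\circ)$. Let $Y_2\subset X$ be a $2$-dimensional compact connected $C^0$-submanifold with $\partial Y_2\neq\varnothing$ satisfying condition (i), and suppose that $\partial Y_1$ and $\partial Y_2$ are isometric in the metrics $\rho_{Y_j}$, $j=1,2$. Then $Y_2$ also has property $(\circ)$.
   Context: An $n$-dimensional $C^0$-submanifold $Y$ with boundary of an $n$-dimensional manifold $X$ is a subset which is an $n$-dimensional topological manifold with boundary in the induced topology; $\partial Y$ is its boundary and $\mathrm{Int}\,Y=Y\setminus\partial Y$ its interior. Condition (i) for $Y$: for all $x,y\in Y$, $$\rho_Y(x,y)=\liminf_{x'\to x,\;y'\to y;\;x',y'\in\mathrm{Int}\,Y}\{\inf[l(\gamma_{x',y',\mathrm{Int}\,Y})]\}<\infty,$$ where the infimum is over the Riemannian lengths of smooth paths $\gamma_{x',y',\mathrm{Int}\,Y}:[0,1]\to\mathrm{Int}\,Y$ joining $x'$ and $y'$ in $\mathrm{Int}\,Y$. This formula also defines the function $\rho_Y$. A shortest path in the metric $\rho_Y$ between distinct points $x,y\in Y$ is a path $\gamma:[0,1]\to Y$ with $\gamma(0)=x$, $\gamma(1)=y$ and $\rho_Y(\gamma(s),\gamma(t))=(t-s)\rho_Y(x,y)$ for $0\le s<t\le1$. Paths are continuous and non-constant. $Y$ has property $(\circ)$ if, for any two points $x,y\in\partial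 Y$ and every shortest path $\gamma:[0,1]\to Y$ in the metric $\rho_Y$ joining them, $\gamma(]0,1[)\subset\mathrm{Int}\,Y$. $\partial Y_1$ and $\partial Y_2$ are isometric in the metrics $\rho_{Y_j}$ if there is a surjective map $f:\partial Y_1\to\partial Y_2$ with $\rho_{Y_2}(f(x),f(y))=\rho_{Y_1}(x,y)$ for all $x,y\in\partial Y_1$. *)

theory Defs
  imports "HOL-Analysis.Analysis"
begin

section \<open>Smooth maps\<close>

text \<open>
  The derivative is taken within \<open>S\<close>, so that the same notion serves open subsets of Euclidean
  space and relatively open subsets of \<open>[0,1]\<close> (one-sided derivatives at the end points). In both
  cases the derivative within \<open>S\<close> is unique.
\<close>

primrec Ck_on :: "nat \<Rightarrow> 'a::real_normed_vector set \<Rightarrow> ('a \<Rightarrow> 'b::real_normed_vector) \<Rightarrow> bool" where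
  "Ck_on 0 S f \<longleftrightarrow> continuous_on S f"
| "Ck_on (Suc k) S f \<longleftrightarrow>
     (\<forall>x\<in>S. f differentiable (at x within S)) \<and>
     (\<forall>v. Ck_on k S (\<lambda>x. frechet_derivative f (at x within S) v))"

definition smooth_on :: "'a::real_normed_vector set \<Rightarrow> ('a \<Rightarrow> 'b::real_normed_vector) \<Rightarrow> bool" where
  "smooth_on S f \<longleftrightarrow> (\<forall>k. Ck_on k S f)"

section \<open>Smooth and Riemannian manifolds\<close>

text \<open>
  The manifold \<open>X\<close> is the whole (Hausdorff, second countable) type; a chart is a pair of its domain
  and the coordinate map, whose values outside the domain are irrelevant.
\<close>

type_synonym ('a, 'n) chart = "'a set \<times> ('a \<Rightarrow> real ^ 'n)"

definition is_chart :: "('a::topological_space, 'n::finite) chart \<Rightarrow> bool" where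
  "is_chart c \<longleftrightarrow> open (fst c) \<and> open (snd c ` fst c) \<and>
     (\<exists>\<psi>. homeomorphism (fst c) (snd c ` fst c) (snd c) \<psi>)"

definition transition :: "('a, 'n) chart \<Rightarrow> ('a, 'n) chart \<Rightarrow> real ^ 'n \<Rightarrow> real ^ 'n" where
  "transition c d = snd d \<circ> inv_into (fst c) (snd c)"

definition smooth_manifold ::
  "('a::{t2_space, second_countable_topology}, 'n::finite) chart set \<Rightarrow> bool" where
  "smooth_manifold A \<longleftrightarrow>
     (\<forall>c\<in>A. is_chart c) \<and> (\<Union>c\<in>A. fst c) = UNIV \<and>
     (\<forall>c\<in>A. \<forall>d\<in>A. smooth_on (snd c ` (fst c \<inter> fst d)) (transition c d))"

text \<open>
  A Riemannian metric is given by its coordinate matrices: \<open>g c u\<close> is the Gram matrix of the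
  coordinate frame of the chart \<open>c\<close> at the point with coordinates \<open>u\<close>. The last condition is the
  transformation law of a covariant 2-tensor.
\<close>

definition riemannian_metric ::
  "('a::topological_space, 'n::finite) chart set \<Rightarrow>
   (('a, 'n) chart \<Rightarrow> real ^ 'n \<Rightarrow> real ^ 'n ^ 'n) \<Rightarrow> bool" where
  "riemannian_metric A g \<longleftrightarrow>
     (\<forall>c\<in>A. smooth_on (snd c ` fst c) (g c)) \<and>
     (\<forall>c\<in>A. \<forall>u\<in>snd c ` fst c. transpose (g c u) = g c u \<and> (\<forall>v. v \<noteq> 0 \<longrightarrow> 0 < v \<bullet> (g c u *v v))) \<and>
     (\<forall>c\<in>A. \<forall>d\<in>A. \<forall>u\<in>snd c ` (fst c \<inter> fst d).
        let J = matrix (frechet_derivative (transition c d) (at u))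
        in g c u = transpose J ** g d (transition c d u) ** J)"

definition riemannian_manifold ::
  "('a::{t2_space, second_countable_topology}, 'n::finite) chart set \<Rightarrow>
   (('a, 'n) chart \<Rightarrow> real ^ 'n \<Rightarrow> real ^ 'n ^ 'n) \<Rightarrow> bool" where
  "riemannian_manifold A g \<longleftrightarrow> smooth_manifold A \<and> riemannian_metric A g"

section \<open>Smooth paths and their length\<close>

definition nonconst_path :: "(real \<Rightarrow> 'a::topological_space) \<Rightarrow> bool" where
  "nonconst_path \<gamma> \<longleftrightarrow> path \<gamma> \<and> \<not> \<gamma> constant_on {0..1}"

definition smooth_path ::
  "('a::topological_space, 'n::finite) chart set \<Rightarrow> (real \<Rightarrow> 'a) \<Rightarrow> bool" where
  "smooth_path A \<gamma> \<longleftrightarrow> nonconst_path \<gamma> \<and>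
     (\<forall>c\<in>A. smooth_on {t \<in> {0..1}. \<gamma> t \<in> fst c} (snd c \<circ> \<gamma>))"

text \<open>
  The speed is computed in an arbitrarily chosen chart around \<open>\<gamma> t\<close>; by the transformation law it
  does not depend on this choice.
\<close>

definition speed ::
  "('a::topological_space, 'n::finite) chart set \<Rightarrow>
   (('a, 'n) chart \<Rightarrow> real ^ 'n \<Rightarrow> real ^ 'n ^ 'n) \<Rightarrow> (real \<Rightarrow> 'a) \<Rightarrow> real \<Rightarrow> real" where
  "speed A g \<gamma> t =
     (let c = (SOME c. c \<in> A \<and> \<gamma> t \<in> fst c);
          v = vector_derivative (snd c \<circ> \<gamma>) (at t within {0..1})
      in sqrt (v \<bullet> (g c (snd c (\<gamma> t)) *v v)))"

definition riem_length ::
  "('a::topological_space, 'n::finite) chart set \<Rightarrow>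
   (('a, 'n) chart \<Rightarrow> real ^ 'n \<Rightarrow> real ^ 'n ^ 'n) \<Rightarrow> (real \<Rightarrow> 'a) \<Rightarrow> real" where
  "riem_length A g \<gamma> = integral {0..1} (speed A g \<gamma>)"

section \<open>Submanifolds with boundary\<close>

text \<open>
  \<open>half_space_chart Y k U \<phi>\<close>: \<open>\<phi>\<close> maps the relatively open subset \<open>U\<close> of \<open>Y\<close> homeomorphically onto
  a relatively open subset of the closed half-space \<open>x\<^sub>k \<ge> 0\<close>. Such a chart may miss the
  hyperplane \<open>x\<^sub>k = 0\<close>, so charts around interior points are included. The Hausdorff property and
  second countability of \<open>Y\<close> are inherited from the ambient type.
\<close>

definition half_space_chart ::
  "'a::topological_space set \<Rightarrow> 'n::finite \<Rightarrow> 'a set \<Rightarrow> ('a \<Rightarrow> real ^ 'n) \<Rightarrow> bool" where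
  "half_space_chart Y k U \<phi> \<longleftrightarrow>
     openin (top_of_set Y) U \<and> openin (top_of_set {x. 0 \<le> x $ k}) (\<phi> ` U) \<and>
     (\<exists>\<psi>. homeomorphism U (\<phi> ` U) \<phi> \<psi>)"

definition C0_submanifold :: "'n::finite itself \<Rightarrow> 'a::topological_space set \<Rightarrow> bool" where
  "C0_submanifold _ Y \<longleftrightarrow>
     (\<forall>p\<in>Y. \<exists>k U (\<phi> :: 'a \<Rightarrow> real ^ 'n). half_space_chart Y k U \<phi> \<and> p \<in> U)"

definition bdry :: "'n::finite itself \<Rightarrow> 'a::topological_space set \<Rightarrow> 'a set" where
  "bdry _ Y =
     {p \<in> Y. \<exists>k U (\<phi> :: 'a \<Rightarrow> real ^ 'n). half_space_chart Y k U \<phi> \<and> p \<in> U \<and> \<phi> p $ k = 0}"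

definition intr :: "'n::finite itself \<Rightarrow> 'a::topological_space set \<Rightarrow> 'a set" where
  "intr n Y = Y - bdry n Y"

section \<open>The metric \<open>\<rho>\<^sub>Y\<close>\<close>

text \<open>The infimum over the empty set of paths is \<open>\<infinity>\<close>.\<close>

definition intr_dist ::
  "('a::topological_space, 'n::finite) chart set \<Rightarrow>
   (('a, 'n) chart \<Rightarrow> real ^ 'n \<Rightarrow> real ^ 'n ^ 'n) \<Rightarrow> 'a set \<Rightarrow> 'a \<Rightarrow> 'a \<Rightarrow> ennreal" where
  "intr_dist A g Y x y =
     (INF \<gamma> \<in> {\<gamma>. smooth_path A \<gamma> \<and> path_image \<gamma> \<subseteq> intr TYPE('n) Y \<and>
                   pathstart \<gamma> = x \<and> pathfinish \<gamma> = y}. ennreal (riem_length A g \<gamma>))"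

definition rho ::
  "('a::topological_space, 'n::finite) chart set \<Rightarrow>
   (('a, 'n) chart \<Rightarrow> real ^ 'n \<Rightarrow> real ^ 'n ^ 'n) \<Rightarrow> 'a set \<Rightarrow> 'a \<Rightarrow> 'a \<Rightarrow> ennreal" where
  "rho A g Y x y =
     Liminf (inf (nhds (x, y)) (principal (intr TYPE('n) Y \<times> intr TYPE('n) Y)))
       (\<lambda>(x', y'). intr_dist A g Y x' y')"

definition condition_i ::
  "('a::topological_space, 'n::finite) chart set \<Rightarrow>
   (('a, 'n) chart \<Rightarrow> real ^ 'n \<Rightarrow> real ^ 'n ^ 'n) \<Rightarrow> 'a set \<Rightarrow> bool" where
  "condition_i A g Y \<longleftrightarrow> (\<forall>x\<in>Y. \<forall>y\<in>Y. rho A g Y x y < \<infinity>)"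

definition shortest_path ::
  "('a::topological_space, 'n::finite) chart set \<Rightarrow>
   (('a, 'n) chart \<Rightarrow> real ^ 'n \<Rightarrow> real ^ 'n ^ 'n) \<Rightarrow> 'a set \<Rightarrow> 'a \<Rightarrow> 'a \<Rightarrow> (real \<Rightarrow> 'a) \<Rightarrow> bool" where
  "shortest_path A g Y x y \<gamma> \<longleftrightarrow>
     x \<in> Y \<and> y \<in> Y \<and> x \<noteq> y \<and> nonconst_path \<gamma> \<and> path_image \<gamma> \<subseteq> Y \<and>
     pathstart \<gamma> = x \<and> pathfinish \<gamma> = y \<and>
     (\<forall>s t. 0 \<le> s \<and> s < t \<and> t \<le> 1 \<longrightarrow>
        rho A g Y (\<gamma> s) (\<gamma> t) = ennreal (t - s) * rho A g Y x y)"

definition property_circ ::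
  "('a::topological_space, 'n::finite) chart set \<Rightarrow>
   (('a, 'n) chart \<Rightarrow> real ^ 'n \<Rightarrow> real ^ 'n ^ 'n) \<Rightarrow> 'a set \<Rightarrow> bool" where
  "property_circ A g Y \<longleftrightarrow>
     (\<forall>x\<in>bdry TYPE('n) Y. \<forall>y\<in>bdry TYPE('n) Y. \<forall>\<gamma>.
        shortest_path A g Y x y \<gamma> \<longrightarrow> \<gamma> ` {0<..<1} \<subseteq> intr TYPE('n) Y)"

definition boundaries_isometric ::
  "('a::topological_space, 'n::finite) chart set \<Rightarrow>
   (('a, 'n) chart \<Rightarrow> real ^ 'n \<Rightarrow> real ^ 'n ^ 'n) \<Rightarrow> 'a set \<Rightarrow> 'a set \<Rightarrow> bool" where
  "boundaries_isometric A g Y\<^sub>1 Y\<^sub>2 \<longleftrightarrow>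
     (\<exists>f. f ` bdry TYPE('n) Y\<^sub>1 = bdry TYPE('n) Y\<^sub>2 \<and>
        (\<forall>x\<in>bdry TYPE('n) Y\<^sub>1. \<forall>y\<in>bdry TYPE('n) Y\<^sub>1.
           rho A g Y\<^sub>2 (f x) (f y) = rho A g Y\<^sub>1 x y))"

end

theory Submission
  imports Defs
begin

text \<open>
  The isometry of the boundaries carries equality in the triangle inequality from one manifold to
  the other. If a shortest path in \<open>Y\<^sub>2\<close> between boundary points \<open>x\<close>, \<open>y\<close> passed through a boundary
  point \<open>w\<close>, then \<open>w\<close> would divide \<open>\<rho>(x,y)\<close> into two parts that add up, and the same would hold for
  preimages \<open>x\<^sub>1\<close>, \<open>w\<^sub>1\<close>, \<open>y\<^sub>1\<close> on the boundary of \<open>Y\<^sub>1\<close>. Joining \<open>x\<^sub>1\<close> to \<open>w\<^sub>1\<close> and \<open>w\<^sub>1\<close> to \<open>y\<^sub>1\<close> by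
  shortest paths then gives a shortest path from \<open>x\<^sub>1\<close> to \<open>y\<^sub>1\<close> through \<open>w\<^sub>1\<close>
  (\<open>shortest_path_through\<close>), against property \<open>(\<circ>)\<close> of \<open>Y\<^sub>1\<close>. So everything rests on two facts
  about \<open>\<rho>\<^sub>Y\<close>: it satisfies the triangle inequality, and its finite values are realized by curves.

  The triangle inequality (\<open>rho_triangle\<close>) is the point where dimension two enters. At a boundary
  point \<open>z\<close> two short paths may end at different points close to \<open>z\<close>, and one has to pass from one to
  the other at small cost. In a half-disc chart around \<open>z\<close>, the points whose coordinates in \<open>X\<close> have
  distance \<open>s\<close> from \<open>z\<close> form a level set that separates a neighbourhood of \<open>z\<close> from the outer part of
  the half-disc. Since the open half-disc is homeomorphic to the plane, a single connected component of
  the level set already separates them, hence meets both paths. It is a connected piece of a circle of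
  radius \<open>s\<close> inside the interior of \<open>Y\<close>, so it contains an arc of length at most \<open>2 \<pi> s\<close> from one path
  to the other (\<open>separating_ring\<close>, \<open>reach_on_circle\<close>).

  Curves that realize \<open>\<rho>\<^sub>Y\<close> come from compactness (\<open>rho_lipschitz_curve\<close>): almost minimizing smooth
  paths, parametrized proportionally to arc length, have a cluster point in the compact product
  space of all functions into \<open>Y\<close>, and lower semicontinuity of \<open>\<rho>\<^sub>Y\<close> makes it Lipschitz. It is
  continuous for the topology of \<open>X\<close> because a path that leaves a neighbourhood has a length that is
  bounded below (\<open>length_lower_bound\<close>).

  The length infimum ranges over smooth nonconstant paths only, so concatenation needs care: two paths
  are joined after a reparametrization all of whose derivatives vanish at the common end point.
\<close>

section \<open>Functions of class \<open>C\<^sup>k\<close> on sets of reals\<close>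

lemma Ck_on_cong:
  assumes "Ck_on k S f" "\<And>x. x \<in> S \<Longrightarrow> f x = g x"
  shows "Ck_on k S g"
  using assms
proof (induction k arbitrary: f g)
  case 0
  then show ?case by (simp cong: continuous_on_cong)
next
  case (Suc k)
  have der: "(f has_derivative D) (at x within S) \<longleftrightarrow> (g has_derivative D) (at x within S)"
    if "x \<in> S" for x D
    using Suc.prems(2) that has_derivative_transform[of x S f g D] has_derivative_transform[of x S g f D]
    by auto
  show ?case
  proof (simp, intro conjI ballI allI)
    fix x assume "x \<in> S"
    then show "g differentiable at x within S"
      using Suc.prems(1) der unfolding Ck_on.simps differentiable_def by blast
  next
    fix v
    show "Ck_on k S (\<lambda>x. frechet_derivative g (at x within S) v)"
    proof (rule Suc.IH)
      show "Ck_on k S (\<lambda>x. frechet_derivative f (at x within S) v)"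
        using Suc.prems(1) by simp
      show "frechet_derivative f (at x within S) v = frechet_derivative g (at x within S) v"
        if "x \<in> S" for x
        using der[OF that] by (simp add: frechet_derivative_def)
    qed
  qed
qed

lemma at_within_Int_open_eq:
  "open T \<Longrightarrow> x \<in> T \<Longrightarrow> at x within (S \<inter> T) = at x within S"
  by (rule at_within_nhd[of x T]) auto

text \<open>
  Derivatives within a set depend on a filter that only sees the set near the point. So the definition
  chooses the same derivative after restriction to an open set, even where derivatives are not unique.
\<close>

lemma Ck_on_Int_open:
  assumes "Ck_on k S f" "open T"
  shows "Ck_on k (S \<inter> T) f"
  using assms(1)
proof (induction k arbitrary: f)
  case 0
  then show ?case by (auto intro: continuous_on_subset)
next
  case (Suc k)
  have "Ck_on k (S \<inter> T) (\<lambda>x. frechet_derivative f (at x within (S \<inter> T)) v)" for v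
    by (rule Ck_on_cong[where f="\<lambda>x. frechet_derivative f (at x within S) v"])
      (use Suc assms(2) in \<open>auto simp: at_within_Int_open_eq\<close>)
  then show ?case using Suc.prems assms(2) by (auto simp: at_within_Int_open_eq)
qed

lemma Ck_on_local:
  assumes "\<And>x. x \<in> S \<Longrightarrow> \<exists>T. open T \<and> x \<in> T \<and> Ck_on k (S \<inter> T) f"
  shows "Ck_on k S f"
  using assms
proof (induction k arbitrary: f)
  case 0
  then have "continuous (at x within S) f" if "x \<in> S" for x
    using that by (metis Ck_on.simps(1) IntI at_within_Int_open_eq continuous_on_eq_continuous_within)
  then show ?case by (simp add: continuous_on_eq_continuous_within)
next
  case (Suc k)
  show ?case
  proof (simp, intro conjI ballI allI)
    fix x assume "x \<in> S"
    then obtain T where "open T" "x \<in> T" "Ck_on (Suc k) (S \<inter> T) f"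
      using Suc.prems by blast
    then show "f differentiable at x within S"
      using \<open>x \<in> S\<close> by (auto simp: at_within_Int_open_eq)
  next
    fix v
    show "Ck_on k S (\<lambda>x. frechet_derivative f (at x within S) v)"
    proof (rule Suc.IH)
      fix x assume "x \<in> S"
      then obtain T where T: "open T" "x \<in> T" "Ck_on (Suc k) (S \<inter> T) f"
        using Suc.prems by blast
      then have "Ck_on k (S \<inter> T) (\<lambda>x. frechet_derivative f (at x within (S \<inter> T)) v)" by simp
      then have "Ck_on k (S \<inter> T) (\<lambda>x. frechet_derivative f (at x within S) v)"
        by (rule Ck_on_cong) (use T in \<open>auto simp: at_within_Int_open_eq\<close>)
      then show "\<exists>T. open T \<and> x \<in> T \<and> Ck_on k (S \<inter> T) (\<lambda>x. frechet_derivative f (at x within S) v)"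
        using T by blast
    qed
  qed
qed

lemma Ck_on_continuous: "Ck_on k S f \<Longrightarrow> continuous_on S f"
  by (cases k) (auto simp: continuous_on_eq_continuous_within differentiable_imp_continuous_within)

lemma Ck_on_Suc_imp: "Ck_on (Suc k) S f \<Longrightarrow> Ck_on k S f"
proof (induction k arbitrary: f)
  case 0
  then show ?case using Ck_on_continuous[of "Suc 0" S f] by (simp del: Ck_on.simps(2))
next
  case (Suc k)
  have "Ck_on k S (\<lambda>x. frechet_derivative f (at x within S) v)" for v
    by (rule Suc.IH) (use Suc.prems in simp)
  then show ?case using Suc.prems by simp
qed

text \<open>
  At a limit point the derivative within a set of reals is unique, which identifies the arbitrarily
  chosen Frechet derivative with a given vector derivative. The calculus below therefore concerns sets
  of reals without isolated points.
\<close>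

lemma real_frechet_derivative:
  fixes f :: "real \<Rightarrow> 'b::real_normed_vector"
  assumes "(f has_vector_derivative d) (at x within S)" "x islimpt S"
  shows "frechet_derivative f (at x within S) v = v *\<^sub>R d"
proof -
  have "f differentiable at x within S"
    using assms(1) by (rule differentiableI_vector)
  then have F: "(f has_derivative frechet_derivative f (at x within S)) (at x within S)"
    by (simp add: frechet_derivative_works)
  then have lin: "linear (frechet_derivative f (at x within S))"
    by (rule has_derivative_linear)
  have "frechet_derivative f (at x within S) v = v *\<^sub>R frechet_derivative f (at x within S) 1" for v
    using linear.scaleR[OF lin, of v 1] by (simp only: real_scaleR_def mult_1_right)
  then have *: "(f has_vector_derivative frechet_derivative f (at x within S) 1) (at x within S)"
    unfolding has_vector_derivative_def by (intro has_derivative_eq_rhs[OF F] ext)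
  have "frechet_derivative f (at x within S) 1 = d"
    using vector_derivative_unique_within[OF _ * assms(1)] assms(2)
    by (simp add: trivial_limit_within)
  then show ?thesis using linear.scaleR[OF lin, of v 1] by simp
qed

lemma Ck_on_real_SucE:
  fixes f :: "real \<Rightarrow> 'b::real_normed_vector"
  assumes "Ck_on (Suc k) S f" "\<And>x. x \<in> S \<Longrightarrow> x islimpt S"
  obtains f' where "\<And>x. x \<in> S \<Longrightarrow> (f has_vector_derivative f' x) (at x within S)" "Ck_on k S f'"
proof
  show "(f has_vector_derivative frechet_derivative f (at x within S) 1) (at x within S)"
    if "x \<in> S" for x
  proof -
    have d: "(f has_vector_derivative vector_derivative f (at x within S)) (at x within S)"
      using assms(1) that by (simp add: vector_derivative_works)
    with real_frechet_derivative[OF d assms(2)[OF that], of 1] show ?thesis by simp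
  qed
  show "Ck_on k S (\<lambda>x. frechet_derivative f (at x within S) 1)" using assms(1) by simp
qed

text \<open>
  Proved before the criterion \<open>Ck_on_real_SucI\<close>, which needs it for the map \<open>\<lambda>y. v *\<^sub>R y\<close>: the
  directional derivatives that the definition quantifies over are multiples of one vector derivative.
\<close>

lemma Ck_on_bounded_linear:
  fixes f :: "real \<Rightarrow> 'b::real_normed_vector"
  assumes L: "bounded_linear L" and S: "\<And>x. x \<in> S \<Longrightarrow> x islimpt S" and "Ck_on k S f"
  shows "Ck_on k S (\<lambda>x. L (f x))"
  using assms(3)
proof (induction k arbitrary: f)
  case 0
  then show ?case by (simp add: bounded_linear.continuous_on[OF L])
next
  case (Suc k)
  obtain f' where f': "\<And>x. x \<in> S \<Longrightarrow> (f has_vector_derivative f' x) (at x within S)" "Ck_on k S f'"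
    using Ck_on_real_SucE[OF Suc.prems S] by blast
  have d: "((\<lambda>x. L (f x)) has_vector_derivative L (f' x)) (at x within S)" if "x \<in> S" for x
    using bounded_linear.has_vector_derivative[OF L f'(1)[OF that]] .
  have "Ck_on k S (\<lambda>x. frechet_derivative (\<lambda>x. L (f x)) (at x within S) v)" for v
  proof (rule Ck_on_cong)
    have "Ck_on k S (\<lambda>x. frechet_derivative f (at x within S) v)" using Suc.prems by simp
    from Suc.IH[OF this] show "Ck_on k S (\<lambda>x. L (frechet_derivative f (at x within S) v))" .
    show "L (frechet_derivative f (at x within S) v) = frechet_derivative (\<lambda>x. L (f x)) (at x within S) v"
      if "x \<in> S" for x
      using real_frechet_derivative[OF d S] real_frechet_derivative[OF f'(1) S] that
      by (simp add: linear.scaleR[OF bounded_linear.linear[OF L]])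
  qed
  then show ?case using d by (auto intro: differentiableI_vector)
qed

lemma Ck_on_real_SucI:
  fixes f :: "real \<Rightarrow> 'b::real_normed_vector"
  assumes "\<And>x. x \<in> S \<Longrightarrow> (f has_vector_derivative f' x) (at x within S)" "Ck_on k S f'"
    and S: "\<And>x. x \<in> S \<Longrightarrow> x islimpt S"
  shows "Ck_on (Suc k) S f"
proof -
  have "Ck_on k S (\<lambda>x. frechet_derivative f (at x within S) v)" for v
  proof (rule Ck_on_cong)
    show "Ck_on k S (\<lambda>x. v *\<^sub>R f' x)"
      using Ck_on_bounded_linear[OF bounded_linear_scaleR_right S assms(2)] by blast
  qed (use real_frechet_derivative[OF assms(1) S] in simp)
  then show ?thesis using assms(1) by (auto intro: differentiableI_vector)
qed

lemma Ck_on_real_add: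
  fixes f g :: "real \<Rightarrow> 'b::real_normed_vector"
  assumes S: "\<And>x. x \<in> S \<Longrightarrow> x islimpt S" and "Ck_on k S f" "Ck_on k S g"
  shows "Ck_on k S (\<lambda>x. f x + g x)"
  using assms(2,3)
proof (induction k arbitrary: f g)
  case 0
  then show ?case by (simp add: continuous_on_add)
next
  case (Suc k)
  obtain f' where f': "\<And>x. x \<in> S \<Longrightarrow> (f has_vector_derivative f' x) (at x within S)" "Ck_on k S f'"
    using Ck_on_real_SucE[OF Suc.prems(1) S] by blast
  obtain g' where g': "\<And>x. x \<in> S \<Longrightarrow> (g has_vector_derivative g' x) (at x within S)" "Ck_on k S g'"
    using Ck_on_real_SucE[OF Suc.prems(2) S] by blast
  show ?case
    by (rule Ck_on_real_SucI[where f'="\<lambda>x. f' x + g' x"])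
       (use f' g' S Suc.IH in \<open>auto intro: has_vector_derivative_add\<close>)
qed

lemma Ck_on_real_scaleR:
  fixes f :: "real \<Rightarrow> real" and g :: "real \<Rightarrow> 'b::real_normed_vector"
  assumes S: "\<And>x. x \<in> S \<Longrightarrow> x islimpt S" and "Ck_on k S f" "Ck_on k S g"
  shows "Ck_on k S (\<lambda>x. f x *\<^sub>R g x)"
  using assms(2,3)
proof (induction k arbitrary: f g)
  case 0
  then show ?case by (simp add: continuous_on_scaleR)
next
  case (Suc k)
  obtain f' where f': "\<And>x. x \<in> S \<Longrightarrow> (f has_vector_derivative f' x) (at x within S)" "Ck_on k S f'"
    using Ck_on_real_SucE[OF Suc.prems(1) S] by blast
  obtain g' where g': "\<And>x. x \<in> S \<Longrightarrow> (g has_vector_derivative g' x) (at x within S)" "Ck_on k S g'"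
    using Ck_on_real_SucE[OF Suc.prems(2) S] by blast
  show ?case
  proof (rule Ck_on_real_SucI[where f'="\<lambda>x. f x *\<^sub>R g' x + f' x *\<^sub>R g x"])
    show "((\<lambda>x. f x *\<^sub>R g x) has_vector_derivative f x *\<^sub>R g' x + f' x *\<^sub>R g x) (at x within S)"
      if "x \<in> S" for x
      using has_vector_derivative_scaleR[of f "f' x" x S g "g' x"] f'(1)[OF that] g'(1)[OF that]
      by (simp add: has_real_derivative_iff_has_vector_derivative)
    show "Ck_on k S (\<lambda>x. f x *\<^sub>R g' x + f' x *\<^sub>R g x)"
      by (rule Ck_on_real_add[OF S Suc.IH[OF Ck_on_Suc_imp[OF Suc.prems(1)] g'(2)]
            Suc.IH[OF f'(2) Ck_on_Suc_imp[OF Suc.prems(2)]]])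
  qed (use S in auto)
qed

lemma Ck_on_real_const:
  fixes S :: "real set"
  assumes S: "\<And>x. x \<in> S \<Longrightarrow> x islimpt S"
  shows "Ck_on k S (\<lambda>x. c)"
proof (induction k arbitrary: c)
  case (Suc k)
  show ?case by (rule Ck_on_real_SucI[where f'="\<lambda>x. 0", OF _ Suc.IH S]) simp
qed simp

lemma Ck_on_real_sum:
  fixes f :: "'i \<Rightarrow> real \<Rightarrow> 'b::real_normed_vector"
  assumes S: "\<And>x. x \<in> S \<Longrightarrow> x islimpt S" and "\<And>i. i \<in> I \<Longrightarrow> Ck_on k S (f i)"
    and "finite I"
  shows "Ck_on k S (\<lambda>x. \<Sum>i\<in>I. f i x)"
  using assms(3,2)
proof (induction I)
  case empty
  show ?case by (simp add: Ck_on_real_const[OF S])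
next
  case (insert i I)
  then show ?case using Ck_on_real_add[OF S, where f="f i" and g="\<lambda>x. \<Sum>i\<in>I. f i x"] by simp
qed

text \<open>
  The derivative of \<open>g \<circ> f\<close> is the finite sum over the basis of the coordinates of \<open>f'\<close> times the
  directional derivatives of \<open>g\<close>, composed with \<open>f\<close>. All of these are of class one less, and products
  of functions of a real variable are already under control.
\<close>

lemma Ck_on_real_compose:
  fixes f :: "real \<Rightarrow> 'b::euclidean_space" and g :: "'b \<Rightarrow> 'c::real_normed_vector"
  assumes S: "\<And>x. x \<in> S \<Longrightarrow> x islimpt S" and "f ` S \<subseteq> T" and "Ck_on k S f" "Ck_on k T g"
  shows "Ck_on k S (\<lambda>x. g (f x))"
  using assms(3,4)
proof (induction k arbitrary: g)
  case 0
  then show ?case using assms(2) by (auto intro: continuous_on_compose2)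
next
  case (Suc k)
  obtain f' where f': "\<And>x. x \<in> S \<Longrightarrow> (f has_vector_derivative f' x) (at x within S)" "Ck_on k S f'"
    using Ck_on_real_SucE[OF Suc.prems(1) S] by blast
  define D where "D y = frechet_derivative g (at y within T)" for y
  have D: "(g has_derivative D y) (at y within T)" if "y \<in> T" for y
    using Suc.prems(2) that frechet_derivative_works unfolding D_def by auto
  have CD: "Ck_on k T (\<lambda>y. D y v)" for v using Suc.prems(2) by (simp add: D_def)
  show ?case
  proof (rule Ck_on_real_SucI[where f'="\<lambda>x. D (f x) (f' x)"])
    fix x assume x: "x \<in> S"
    then have "(g has_derivative D (f x)) (at (f x) within f ` S)"
      using D assms(2) by (meson has_derivative_subset image_subset_iff)
    from diff_chain_within[OF f'(1)[OF x, unfolded has_vector_derivative_def] this]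
    show "((\<lambda>x. g (f x)) has_vector_derivative D (f x) (f' x)) (at x within S)"
      using linear.scaleR[OF has_derivative_linear[OF D[of "f x"]]] assms(2) x
      by (auto simp: has_vector_derivative_def o_def)
  next
    show "Ck_on k S (\<lambda>x. D (f x) (f' x))"
    proof (rule Ck_on_cong)
      show "Ck_on k S (\<lambda>x. \<Sum>b\<in>Basis. (f' x \<bullet> b) *\<^sub>R D (f x) b)"
      proof (intro Ck_on_real_sum Ck_on_real_scaleR S finite_Basis)
        fix b :: 'b
        show "Ck_on k S (\<lambda>x. f' x \<bullet> b)"
          by (rule Ck_on_bounded_linear[OF bounded_linear_inner_left S f'(2)])
        show "Ck_on k S (\<lambda>x. D (f x) b)"
          by (rule Suc.IH[OF Ck_on_Suc_imp[OF Suc.prems(1)] CD])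
      qed
      fix x assume x: "x \<in> S"
      then have "linear (D (f x))" using D assms(2) has_derivative_linear by blast
      then show "(\<Sum>b\<in>Basis. (f' x \<bullet> b) *\<^sub>R D (f x) b) = D (f x) (f' x)"
        using linear_sum[of "D (f x)" "\<lambda>b. (f' x \<bullet> b) *\<^sub>R b" Basis]
        by (simp add: linear.scaleR euclidean_representation)
    qed
  qed (use S in auto)
qed

lemma Ck_on_real_ident:
  fixes S :: "real set"
  assumes S: "\<And>x. x \<in> S \<Longrightarrow> x islimpt S"
  shows "Ck_on k S (\<lambda>x. x)"
proof (cases k)
  case (Suc j)
  show ?thesis unfolding Suc
    by (rule Ck_on_real_SucI[where f'="\<lambda>x. 1", OF _ Ck_on_real_const[OF S] S]) simp
qed simp

lemma Ck_on_real_subset: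
  fixes f :: "real \<Rightarrow> 'b::real_normed_vector"
  assumes S: "\<And>x. x \<in> S \<Longrightarrow> x islimpt S" and "S \<subseteq> T" "Ck_on k T f"
  shows "Ck_on k S f"
  by (rule Ck_on_real_compose[OF S _ Ck_on_real_ident[OF S] assms(3)]) (use assms(2) in auto)

lemma poly_times_exp_minus_tendsto_0:
  "((\<lambda>y::real. poly P y * exp (- y)) \<longlongrightarrow> 0) at_top"
proof -
  have "((\<lambda>y. \<Sum>i\<le>degree P. coeff P i * (y ^ i / exp y)) \<longlongrightarrow> (\<Sum>i\<le>degree P. coeff P i * 0)) at_top"
    by (intro tendsto_sum tendsto_mult tendsto_const tendsto_power_div_exp_0)
  then show ?thesis
    by (simp add: poly_altdef sum_distrib_right exp_minus divide_inverse mult.assoc)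
qed

text \<open>
  These functions form a family closed under differentiation, and each of them is continuous at \<open>0\<close>;
  this makes all of them smooth on the whole line.
\<close>

definition flat_poly :: "real poly \<Rightarrow> real \<Rightarrow> real" where
  "flat_poly P x = (if x > 0 then poly P (1 / x) * exp (- (1 / x)) else 0)"

lemma flat_poly_DERIV:
  "(flat_poly P has_real_derivative flat_poly ([:0, 0, 1:] * (P - pderiv P)) x) (at x)"
proof -
  consider "x > 0" | "x < 0" | "x = 0" by linarith
  then show ?thesis
  proof cases
    case 1
    have "((\<lambda>x. poly P (1 / x) * exp (- (1 / x))) has_real_derivative
        flat_poly ([:0, 0, 1:] * (P - pderiv P)) x) (at x)"
      using 1 by (auto intro!: derivative_eq_intros DERIV_chain'[OF _ poly_DERIV]
          simp: flat_poly_def field_simps power2_eq_square)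
    then show ?thesis
      by (rule DERIV_cong_ev[THEN iffD1, rotated 3])
         (use 1 in \<open>auto simp: flat_poly_def eventually_nhds intro!: exI[of _ "{0<..}"]\<close>)
  next
    case 2
    have "((\<lambda>x. 0) has_real_derivative flat_poly ([:0, 0, 1:] * (P - pderiv P)) x) (at x)"
      using 2 by (simp add: flat_poly_def)
    then show ?thesis
      by (rule DERIV_cong_ev[THEN iffD1, rotated 3])
         (use 2 in \<open>auto simp: flat_poly_def eventually_nhds intro!: exI[of _ "{..<0}"]\<close>)
  next
    case 3
    have "((\<lambda>h. poly ([:0, 1:] * P) (inverse h) * exp (- inverse h)) \<longlongrightarrow> 0) (at_right 0)"
      by (rule filterlim_compose[OF poly_times_exp_minus_tendsto_0 filterlim_inverse_at_top_right])
    then have "((\<lambda>h. flat_poly P h / h) \<longlongrightarrow> 0) (at_right 0)"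
      by (rule Lim_transform_eventually)
         (auto simp: flat_poly_def eventually_at_right_field field_simps intro!: exI[of _ 1])
    moreover have "((\<lambda>h. flat_poly P h / h) \<longlongrightarrow> 0) (at_left 0)"
      by (rule Lim_transform_eventually[OF tendsto_const])
         (auto simp: flat_poly_def eventually_at_left_field intro!: exI[of _ "-1"])
    ultimately have "((\<lambda>h. flat_poly P h / h) \<longlongrightarrow> 0) (at 0)"
      by (rule filterlim_split_at[rotated])
    then show ?thesis using 3 by (simp add: DERIV_def flat_poly_def)
  qed
qed

lemma Ck_on_flat_poly: "Ck_on k UNIV (flat_poly P)"
proof (induction k arbitrary: P)
  case 0
  show ?case using DERIV_isCont[OF flat_poly_DERIV] by (simp add: continuous_at_imp_continuous_on)
next
  case (Suc k)
  show ?case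
    by (rule Ck_on_real_SucI[OF _ Suc.IH])
       (use flat_poly_DERIV in \<open>auto simp: has_real_derivative_iff_has_vector_derivative[symmetric]\<close>)
qed

text \<open>
  \<open>flat x = exp (1 - 1 / x)\<close> for positive \<open>x\<close>: it increases from \<open>0\<close> to \<open>1\<close> on \<open>[0,1]\<close> and has
  infinite contact with \<open>0\<close> at the origin.
\<close>

definition flat :: "real \<Rightarrow> real" where "flat = flat_poly [:exp 1:]"
definition flat' :: "real \<Rightarrow> real" where "flat' = flat_poly [:0, 0, exp 1:]"

lemma flat_DERIV: "(flat has_real_derivative flat' x) (at x)"
  using flat_poly_DERIV[of "[:exp 1:]" x] by (simp add: flat_def flat'_def)

lemma flat'_nonneg: "0 \<le> flat' x"
  by (simp add: flat'_def flat_poly_def)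

lemma flat_le_0: "x \<le> 0 \<Longrightarrow> flat x = 0" and flat'_le_0: "x \<le> 0 \<Longrightarrow> flat' x = 0"
  by (simp_all add: flat_def flat'_def flat_poly_def)

lemma flat_1: "flat 1 = 1"
  by (simp add: flat_def flat_poly_def flip: exp_add)

lemma Ck_on_flat: "Ck_on k UNIV flat" by (simp add: flat_def Ck_on_flat_poly)

lemma flat_nonneg: "0 \<le> flat x"
  by (simp add: flat_def flat_poly_def)

lemma flat_le_1: "x \<le> 1 \<Longrightarrow> flat x \<le> 1"
  using DERIV_nonneg_imp_nondecreasing[of x 1 flat] flat_DERIV flat'_nonneg flat_1 by metis

lemma unit_interval_islimpt: "t \<in> {0..1} \<Longrightarrow> t islimpt {0..1::real}"
  by (rule islimpt_Icc[THEN iffD2]) auto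

lemma Ck_on_real_affine:
  fixes S :: "real set" and b :: "'b::real_normed_vector"
  assumes S: "\<And>x. x \<in> S \<Longrightarrow> x islimpt S"
  shows "Ck_on k S (\<lambda>t. a + t *\<^sub>R b)"
  by (intro Ck_on_real_add[OF S] Ck_on_real_scaleR[OF S] Ck_on_real_const[OF S] Ck_on_real_ident[OF S])

text \<open>
  These parameter changes run through \<open>[0,1]\<close> during one half of the unit interval and stand still
  during the other half. The transition at \<open>1/2\<close> is smooth because \<open>flat\<close> is flat at \<open>0\<close>.
\<close>

lemma flat_stop:
  shows "Ck_on k {0..1} (\<lambda>t. 1 - flat (1 - 2 * t))" "(\<lambda>t. 1 - flat (1 - 2 * t)) ` {0..1} \<subseteq> {0..1}"
    "((\<lambda>t. 1 - flat (1 - 2 * t)) has_real_derivative 2 * flat' (1 - 2 * t)) (at t within {0..1})"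
proof -
  have "Ck_on k {0..1} (\<lambda>t. flat (1 + t *\<^sub>R (- 2)))"
    by (rule Ck_on_real_compose[OF unit_interval_islimpt _ Ck_on_real_affine[OF unit_interval_islimpt] Ck_on_flat])
      simp_all
  then have "Ck_on k {0..1} (\<lambda>t. 1 + - flat (1 + t *\<^sub>R (- 2)))"
    by (intro Ck_on_real_add[OF unit_interval_islimpt] Ck_on_real_const[OF unit_interval_islimpt]
        Ck_on_bounded_linear[OF bounded_linear_minus[OF bounded_linear_ident] unit_interval_islimpt])
  then show "Ck_on k {0..1} (\<lambda>t. 1 - flat (1 - 2 * t))" by (simp add: mult.commute)
  show "(\<lambda>t. 1 - flat (1 - 2 * t)) ` {0..1} \<subseteq> {0..1}"
    using flat_nonneg flat_le_1 by auto
  have "((\<lambda>t. 1 - flat (1 - 2 * t)) has_real_derivative 0 - flat' (1 - 2 * t) * (- 2)) (at t within {0..1})"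
    by (rule DERIV_diff[OF DERIV_const DERIV_chain2[OF flat_DERIV]]) (auto intro!: derivative_eq_intros)
  then show "((\<lambda>t. 1 - flat (1 - 2 * t)) has_real_derivative 2 * flat' (1 - 2 * t)) (at t within {0..1})"
    by (simp add: mult.commute)
qed

lemma flat_start:
  shows "Ck_on k {0..1} (\<lambda>t. flat (2 * t - 1))" "(\<lambda>t. flat (2 * t - 1)) ` {0..1} \<subseteq> {0..1}"
    "((\<lambda>t. flat (2 * t - 1)) has_real_derivative 2 * flat' (2 * t - 1)) (at t within {0..1})"
proof -
  have "Ck_on k {0..1} (\<lambda>t. flat (- 1 + t *\<^sub>R 2))"
    by (rule Ck_on_real_compose[OF unit_interval_islimpt _ Ck_on_real_affine[OF unit_interval_islimpt] Ck_on_flat])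
      simp_all
  then show "Ck_on k {0..1} (\<lambda>t. flat (2 * t - 1))" by (simp add: mult.commute)
  show "(\<lambda>t. flat (2 * t - 1)) ` {0..1} \<subseteq> {0..1}"
    using flat_nonneg flat_le_1 by auto
  have "((\<lambda>t. flat (2 * t - 1)) has_real_derivative flat' (2 * t - 1) * 2) (at t within {0..1})"
    by (rule DERIV_chain2[OF flat_DERIV]) (auto intro!: derivative_eq_intros)
  then show "((\<lambda>t. flat (2 * t - 1)) has_real_derivative 2 * flat' (2 * t - 1)) (at t within {0..1})"
    by (simp add: mult.commute)
qed

section \<open>Speed and length in charts\<close>

text \<open>
  The set of times that a path spends in an open set is relatively open in \<open>[0,1]\<close>, so derivatives
  within it are derivatives within \<open>[0,1]\<close>, and it has no isolated points.
\<close>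

lemma times_open:
  assumes "path \<gamma>" "open U"
  obtains W where "open W" "{t \<in> {0..1}. \<gamma> t \<in> U} = {0..1} \<inter> W"
proof -
  obtain W where W: "open W" "W \<inter> {0..1} = \<gamma> -` U \<inter> {0..1}"
    using assms continuous_on_open_invariant[of "{0..1}" \<gamma>] unfolding path_def by blast
  have "{t \<in> {0..1}. \<gamma> t \<in> U} = \<gamma> -` U \<inter> {0..1}" by blast
  also have "\<dots> = {0..1} \<inter> W" unfolding W(2)[symmetric] by (rule Int_commute)
  finally show thesis by (rule that[OF W(1)])
qed

lemma at_within_times:
  assumes "path \<gamma>" "open U" "t \<in> {0..1}" "\<gamma> t \<in> U"
  shows "at t within {t \<in> {0..1}. \<gamma> t \<in> U} = at t within {0..1}"
proof -
  obtain W where W: "open W" "{t \<in> {0..1}. \<gamma> t \<in> U} = {0..1} \<inter> W"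
    using times_open[OF assms(1,2)] .
  then have "t \<in> W" using assms by auto
  then show ?thesis using at_within_Int_open_eq[OF W(1)] W(2) by simp
qed

lemma times_islimpt:
  assumes "path \<gamma>" "open U" "t \<in> {t \<in> {0..1}. \<gamma> t \<in> U}"
  shows "t islimpt {t \<in> {0..1}. \<gamma> t \<in> U}"
proof -
  have t: "t \<in> {0..1}" "\<gamma> t \<in> U" using assms(3) by auto
  have "\<not> trivial_limit (at t within {t \<in> {0..1}. \<gamma> t \<in> U})"
    unfolding at_within_times[OF assms(1,2) t] trivial_limit_within
    using unit_interval_islimpt[OF t(1)] by simp
  then show ?thesis unfolding trivial_limit_within by simp
qed

lemma continuous_on_matrix_vector_mult:
  fixes M :: "'t::topological_space \<Rightarrow> real ^ 'n ^ 'm" and v :: "'t \<Rightarrow> real ^ 'n"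
  assumes "continuous_on S M" "continuous_on S v"
  shows "continuous_on S (\<lambda>s. M s *v v s)"
  unfolding matrix_vector_mult_def
  by (intro continuous_intros assms)

lemma inner_congruent_matrix:
  fixes G :: "real ^ 'n ^ 'n"
  shows "v \<bullet> ((transpose J ** G ** J) *v v) = (J *v v) \<bullet> (G *v (J *v v))"
proof -
  have "v \<bullet> ((transpose J ** G ** J) *v v) = v \<bullet> (transpose J *v (G *v (J *v v)))"
    by (simp add: matrix_vector_mul_assoc matrix_mul_assoc)
  also have "\<dots> = (v v* transpose J) \<bullet> (G *v (J *v v))"
    by (simp only: dot_lmul_matrix)
  also have "v v* transpose J = J *v v"
    using transpose_matrix_vector[of "transpose J" v] by simp
  finally show ?thesis .
qed

locale riemannian =
  fixes A :: "('a::{t2_space, second_countable_topology}, 'n::finite) chart set"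
    and g :: "('a, 'n) chart \<Rightarrow> real ^ 'n \<Rightarrow> real ^ 'n ^ 'n"
  assumes manifold: "riemannian_manifold A g"
begin

abbreviation chart_inv :: "('a, 'n) chart \<Rightarrow> real ^ 'n \<Rightarrow> 'a" where
  "chart_inv c \<equiv> inv_into (fst c) (snd c)"

text \<open>
  The Riemannian norm of the tangent vector with coordinates \<open>v\<close> at the point with coordinates \<open>u\<close>.
\<close>

definition gnorm :: "('a, 'n) chart \<Rightarrow> real ^ 'n \<Rightarrow> real ^ 'n \<Rightarrow> real" where
  "gnorm c u v = sqrt (v \<bullet> (g c u *v v))"

lemma chart_at: obtains c where "c \<in> A" "p \<in> fst c"
  using manifold unfolding riemannian_manifold_def smooth_manifold_def by blast

context
  fixes c assumes c: "c \<in> A"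
begin

lemma chart_open: "open (fst c)" and chart_image_open: "open (snd c ` fst c)"
  and chart_homeomorphism: "homeomorphism (fst c) (snd c ` fst c) (snd c) (chart_inv c)"
proof -
  have *: "is_chart c" using c manifold unfolding riemannian_manifold_def smooth_manifold_def by blast
  then show "open (fst c)" "open (snd c ` fst c)" by (auto simp: is_chart_def)
  obtain \<psi> where \<psi>: "homeomorphism (fst c) (snd c ` fst c) (snd c) \<psi>" using * by (auto simp: is_chart_def)
  then have inj: "inj_on (snd c) (fst c)" by (intro inj_on_inverseI[of _ \<psi>] homeomorphism_apply1)
  have "chart_inv c u = \<psi> u" if u: "u \<in> snd c ` fst c" for u
  proof -
    obtain p where p: "p \<in> fst c" "u = snd c p" using u by blast
    then show ?thesis using inv_into_f_f[OF inj p(1)] homeomorphism_apply1[OF \<psi> p(1)] by simp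
  qed
  then show "homeomorphism (fst c) (snd c ` fst c) (snd c) (chart_inv c)"
    by (intro homeomorphism_cong[OF \<psi>]) simp_all
qed

lemma chart_inj: "inj_on (snd c) (fst c)"
  by (rule inj_on_inverseI[of _ "chart_inv c"]) (rule homeomorphism_apply1[OF chart_homeomorphism])

lemma chart_inv_in: "u \<in> snd c ` fst c \<Longrightarrow> chart_inv c u \<in> fst c"
  and chart_inv_right: "u \<in> snd c ` fst c \<Longrightarrow> snd c (chart_inv c u) = u"
  by (rule inv_into_into, assumption) (rule f_inv_into_f)

lemma chart_inv_left: "p \<in> fst c \<Longrightarrow> chart_inv c (snd c p) = p"
  using chart_inj by (rule inv_into_f_f)

lemma chart_continuous: "continuous_on (fst c) (snd c)"
  and chart_inv_continuous: "continuous_on (snd c ` fst c) (chart_inv c)"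
  by (rule homeomorphism_cont1[OF chart_homeomorphism], rule homeomorphism_cont2[OF chart_homeomorphism])

lemma chart_image_open_sub: "open U \<Longrightarrow> U \<subseteq> fst c \<Longrightarrow> open (snd c ` U)"
  using homeomorphism_imp_open_map[OF chart_homeomorphism, of U] chart_open chart_image_open
  by (meson openin_open_eq)

lemma chart_inv_image_open: "open U \<Longrightarrow> U \<subseteq> snd c ` fst c \<Longrightarrow> open (chart_inv c ` U)"
  using homeomorphism_imp_open_map[OF homeomorphism_symD[OF chart_homeomorphism], of U]
    chart_open chart_image_open
  by (meson openin_open_eq)

lemma metric_continuous: "continuous_on (snd c ` fst c) (g c)"
  using manifold c unfolding riemannian_manifold_def riemannian_metric_def smooth_on_def
  by (metis Ck_on.simps(1))

lemma metric_pos: "u \<in> snd c ` fst c \<Longrightarrow> v \<noteq> 0 \<Longrightarrow> 0 < v \<bullet> (g c u *v v)"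
  using manifold c unfolding riemannian_manifold_def riemannian_metric_def by blast

lemma gnorm_nonneg: "u \<in> snd c ` fst c \<Longrightarrow> 0 \<le> gnorm c u v"
  using metric_pos[of u v] by (cases "v = 0") (auto simp: gnorm_def)

lemma gnorm_scaleR: "gnorm c u (r *\<^sub>R v) = \<bar>r\<bar> * gnorm c u v"
proof -
  have "(r *\<^sub>R v) \<bullet> (g c u *v (r *\<^sub>R v)) = r\<^sup>2 * (v \<bullet> (g c u *v v))"
    by (simp add: matrix_vector_mult_scaleR power2_eq_square)
  then show ?thesis by (simp add: gnorm_def real_sqrt_mult)
qed

lemma gnorm_continuous:
  assumes "continuous_on S u" "continuous_on S v" "u ` S \<subseteq> snd c ` fst c"
  shows "continuous_on S (\<lambda>s. gnorm c (u s) (v s))"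
  unfolding gnorm_def
  by (intro continuous_on_real_sqrt continuous_on_inner continuous_on_matrix_vector_mult assms
      continuous_on_compose2[OF metric_continuous assms(1,3)])

text \<open>
  By homogeneity it suffices to bound the norm on \<open>K\<close> times the unit sphere, where it is continuous
  and positive.
\<close>

lemma gnorm_bounds:
  assumes "compact K" "K \<subseteq> snd c ` fst c"
  obtains l L where "0 < l" "0 < L" "\<And>u v. u \<in> K \<Longrightarrow> l * norm v \<le> gnorm c u v"
    "\<And>u v. u \<in> K \<Longrightarrow> gnorm c u v \<le> L * norm v"
proof (cases "K = {}")
  case True
  then show ?thesis using that[of 1 1] by auto
next
  case False
  define P where "P = K \<times> sphere (0 :: real ^ 'n) 1"
  have P: "compact P" "P \<noteq> {}"
    using assms False unfolding P_def by (auto simp: compact_Times)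
  have cont: "continuous_on P (\<lambda>p. gnorm c (fst p) (snd p))"
    by (intro gnorm_continuous continuous_intros) (use assms in \<open>auto simp: P_def\<close>)
  obtain p where p: "p \<in> P" "\<And>q. q \<in> P \<Longrightarrow> gnorm c (fst p) (snd p) \<le> gnorm c (fst q) (snd q)"
    using continuous_attains_inf[OF P cont] by blast
  obtain r where r: "r \<in> P" "\<And>q. q \<in> P \<Longrightarrow> gnorm c (fst q) (snd q) \<le> gnorm c (fst r) (snd r)"
    using continuous_attains_sup[OF P cont] by blast
  have pos: "0 < gnorm c (fst q) (snd q)" if "q \<in> P" for q
    using that assms(2) metric_pos[of "fst q" "snd q"] by (force simp: P_def gnorm_def)
  have scale: "gnorm c u v = norm v * gnorm c u (v /\<^sub>R norm v)" if "v \<noteq> 0" for u v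
    using that gnorm_scaleR[of u "norm v" "v /\<^sub>R norm v"] by simp
  have memP: "(u, v /\<^sub>R norm v) \<in> P" if "u \<in> K" "v \<noteq> 0" for u v
    using that by (simp add: P_def)
  show ?thesis
  proof (rule that[OF pos[OF p(1)] pos[OF r(1)]])
    fix u v assume u: "u \<in> K"
    show "gnorm c (fst p) (snd p) * norm v \<le> gnorm c u v"
    proof (cases "v = 0")
      case False
      then show ?thesis
        using scale[OF False, of u] p(2)[OF memP[OF u False]] by (simp add: mult.commute)
    qed (simp add: gnorm_def)
    show "gnorm c u v \<le> gnorm c (fst r) (snd r) * norm v"
    proof (cases "v = 0")
      case False
      then show ?thesis
        using scale[OF False, of u] r(2)[OF memP[OF u False]] by (simp add: mult.commute)
    qed (simp add: gnorm_def)
  qed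
qed

end

lemma transition_Ck:
  assumes "c \<in> A" "d \<in> A"
  shows "Ck_on k (snd c ` (fst c \<inter> fst d)) (transition c d)"
  using manifold assms unfolding riemannian_manifold_def smooth_manifold_def smooth_on_def by blast

lemma transition_domain_open:
  assumes "c \<in> A" "d \<in> A"
  shows "open (snd c ` (fst c \<inter> fst d))"
  using chart_image_open_sub[OF assms(1)] chart_open assms by (simp add: open_Int)

lemma transition_eq: "c \<in> A \<Longrightarrow> p \<in> fst c \<Longrightarrow> transition c d (snd c p) = snd d p"
  by (simp add: transition_def chart_inv_left)

text \<open>
  Smooth paths without the requirement that they be nonconstant, which pieces of a smooth path and its
  reparametrizations may violate.
\<close>

definition smooth_curve :: "(real \<Rightarrow> 'a) \<Rightarrow> bool" where
  "smooth_curve \<gamma> \<longleftrightarrow> path \<gamma> \<and>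
     (\<forall>c\<in>A. \<forall>k. Ck_on k {t \<in> {0..1}. \<gamma> t \<in> fst c} (snd c \<circ> \<gamma>))"

lemma smooth_path_iff: "smooth_path A \<gamma> \<longleftrightarrow> smooth_curve \<gamma> \<and> \<not> \<gamma> constant_on {0..1}"
  unfolding smooth_path_def smooth_curve_def nonconst_path_def smooth_on_def by blast

lemma smooth_curve_path: "smooth_curve \<gamma> \<Longrightarrow> path \<gamma>"
  by (simp add: smooth_curve_def)

text \<open>
  The transformation law of the metric cancels the Jacobian of the transition map, so the chart chosen
  in the definition of the speed may be replaced by any other.
\<close>

lemma speed_in_chart:
  assumes "path \<gamma>" "c \<in> A" "t \<in> {0..1}" "\<gamma> t \<in> fst c"
    and v: "((snd c \<circ> \<gamma>) has_vector_derivative v) (at t within {0..1})"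
  shows "speed A g \<gamma> t = gnorm c (snd c (\<gamma> t)) v"
proof -
  define d where "d = (SOME d. d \<in> A \<and> \<gamma> t \<in> fst d)"
  have d: "d \<in> A" "\<gamma> t \<in> fst d"
    using someI_ex[of "\<lambda>d. d \<in> A \<and> \<gamma> t \<in> fst d"] assms(2,4) unfolding d_def by blast+
  define u where "u = snd c (\<gamma> t)"
  define U where "U = snd c ` (fst c \<inter> fst d)"
  have u: "u \<in> U" "open U"
    using assms d transition_domain_open[OF assms(2) d(1)] by (auto simp: u_def U_def)
  define D where "D = frechet_derivative (transition c d) (at u)"
  have "transition c d differentiable (at u within U)"
    using transition_Ck[OF assms(2) d(1), of "Suc 0"] u(1) unfolding U_def[symmetric] Ck_on.simps by blast
  then have D: "(transition c d has_derivative D) (at u)"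
    unfolding at_within_open[OF u] D_def by (simp only: frechet_derivative_works)
  define T where "T = {s \<in> {0..1}. \<gamma> s \<in> fst c}"
  have atT: "at t within T = at t within {0..1}"
    unfolding T_def by (rule at_within_times[OF assms(1) chart_open[OF assms(2)] assms(3,4)])
  have tT: "t \<in> T" using assms by (simp add: T_def)
  have "((transition c d \<circ> (snd c \<circ> \<gamma>)) has_vector_derivative D v) (at t within T)"
    using vector_derivative_diff_chain_within[of "snd c \<circ> \<gamma>" v t T "transition c d" D] v D
    by (simp add: atT u_def has_derivative_at_withinI)
  then have "((snd d \<circ> \<gamma>) has_vector_derivative D v) (at t within T)"
    by (rule has_vector_derivative_transform[OF tT, rotated])
       (auto simp: T_def transition_eq[OF assms(2)])
  then have *: "vector_derivative (snd d \<circ> \<gamma>) (at t within {0..1}) = D v"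
    unfolding atT using unit_interval_islimpt[OF assms(3)]
    by (intro vector_derivative_within) (auto simp: trivial_limit_within)
  have J: "matrix D *v v = D v"
    using D by (simp add: has_derivative_linear matrix_works)
  have "g c u = transpose (matrix D) ** g d (transition c d u) ** matrix D"
    using manifold assms(2) d(1) u unfolding riemannian_manifold_def riemannian_metric_def D_def U_def Let_def
    by blast
  then have "v \<bullet> (g c u *v v) = D v \<bullet> (g d (snd d (\<gamma> t)) *v D v)"
    by (simp add: inner_congruent_matrix J transition_eq[OF assms(2,4)] u_def)
  then show ?thesis
    by (simp add: speed_def Let_def d_def[symmetric] * gnorm_def u_def)
qed

lemma chart_derivative:
  assumes "smooth_curve \<gamma>" "c \<in> A"
  shows "\<exists>v. (\<forall>t\<in>{0..1}. \<gamma> t \<in> fst c \<longrightarrow> ((snd c \<circ> \<gamma>) has_vector_derivative v t) (at t within {0..1})) \<and>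
    continuous_on {t \<in> {0..1}. \<gamma> t \<in> fst c} v"
proof -
  note p = smooth_curve_path[OF assms(1)] and o = chart_open[OF assms(2)]
  define T where "T = {t \<in> {0..1}. \<gamma> t \<in> fst c}"
  have T: "x islimpt T" if "x \<in> T" for x
    using times_islimpt[OF p o] that unfolding T_def .
  have C: "Ck_on (Suc 0) T (snd c \<circ> \<gamma>)"
    using assms unfolding smooth_curve_def T_def by blast
  obtain v where v: "\<And>t. t \<in> T \<Longrightarrow> ((snd c \<circ> \<gamma>) has_vector_derivative v t) (at t within T)"
    "Ck_on 0 T v"
    using Ck_on_real_SucE[OF C T] by blast
  have v1: "((snd c \<circ> \<gamma>) has_vector_derivative v t) (at t within {0..1})"
    if t: "t \<in> {0..1}" "\<gamma> t \<in> fst c" for t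
    using v(1)[of t] t unfolding T_def at_within_times[OF p o t] by blast
  show ?thesis
    by (rule exI[of _ v]) (use v(2) v1 in \<open>simp add: T_def\<close>)
qed

text \<open>
  Continuity guarantees that lengths are genuine integrals, and not the default value of the integral
  of a function that is not integrable.
\<close>

lemma speed_continuous:
  assumes "smooth_curve \<gamma>"
  shows "continuous_on {0..1} (speed A g \<gamma>)"
  unfolding continuous_on_eq_continuous_within
proof
  fix t :: real assume t: "t \<in> {0..1}"
  obtain c where c: "c \<in> A" "\<gamma> t \<in> fst c" using chart_at .
  obtain v where v: "\<And>s. s \<in> {0..1} \<Longrightarrow> \<gamma> s \<in> fst c \<Longrightarrow> ((snd c \<circ> \<gamma>) has_vector_derivative v s) (at s within {0..1})"
    "continuous_on {t \<in> {0..1}. \<gamma> t \<in> fst c} v" using chart_derivative[OF assms c(1)] by blast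
  have p: "path \<gamma>" using assms by (rule smooth_curve_path)
  let ?T = "{t \<in> {0..1}. \<gamma> t \<in> fst c}"
  have "continuous_on ?T \<gamma>" using p unfolding path_def by (rule continuous_on_subset) auto
  then have "continuous_on ?T (\<lambda>s. gnorm c (snd c (\<gamma> s)) (v s))"
    by (intro gnorm_continuous[OF c(1)] v(2) continuous_on_compose2[OF chart_continuous[OF c(1)]]) auto
  then have "continuous_on ?T (speed A g \<gamma>)"
    by (rule continuous_on_eq) (use speed_in_chart[OF p c(1) _ _ v(1), symmetric] in simp)
  then have "continuous (at t within ?T) (speed A g \<gamma>)"
    using t c(2) unfolding continuous_on_eq_continuous_within by blast
  then show "continuous (at t within {0..1}) (speed A g \<gamma>)"
    unfolding at_within_times[OF p chart_open[OF c(1)] t c(2)] .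
qed

lemma speed_nonneg:
  assumes "smooth_curve \<gamma>" "t \<in> {0..1}"
  shows "0 \<le> speed A g \<gamma> t"
proof -
  obtain c where c: "c \<in> A" "\<gamma> t \<in> fst c" using chart_at .
  obtain v where v: "\<And>s. s \<in> {0..1} \<Longrightarrow> \<gamma> s \<in> fst c \<Longrightarrow> ((snd c \<circ> \<gamma>) has_vector_derivative v s) (at s within {0..1})"
    using chart_derivative[OF assms(1) c(1)] by blast
  have "snd c (\<gamma> t) \<in> snd c ` fst c" using c(2) by blast
  from gnorm_nonneg[OF c(1) this] show ?thesis
    unfolding speed_in_chart[OF smooth_curve_path[OF assms(1)] c(1) assms(2) c(2) v[OF assms(2) c(2)]] .
qed

lemma speed_cong:
  assumes "open W" "t \<in> W" "t \<in> {0..1}" and eq: "\<And>s. s \<in> {0..1} \<inter> W \<Longrightarrow> \<gamma> s = \<delta> s"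
  shows "speed A g \<gamma> t = speed A g \<delta> t"
proof -
  have "((f \<circ> \<gamma>) has_vector_derivative v) (at t within {0..1}) \<longleftrightarrow>
        ((f \<circ> \<delta>) has_vector_derivative v) (at t within {0..1})" for f :: "'a \<Rightarrow> real ^ 'n" and v
    unfolding at_within_Int_open_eq[OF assms(1,2), of "{0..1}", symmetric]
    using has_vector_derivative_transform[of t "{0..1} \<inter> W" "f \<circ> \<gamma>" "f \<circ> \<delta>"]
      has_vector_derivative_transform[of t "{0..1} \<inter> W" "f \<circ> \<delta>" "f \<circ> \<gamma>"] assms
    unfolding comp_def by (metis (no_types, lifting) IntI)
  then have "vector_derivative (f \<circ> \<gamma>) (at t within {0..1}) =
      vector_derivative (f \<circ> \<delta>) (at t within {0..1})" for f :: "'a \<Rightarrow> real ^ 'n"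
    by (simp add: vector_derivative_def)
  moreover have "\<gamma> t = \<delta> t" using assms by simp
  ultimately show ?thesis by (simp add: speed_def)
qed

section \<open>Reparametrization and concatenation of smooth curves\<close>

lemma smooth_curve_reparam:
  assumes \<gamma>: "smooth_curve \<gamma>" and h: "\<And>k. Ck_on k {0..1} h" "h ` {0..1} \<subseteq> {0..1}"
  shows "smooth_curve (\<gamma> \<circ> h)"
  unfolding smooth_curve_def
proof (intro conjI ballI allI)
  show p: "path (\<gamma> \<circ> h)"
    using continuous_on_compose[OF Ck_on_continuous[OF h(1)[of 0]], of \<gamma>]
      continuous_on_subset[OF _ h(2)] smooth_curve_path[OF \<gamma>] unfolding path_def by blast
  fix c k assume c: "c \<in> A"
  let ?S = "{t \<in> {0..1}. (\<gamma> \<circ> h) t \<in> fst c}" and ?T = "{t \<in> {0..1}. \<gamma> t \<in> fst c}"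
  have S: "x islimpt ?S" if "x \<in> ?S" for x using times_islimpt[OF p chart_open[OF c] that] .
  have sub: "h ` ?S \<subseteq> ?T" using h(2) by (auto simp: image_subset_iff)
  have hS: "Ck_on k ?S h" by (rule Ck_on_real_subset[OF S _ h(1)]) auto
  have "Ck_on k ?T (snd c \<circ> \<gamma>)" using \<gamma> c unfolding smooth_curve_def by blast
  from Ck_on_real_compose[OF S sub hS this]
  show "Ck_on k ?S (snd c \<circ> (\<gamma> \<circ> h))" by (simp add: o_def)
qed

lemma speed_reparam:
  assumes \<gamma>: "smooth_curve \<gamma>" and h: "\<And>k. Ck_on k {0..1} h" "h ` {0..1} \<subseteq> {0..1}"
    and t: "t \<in> {0..1}" and d: "(h has_real_derivative d) (at t within {0..1})"
  shows "speed A g (\<gamma> \<circ> h) t = \<bar>d\<bar> * speed A g \<gamma> (h t)"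
proof -
  obtain c where c: "c \<in> A" "\<gamma> (h t) \<in> fst c" using chart_at .
  have ht: "h t \<in> {0..1}" using h(2) t by blast
  obtain v where v: "((snd c \<circ> \<gamma>) has_vector_derivative v) (at (h t) within {0..1})"
    using chart_derivative[OF \<gamma> c(1)] ht c(2) by blast
  have "((snd c \<circ> \<gamma>) has_vector_derivative v) (at (h t) within h ` {0..1})"
    using has_vector_derivative_within_subset[OF v h(2)] .
  from vector_diff_chain_within[OF d[unfolded has_real_derivative_iff_has_vector_derivative] this]
  have "((snd c \<circ> (\<gamma> \<circ> h)) has_vector_derivative d *\<^sub>R v) (at t within {0..1})"
    by (simp only: comp_assoc)
  then have "speed A g (\<gamma> \<circ> h) t = gnorm c (snd c (\<gamma> (h t))) (d *\<^sub>R v)"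
    using speed_in_chart[OF smooth_curve_path[OF smooth_curve_reparam[OF \<gamma> h]] c(1) t] c(2)
    by (simp add: o_def)
  then show ?thesis
    by (simp add: gnorm_scaleR[OF c(1)] speed_in_chart[OF smooth_curve_path[OF \<gamma>] c(1) ht c(2) v])
qed

lemma length_reparam:
  assumes \<gamma>: "smooth_curve \<gamma>" and h: "\<And>k. Ck_on k {0..1} h" "h ` {0..1} \<subseteq> {0..1}"
    and d: "\<And>t. t \<in> {0..1} \<Longrightarrow> (h has_real_derivative d t) (at t within {0..1})"
  shows "(\<And>t. t \<in> {0..1} \<Longrightarrow> 0 \<le> d t) \<Longrightarrow> h 0 \<le> h 1 \<Longrightarrow>
           riem_length A g (\<gamma> \<circ> h) = integral {h 0..h 1} (speed A g \<gamma>)"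
    and "(\<And>t. t \<in> {0..1} \<Longrightarrow> d t \<le> 0) \<Longrightarrow> h 1 \<le> h 0 \<Longrightarrow>
           riem_length A g (\<gamma> \<circ> h) = integral {h 1..h 0} (speed A g \<gamma>)"
proof -
  have I: "((\<lambda>t. d t *\<^sub>R speed A g \<gamma> (h t)) has_integral
      (integral {h 0..h 1} (speed A g \<gamma>) - integral {h 1..h 0} (speed A g \<gamma>))) {0..1}"
    by (rule has_integral_substitution_general[of "{}", OF _ _ h(2) speed_continuous[OF \<gamma>]])
       (use d Ck_on_continuous[OF h(1)[of 0]] in auto)
  have sp: "speed A g (\<gamma> \<circ> h) t = \<bar>d t\<bar> * speed A g \<gamma> (h t)" if "t \<in> {0..1}" for t
    by (rule speed_reparam[OF \<gamma> h that d[OF that]])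
  have triv: "integral {b..a} (speed A g \<gamma>) = 0" if "a \<le> b" for a b :: real
    using that by (cases "a = b") auto
  {
    assume d0: "\<And>t. t \<in> {0..1} \<Longrightarrow> 0 \<le> d t" and le: "h 0 \<le> h 1"
    have "(speed A g (\<gamma> \<circ> h) has_integral integral {h 0..h 1} (speed A g \<gamma>)) {0..1}"
      using I unfolding triv[OF le] diff_0_right
      by (rule has_integral_eq[rotated]) (simp only: sp d0 abs_of_nonneg real_scaleR_def)
    then show "riem_length A g (\<gamma> \<circ> h) = integral {h 0..h 1} (speed A g \<gamma>)"
      unfolding riem_length_def by (rule integral_unique)
  }
  {
    assume d0: "\<And>t. t \<in> {0..1} \<Longrightarrow> d t \<le> 0" and le: "h 1 \<le> h 0"
    have "((\<lambda>t. - (d t *\<^sub>R speed A g \<gamma> (h t))) has_integral integral {h 1..h 0} (speed A g \<gamma>)) {0..1}"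
      using has_integral_neg[OF I] unfolding triv[OF le] by simp
    then have "(speed A g (\<gamma> \<circ> h) has_integral integral {h 1..h 0} (speed A g \<gamma>)) {0..1}"
      by (rule has_integral_eq[rotated])
         (simp only: sp d0 abs_of_nonpos real_scaleR_def mult_minus_left)
    then show "riem_length A g (\<gamma> \<circ> h) = integral {h 1..h 0} (speed A g \<gamma>)"
      unfolding riem_length_def by (rule integral_unique)
  }
qed

lemma speed_integrable:
  assumes "smooth_curve \<gamma>" "{a..b} \<subseteq> {0..1}"
  shows "speed A g \<gamma> integrable_on {a..b}"
  using assms by (intro integrable_continuous_real continuous_on_subset[OF speed_continuous])

lemma riem_length_nonneg: "smooth_curve \<gamma> \<Longrightarrow> 0 \<le> riem_length A g \<gamma>"
  unfolding riem_length_def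
  by (rule integral_nonneg[OF speed_integrable]) (use speed_nonneg in auto)

text \<open>
  Each of the two curves is traversed so that all derivatives vanish at the common end point.
\<close>

definition smooth_join :: "(real \<Rightarrow> 'a) \<Rightarrow> (real \<Rightarrow> 'a) \<Rightarrow> real \<Rightarrow> 'a" where
  "smooth_join \<gamma> \<delta> t = (if t \<le> 1 / 2 then \<gamma> (1 - flat (1 - 2 * t)) else \<delta> (flat (2 * t - 1)))"

lemma
  assumes \<gamma>: "smooth_curve \<gamma>" and \<delta>: "smooth_curve \<delta>" and eq: "\<gamma> 1 = \<delta> 0"
  shows smooth_curve_join: "smooth_curve (smooth_join \<gamma> \<delta>)"
    and length_join: "riem_length A g (smooth_join \<gamma> \<delta>) = riem_length A g \<gamma> + riem_length A g \<delta>"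
proof -
  define \<alpha> where "\<alpha> = \<gamma> \<circ> (\<lambda>t. 1 - flat (1 - 2 * t))"
  define \<beta> where "\<beta> = \<delta> \<circ> (\<lambda>t. flat (2 * t - 1))"
  define J where "J = smooth_join \<gamma> \<delta>"
  have \<alpha>: "smooth_curve \<alpha>" unfolding \<alpha>_def by (rule smooth_curve_reparam[OF \<gamma> flat_stop(1,2)])
  have \<beta>: "smooth_curve \<beta>" unfolding \<beta>_def by (rule smooth_curve_reparam[OF \<delta> flat_start(1,2)])
  have J: "J t = (if t \<le> 1 / 2 then \<alpha> t else \<beta> t)" for t
    by (simp add: J_def smooth_join_def \<alpha>_def \<beta>_def)
  define z where "z = \<gamma> 1"
  have \<alpha>z: "\<alpha> t = z" if "t \<ge> 1 / 2" for t
    using that by (simp add: \<alpha>_def z_def flat_le_0)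
  have \<beta>z: "\<beta> t = z" if "t \<le> 1 / 2" for t
    using that by (simp add: \<beta>_def z_def flat_le_0 eq)
  have pJ: "path J"
  proof -
    have "continuous_on {0..1} (\<lambda>t. if t \<le> 1 / 2 then \<alpha> t else \<beta> t)"
    proof (rule continuous_on_cases_le)
      show "continuous_on {t \<in> {0..1}. t \<le> 1 / 2} \<alpha>"
        by (rule continuous_on_subset[OF smooth_curve_path[OF \<alpha>, unfolded path_def]]) auto
      show "continuous_on {t \<in> {0..1}. 1 / 2 \<le> t} \<beta>"
        by (rule continuous_on_subset[OF smooth_curve_path[OF \<beta>, unfolded path_def]]) auto
    qed (use \<alpha>z \<beta>z in \<open>auto intro: continuous_on_id\<close>)
    then show ?thesis unfolding path_def J .
  qed
  show "smooth_curve (smooth_join \<gamma> \<delta>)"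
    unfolding J_def[symmetric] smooth_curve_def
  proof (intro conjI ballI allI pJ)
    fix c k assume c: "c \<in> A"
    let ?S = "{t \<in> {0..1}. J t \<in> fst c}"
    have lim: "x islimpt ?S" if "x \<in> ?S" for x
      by (rule times_islimpt[OF pJ chart_open[OF c] that])
    have C\<alpha>: "Ck_on k {t \<in> {0..1}. \<alpha> t \<in> fst c} (snd c \<circ> \<alpha>)"
      and C\<beta>: "Ck_on k {t \<in> {0..1}. \<beta> t \<in> fst c} (snd c \<circ> \<beta>)"
      using \<alpha> \<beta> c unfolding smooth_curve_def by blast+
    show "Ck_on k ?S (snd c \<circ> J)"
    proof (rule Ck_on_local)
      fix x assume x: "x \<in> ?S"
      consider "x < 1 / 2" | "x > 1 / 2" | "x = 1 / 2" by linarith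
      then show "\<exists>T. open T \<and> x \<in> T \<and> Ck_on k (?S \<inter> T) (snd c \<circ> J)"
      proof cases
        case 1
        have "?S \<inter> {..<1/2} = {t \<in> {0..1}. \<alpha> t \<in> fst c} \<inter> {..<1/2}" by (auto simp: J)
        moreover have "Ck_on k ({t \<in> {0..1}. \<alpha> t \<in> fst c} \<inter> {..<1/2}) (snd c \<circ> J)"
          by (rule Ck_on_cong[OF Ck_on_Int_open[OF C\<alpha>]]) (auto simp: J)
        ultimately show ?thesis using 1 by (intro exI[of _ "{..<1/2}"]) simp
      next
        case 2
        have "?S \<inter> {1/2<..} = {t \<in> {0..1}. \<beta> t \<in> fst c} \<inter> {1/2<..}" by (auto simp: J)
        moreover have "Ck_on k ({t \<in> {0..1}. \<beta> t \<in> fst c} \<inter> {1/2<..}) (snd c \<circ> J)"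
          by (rule Ck_on_cong[OF Ck_on_Int_open[OF C\<beta>]]) (auto simp: J)
        ultimately show ?thesis using 2 by (intro exI[of _ "{1/2<..}"]) simp
      next
        case 3
        then have "J (1 / 2) \<in> fst c" using x by blast
        then have z: "z \<in> fst c" using \<alpha>z[of "1/2"] by (simp add: J)
        obtain W\<alpha> where W\<alpha>: "open W\<alpha>" "{t \<in> {0..1}. \<alpha> t \<in> fst c} = {0..1} \<inter> W\<alpha>"
          using times_open[OF smooth_curve_path[OF \<alpha>] chart_open[OF c]] by blast
        obtain W\<beta> where W\<beta>: "open W\<beta>" "{t \<in> {0..1}. \<beta> t \<in> fst c} = {0..1} \<inter> W\<beta>"
          using times_open[OF smooth_curve_path[OF \<beta>] chart_open[OF c]] by blast
        define T where "T = W\<alpha> \<inter> W\<beta>"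
        have T: "open T" using W\<alpha> W\<beta> by (auto simp: T_def)
        have "1 / 2 \<in> {t \<in> {0..1}. \<alpha> t \<in> fst c}" "1 / 2 \<in> {t \<in> {0..1}. \<beta> t \<in> fst c}"
          using z \<alpha>z[of "1/2"] \<beta>z[of "1/2"] by auto
        then have xT: "x \<in> T" unfolding W\<alpha>(2) W\<beta>(2) T_def 3 by blast
        have limT: "t islimpt ?S \<inter> T" if t: "t \<in> ?S \<inter> T" for t
          using lim[of t] at_within_Int_open_eq[OF T, of t ?S] t
          by (metis (no_types, lifting) IntE trivial_limit_within)
        have sub\<alpha>: "?S \<inter> T \<subseteq> {t \<in> {0..1}. \<alpha> t \<in> fst c}" unfolding W\<alpha>(2) T_def by blast
        have sub\<beta>: "?S \<inter> T \<subseteq> {t \<in> {0..1}. \<beta> t \<in> fst c}" unfolding W\<beta>(2) T_def by blast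
        \<comment> \<open>near the joint one of the two halves rests at z, so in the chart the curve is their sum minus z\<close>
        have "Ck_on k (?S \<inter> T) (\<lambda>t. (snd c \<circ> \<alpha>) t + ((snd c \<circ> \<beta>) t + - snd c z))"
          by (intro Ck_on_real_add[OF limT] Ck_on_real_const[OF limT]
              Ck_on_real_subset[OF limT sub\<alpha> C\<alpha>] Ck_on_real_subset[OF limT sub\<beta> C\<beta>])
        then have "Ck_on k (?S \<inter> T) (snd c \<circ> J)"
          by (rule Ck_on_cong) (use \<alpha>z \<beta>z in \<open>simp add: J\<close>)
        then show ?thesis using T xT by blast
      qed
    qed
  qed
  have L\<alpha>: "riem_length A g \<alpha> = riem_length A g \<gamma>"
    using length_reparam(1)[OF \<gamma> flat_stop] flat'_nonneg
    by (simp add: \<alpha>_def flat_le_0 flat_1 riem_length_def)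
  have L\<beta>: "riem_length A g \<beta> = riem_length A g \<delta>"
    using length_reparam(1)[OF \<delta> flat_start] flat'_nonneg
    by (simp add: \<beta>_def flat_le_0 flat_1 riem_length_def)
  have sp: "speed A g J t = speed A g \<alpha> t + speed A g \<beta> t" if t: "t \<in> {0..1} - {1/2}" for t
  proof (cases "t < 1 / 2")
    case True
    have "speed A g J t = speed A g \<alpha> t"
      by (rule speed_cong[of "{..<1/2}"]) (use t True in \<open>auto simp: J\<close>)
    moreover have "speed A g \<beta> t = 0"
      using speed_reparam[OF \<delta> flat_start(1,2) _ flat_start(3), of t] t True
      by (simp add: \<beta>_def flat'_le_0)
    ultimately show ?thesis by simp
  next
    case False
    have "speed A g J t = speed A g \<beta> t"
      by (rule speed_cong[of "{1/2<..}"]) (use t False in \<open>auto simp: J\<close>)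
    moreover have "speed A g \<alpha> t = 0"
      using speed_reparam[OF \<gamma> flat_stop(1,2) _ flat_stop(3), of t] t False
      by (simp add: \<alpha>_def flat'_le_0)
    ultimately show ?thesis by simp
  qed
  have "((\<lambda>t. speed A g \<alpha> t + speed A g \<beta> t) has_integral (riem_length A g \<alpha> + riem_length A g \<beta>)) {0..1}"
    unfolding riem_length_def
    by (intro has_integral_add integrable_integral speed_integrable \<alpha> \<beta> order_refl)
  then have "(speed A g J has_integral (riem_length A g \<alpha> + riem_length A g \<beta>)) {0..1}"
    by (rule has_integral_spike_finite[of "{1/2}", rotated 2]) (use sp in auto)
  then show "riem_length A g (smooth_join \<gamma> \<delta>) = riem_length A g \<gamma> + riem_length A g \<delta>"
    unfolding L\<alpha> L\<beta> J_def riem_length_def[of _ _ "smooth_join \<gamma> \<delta>"] by (rule integral_unique)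
qed

section \<open>Points joined by short smooth paths\<close>

text \<open>
  \<open>reach I x y a\<close> says that the infimum of the lengths of paths in \<open>I\<close> from \<open>x\<close> to \<open>y\<close> is less
  than \<open>a\<close>; see \<open>intr_dist_less_iff\<close>. Stated with real bounds, the estimates stay clear of extended
  arithmetic.
\<close>

definition reach :: "'a set \<Rightarrow> 'a \<Rightarrow> 'a \<Rightarrow> real \<Rightarrow> bool" where
  "reach I x y a \<longleftrightarrow> (\<exists>\<gamma>. smooth_path A \<gamma> \<and> path_image \<gamma> \<subseteq> I \<and>
     pathstart \<gamma> = x \<and> pathfinish \<gamma> = y \<and> riem_length A g \<gamma> < a)"

lemma reach_mono: "reach I x y a \<Longrightarrow> a \<le> b \<Longrightarrow> reach I x y b"
  unfolding reach_def by fastforce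

lemma reach_trans:
  assumes "reach I x y a" "reach I y z b"
  shows "reach I x z (a + b)"
proof -
  obtain \<gamma> where \<gamma>: "smooth_path A \<gamma>" "path_image \<gamma> \<subseteq> I" "pathstart \<gamma> = x" "pathfinish \<gamma> = y"
    "riem_length A g \<gamma> < a" using assms(1) unfolding reach_def by blast
  obtain \<delta> where \<delta>: "smooth_path A \<delta>" "path_image \<delta> \<subseteq> I" "pathstart \<delta> = y" "pathfinish \<delta> = z"
    "riem_length A g \<delta> < b" using assms(2) unfolding reach_def by blast
  have s: "smooth_curve \<gamma>" "smooth_curve \<delta>" and nc: "\<not> \<gamma> constant_on {0..1}"
    using \<gamma>(1) \<delta>(1) unfolding smooth_path_iff by auto
  have eq: "\<gamma> 1 = \<delta> 0" using \<gamma>(4) \<delta>(3) by (simp add: pathstart_def pathfinish_def)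
  let ?J = "smooth_join \<gamma> \<delta>"
  have onto: "\<exists>t\<in>{0..1}. t \<le> 1 / 2 \<and> \<gamma> s = ?J t" if s: "s \<in> {0..1}" for s
  proof -
    have "continuous_on {0..1/2} (\<lambda>t. 1 - flat (1 - 2 * t))"
      by (rule continuous_on_subset[OF Ck_on_continuous[OF flat_stop(1)[of 0]]]) auto
    then have "\<exists>t\<ge>0. t \<le> 1 / 2 \<and> 1 - flat (1 - 2 * t) = s"
      by (intro IVT') (use s in \<open>auto simp: flat_1 flat_le_0\<close>)
    then obtain t where t: "0 \<le> t" "t \<le> 1 / 2" "1 - flat (1 - 2 * t) = s" by blast
    then have "\<gamma> s = ?J t" by (simp add: smooth_join_def)
    then show ?thesis using t by (intro bexI[of _ t]) auto
  qed
  have "\<not> ?J constant_on {0..1}"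
  proof
    assume "?J constant_on {0..1}"
    then obtain w where "?J t = w" if "t \<in> {0..1}" for t unfolding constant_on_def by blast
    then have "\<gamma> s = w" if "s \<in> {0..1}" for s using onto[OF that] by metis
    then show False using nc unfolding constant_on_def by blast
  qed
  then have "smooth_path A ?J" using smooth_curve_join[OF s eq] by (simp add: smooth_path_iff)
  moreover have "path_image ?J \<subseteq> I"
  proof
    fix p assume "p \<in> path_image ?J"
    then obtain t where t: "t \<in> {0..1}" "p = ?J t" unfolding path_image_def by blast
    have "1 - flat (1 - 2 * t) \<in> {0..1}" "flat (2 * t - 1) \<in> {0..1}"
      using flat_stop(2) flat_start(2) t(1) by blast+
    then have "p \<in> path_image \<gamma> \<union> path_image \<delta>"
      unfolding t(2) smooth_join_def path_image_def by (cases "t \<le> 1 / 2") (simp_all del: atLeastAtMost_iff)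
    then show "p \<in> I" using \<gamma>(2) \<delta>(2) by blast
  qed
  moreover have "pathstart ?J = x" "pathfinish ?J = z"
    using \<gamma>(3) \<delta>(4) by (simp_all add: pathstart_def pathfinish_def smooth_join_def flat_1)
  moreover have "riem_length A g ?J < a + b"
    using length_join[OF s eq] \<gamma>(5) \<delta>(5) by simp
  ultimately show ?thesis unfolding reach_def by blast
qed

lemma reach_sym:
  assumes "reach I x y a"
  shows "reach I y x a"
proof -
  obtain \<gamma> where \<gamma>: "smooth_path A \<gamma>" "path_image \<gamma> \<subseteq> I" "pathstart \<gamma> = x" "pathfinish \<gamma> = y"
    "riem_length A g \<gamma> < a" using assms(1) unfolding reach_def by blast
  define h :: "real \<Rightarrow> real" where "h = (\<lambda>t. 1 + t *\<^sub>R (- 1))"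
  have s: "smooth_curve \<gamma>" and nc: "\<not> \<gamma> constant_on {0..1}"
    using \<gamma>(1) unfolding smooth_path_iff by auto
  have h: "Ck_on k {0..1} h" "h ` {0..1} \<subseteq> {0..1}" for k
    unfolding h_def by (rule Ck_on_real_affine[OF unit_interval_islimpt]) auto
  have hd: "(h has_real_derivative - 1) (at t within {0..1})" for t
    unfolding h_def by (auto intro!: derivative_eq_intros)
  have hh: "h (h t) = t" "t \<in> {0..1} \<Longrightarrow> h t \<in> {0..1}" for t by (auto simp: h_def)
  have "\<not> (\<gamma> \<circ> h) constant_on {0..1}"
  proof
    assume "(\<gamma> \<circ> h) constant_on {0..1}"
    then obtain w where w: "\<And>t. t \<in> {0..1} \<Longrightarrow> \<gamma> (h t) = w" unfolding constant_on_def by auto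
    have "\<gamma> t = w" if "t \<in> {0..1}" for t using w[OF hh(2)[OF that]] hh(1) by simp
    then show False using nc unfolding constant_on_def by blast
  qed
  then have "smooth_path A (\<gamma> \<circ> h)" using smooth_curve_reparam[OF s h] by (simp add: smooth_path_iff)
  moreover have "path_image (\<gamma> \<circ> h) \<subseteq> I"
    using \<gamma>(2) hh(2) unfolding path_image_def by auto
  moreover have "pathstart (\<gamma> \<circ> h) = y" "pathfinish (\<gamma> \<circ> h) = x"
    using \<gamma>(3,4) by (simp_all add: pathstart_def pathfinish_def h_def)
  moreover have "riem_length A g (\<gamma> \<circ> h) < a"
    using length_reparam(2)[OF s h hd] \<gamma>(5) by (simp add: h_def riem_length_def)
  ultimately show ?thesis unfolding reach_def by blast
qed

text \<open>
  A smooth curve \<open>\<alpha>\<close> in coordinates is carried to the manifold; its length is at most the bound \<open>L\<close> of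
  the metric times the bound \<open>M\<close> of the coordinate speed. It is used for segments and circular arcs.
\<close>

lemma reach_chart:
  assumes c: "c \<in> A" and \<alpha>: "\<And>k. Ck_on k {0..1} \<alpha>" "\<alpha> ` {0..1} \<subseteq> snd c ` fst c"
    and d: "\<And>t. t \<in> {0..1} \<Longrightarrow> (\<alpha> has_vector_derivative \<alpha>' t) (at t within {0..1})"
    and M: "\<And>t. t \<in> {0..1} \<Longrightarrow> norm (\<alpha>' t) \<le> M"
    and L: "\<And>t v. t \<in> {0..1} \<Longrightarrow> gnorm c (\<alpha> t) v \<le> L * norm v" "0 \<le> L"
    and I: "\<And>t. t \<in> {0..1} \<Longrightarrow> chart_inv c (\<alpha> t) \<in> I"
    and neq: "\<alpha> 0 \<noteq> \<alpha> 1" and e: "L * M < e"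
  shows "reach I (chart_inv c (\<alpha> 0)) (chart_inv c (\<alpha> 1)) e"
proof -
  define \<gamma> where "\<gamma> = chart_inv c \<circ> \<alpha>"
  have \<alpha>in: "\<alpha> t \<in> snd c ` fst c" if "t \<in> {0..1}" for t using \<alpha>(2) that by blast
  have \<gamma>in: "\<gamma> t \<in> fst c" and \<gamma>\<alpha>: "snd c (\<gamma> t) = \<alpha> t" if "t \<in> {0..1}" for t
    using chart_inv_in[OF c \<alpha>in[OF that]] chart_inv_right[OF c \<alpha>in[OF that]] by (simp_all add: \<gamma>_def)
  have p: "path \<gamma>" unfolding path_def \<gamma>_def
    by (rule continuous_on_compose[OF Ck_on_continuous[OF \<alpha>(1)[of 0]]])
       (rule continuous_on_subset[OF chart_inv_continuous[OF c] \<alpha>(2)])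
  have s: "smooth_curve \<gamma>" unfolding smooth_curve_def
  proof (intro conjI ballI allI p)
    fix d k assume dA: "d \<in> A"
    let ?S = "{t \<in> {0..1}. \<gamma> t \<in> fst d}"
    have S: "t islimpt ?S" if "t \<in> ?S" for t by (rule times_islimpt[OF p chart_open[OF dA] that])
    have sub: "\<alpha> ` ?S \<subseteq> snd c ` (fst c \<inter> fst d)"
    proof
      fix u assume "u \<in> \<alpha> ` ?S"
      then obtain t where t: "t \<in> {0..1}" "\<gamma> t \<in> fst d" "u = \<alpha> t" by blast
      then show "u \<in> snd c ` (fst c \<inter> fst d)" using \<gamma>in[OF t(1)] \<gamma>\<alpha>[OF t(1)] by (metis IntI imageI)
    qed
    have "Ck_on k ?S \<alpha>" by (rule Ck_on_real_subset[OF S _ \<alpha>(1)]) auto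
    from Ck_on_real_compose[OF S sub this transition_Ck[OF c dA]]
    show "Ck_on k ?S (snd d \<circ> \<gamma>)"
      by (simp add: o_def \<gamma>_def transition_def)
  qed
  have sp: "speed A g \<gamma> t \<le> L * M" if t: "t \<in> {0..1}" for t
  proof -
    have "((snd c \<circ> \<gamma>) has_vector_derivative \<alpha>' t) (at t within {0..1})"
      by (rule has_vector_derivative_transform[OF t _ d[OF t]]) (simp add: \<gamma>\<alpha>)
    then have "speed A g \<gamma> t = gnorm c (\<alpha> t) (\<alpha>' t)"
      using speed_in_chart[OF p c t \<gamma>in[OF t]] \<gamma>\<alpha>[OF t] by simp
    also have "\<dots> \<le> L * norm (\<alpha>' t)" by (rule L(1)[OF t])
    also have "\<dots> \<le> L * M" using M[OF t] L(2) by (rule mult_left_mono)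
    finally show ?thesis .
  qed
  have "riem_length A g \<gamma> \<le> integral {0..1} (\<lambda>t::real. L * M)"
    unfolding riem_length_def
    by (rule integral_le[OF speed_integrable[OF s]]) (use sp in auto)
  then have "riem_length A g \<gamma> < e" using e by simp
  moreover have "smooth_path A \<gamma>"
    unfolding smooth_path_iff
  proof (intro conjI s notI)
    assume "\<gamma> constant_on {0..1}"
    then have "\<gamma> 0 = \<gamma> 1" unfolding constant_on_def by fastforce
    then show False using neq \<gamma>\<alpha>[of 0] \<gamma>\<alpha>[of 1] by simp
  qed
  moreover have "path_image \<gamma> \<subseteq> I" using I by (auto simp: path_image_def \<gamma>_def)
  moreover have "pathstart \<gamma> = chart_inv c (\<alpha> 0)" "pathfinish \<gamma> = chart_inv c (\<alpha> 1)"
    by (simp_all add: pathstart_def pathfinish_def \<gamma>_def)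
  ultimately show ?thesis unfolding reach_def by blast
qed

text \<open>
  Coordinate segments in a small ball do the job for distinct points. Constant paths are not admitted,
  so a point is joined to itself by running along a segment and back.
\<close>

lemma reach_nbhd:
  assumes "open I" "p \<in> I" "0 < e"
  shows "\<exists>N. open N \<and> p \<in> N \<and> N \<subseteq> I \<and> (\<forall>x\<in>N. \<forall>y\<in>N. reach I x y e)"
proof -
  obtain c where c: "c \<in> A" "p \<in> fst c" using chart_at .
  define U where "U = snd c ` (I \<inter> fst c)"
  have "open U" unfolding U_def
    using chart_image_open_sub[OF c(1), of "I \<inter> fst c"] chart_open[OF c(1)] assms(1) by (simp add: open_Int)
  moreover have "snd c p \<in> U" using c assms by (simp add: U_def)
  ultimately obtain r where r: "0 < r" "cball (snd c p) r \<subseteq> U" using open_contains_cball by blast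
  have U: "U \<subseteq> snd c ` fst c" by (auto simp: U_def)
  have UI: "chart_inv c u \<in> I" if "u \<in> U" for u
    using that chart_inv_left[OF c(1)] by (auto simp: U_def)
  obtain L where L: "0 < L" "\<And>u v. u \<in> cball (snd c p) r \<Longrightarrow> gnorm c u v \<le> L * norm v"
    using gnorm_bounds[OF c(1) compact_cball, of "snd c p" r] r(2) U by (metis order_trans)
  define s where "s = min r (e / (8 * L))"
  have s: "0 < s" "s \<le> r" "L * (2 * s) < e / 2"
  proof -
    show "0 < s" "s \<le> r" using r L assms by (auto simp: s_def)
    have "L * (2 * s) \<le> L * (2 * (e / (8 * L)))"
      using L by (intro mult_left_mono) (auto simp: s_def)
    also have "\<dots> < e / 2" using L assms by simp
    finally show "L * (2 * s) < e / 2" .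
  qed
  let ?B = "ball (snd c p) s"
  have B: "?B \<subseteq> cball (snd c p) r" using s(2) by auto
  have seg: "reach I (chart_inv c u) (chart_inv c v) (e / 2)" if uv: "u \<in> ?B" "v \<in> ?B" "u \<noteq> v" for u v
  proof -
    define \<alpha> where "\<alpha> = (\<lambda>t. u + t *\<^sub>R (v - u))"
    have \<alpha>B: "\<alpha> t \<in> ?B" if t: "t \<in> {0..1}" for t
    proof -
      have "(1 - t) *\<^sub>R u + t *\<^sub>R v \<in> ?B"
        using convexD[OF convex_ball uv(1,2), of "1 - t" t] t by simp
      then show ?thesis by (simp add: \<alpha>_def algebra_simps)
    qed
    have "reach I (chart_inv c (\<alpha> 0)) (chart_inv c (\<alpha> 1)) (e / 2)"
    proof (rule reach_chart[OF c(1), where M="2 * s" and L=L and \<alpha>'="\<lambda>t. v - u"])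
      show "Ck_on k {0..1} \<alpha>" for k
        unfolding \<alpha>_def by (rule Ck_on_real_affine[OF unit_interval_islimpt])
      show "\<alpha> ` {0..1} \<subseteq> snd c ` fst c" using \<alpha>B B r(2) U by blast
      show "(\<alpha> has_vector_derivative v - u) (at t within {0..1})" for t
        unfolding \<alpha>_def by (auto intro!: derivative_eq_intros)
      have "dist u v \<le> dist (snd c p) u + dist (snd c p) v" by (rule dist_triangle3)
      then show "norm (v - u) \<le> 2 * s" using uv by (simp add: dist_norm norm_minus_commute)
      show "gnorm c (\<alpha> t) w \<le> L * norm w" if "t \<in> {0..1}" for t w
        using L(2) \<alpha>B[OF that] B by blast
      show "chart_inv c (\<alpha> t) \<in> I" if "t \<in> {0..1}" for t
        using \<alpha>B[OF that] B r(2) by (intro UI) blast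
    qed (use L s uv in \<open>auto simp: \<alpha>_def\<close>)
    then show ?thesis by (simp add: \<alpha>_def)
  qed
  define N where "N = chart_inv c ` ?B"
  have "open N" unfolding N_def by (rule chart_inv_image_open[OF c(1)]) (use B r(2) U in auto)
  moreover have "p \<in> N"
    unfolding N_def using chart_inv_left[OF c] s(1) by (metis centre_in_ball imageI)
  moreover have "N \<subseteq> I" unfolding N_def using UI B r(2) by blast
  moreover have "reach I x y e" if xy: "x \<in> N" "y \<in> N" for x y
  proof -
    obtain u v where uv: "u \<in> ?B" "x = chart_inv c u" "v \<in> ?B" "y = chart_inv c v"
      using xy unfolding N_def by blast
    show ?thesis
    proof (cases "u = v")
      case False
      then show ?thesis using reach_mono[OF seg[OF uv(1,3)]] assms(3) uv by simp
    next
      case True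
      have "?B \<noteq> {u}" using not_open_singleton[of u] open_ball[of "snd c p" s] by metis
      then obtain w where w: "w \<in> ?B" "w \<noteq> u" using uv(1) by blast
      have "reach I (chart_inv c u) (chart_inv c u) (e / 2 + e / 2)"
        by (rule reach_trans[OF seg[OF uv(1) w(1)] seg[OF w(1) uv(1)]]) (use w in auto)
      then show ?thesis using True uv by simp
    qed
  qed
  ultimately show ?thesis by blast
qed

lemma reach_refl: "open I \<Longrightarrow> p \<in> I \<Longrightarrow> 0 < e \<Longrightarrow> reach I p p e"
  using reach_nbhd[of I p e] by blast

text \<open>
  A piece of a path may be constant, and then the statement is about a short path from a point to
  itself.
\<close>

lemma reach_subpath:
  assumes I: "open I" and \<gamma>: "smooth_curve \<gamma>" "path_image \<gamma> \<subseteq> I"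
    and ab: "0 \<le> a" "a \<le> b" "b \<le> 1" and e: "integral {a..b} (speed A g \<gamma>) < e"
  shows "reach I (\<gamma> a) (\<gamma> b) e"
proof -
  define h :: "real \<Rightarrow> real" where "h = (\<lambda>t. a + t *\<^sub>R (b - a))"
  have hin: "h t \<in> {0..1}" if t: "t \<in> {0..1}" for t
  proof -
    have "t * (b - a) \<le> 1 * (b - a)" using t ab by (intro mult_right_mono) auto
    then show ?thesis using t ab by (simp add: h_def)
  qed
  have h: "Ck_on k {0..1} h" "h ` {0..1} \<subseteq> {0..1}" for k
  proof -
    show "Ck_on k {0..1} h" unfolding h_def by (rule Ck_on_real_affine[OF unit_interval_islimpt])
    show "h ` {0..1} \<subseteq> {0..1}" using hin by (rule image_subsetI)
  qed
  have hd: "(h has_real_derivative b - a) (at t within {0..1})" for t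
    unfolding h_def by (auto intro!: derivative_eq_intros)
  have h01: "h 0 = a" "h 1 = b" by (simp_all add: h_def)
  have "riem_length A g (\<gamma> \<circ> h) = integral {a..b} (speed A g \<gamma>)"
    using length_reparam(1)[OF \<gamma>(1) h hd] ab h01 by simp
  then have len: "riem_length A g (\<gamma> \<circ> h) < e" using e by simp
  have s: "smooth_curve (\<gamma> \<circ> h)" by (rule smooth_curve_reparam[OF \<gamma>(1) h])
  have img: "path_image (\<gamma> \<circ> h) \<subseteq> I" using \<gamma>(2) hin by (auto simp: path_image_def)
  show ?thesis
  proof (cases "(\<gamma> \<circ> h) constant_on {0..1}")
    case True
    then have "(\<gamma> \<circ> h) 0 = (\<gamma> \<circ> h) 1" unfolding constant_on_def by fastforce
    then have "\<gamma> a = \<gamma> b" by (simp add: h01)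
    moreover have "0 < e" using riem_length_nonneg[OF s] len by simp
    moreover have "\<gamma> a \<in> I" using \<gamma>(2) ab by (auto simp: path_image_def)
    ultimately show ?thesis using reach_refl[OF I] by simp
  next
    case False
    then have "smooth_path A (\<gamma> \<circ> h)" using s by (simp add: smooth_path_iff)
    moreover have "pathstart (\<gamma> \<circ> h) = \<gamma> a" "pathfinish (\<gamma> \<circ> h) = \<gamma> b"
      by (simp_all add: pathstart_def pathfinish_def h01)
    ultimately show ?thesis using img len unfolding reach_def by blast
  qed
qed

text \<open>
  Up to its first exit from a coordinate ball of radius \<open>r\<close>, a path that starts in the ball of radius
  \<open>r / 2\<close> travels the coordinate distance \<open>r / 2\<close>, and there the metric dominates a multiple \<open>l\<close> of the
  Euclidean one. The target set is an open set \<open>V\<close>, larger than the complement of \<open>N\<close>, so that the bound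
  survives in the limit that defines \<open>\<rho>\<^sub>Y\<close>.
\<close>

lemma length_lower_bound:
  assumes "open N" "q \<in> N"
  shows "\<exists>W V \<delta>. open W \<and> q \<in> W \<and> open V \<and> - N \<subseteq> V \<and> 0 < \<delta> \<and>
    (\<forall>I x y. x \<in> W \<longrightarrow> y \<in> V \<longrightarrow> \<not> reach I x y \<delta>)"
proof -
  obtain c where c: "c \<in> A" "q \<in> fst c" using chart_at .
  define U where "U = snd c ` (N \<inter> fst c)"
  have "open U" unfolding U_def
    using chart_image_open_sub[OF c(1), of "N \<inter> fst c"] chart_open[OF c(1)] assms(1) by (simp add: open_Int)
  moreover have "snd c q \<in> U" using c assms by (simp add: U_def)
  ultimately obtain r where r: "0 < r" "cball (snd c q) r \<subseteq> U" using open_contains_cball by blast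
  have U: "U \<subseteq> snd c ` fst c" by (auto simp: U_def)
  have UN: "chart_inv c u \<in> N" if "u \<in> U" for u
    using that chart_inv_left[OF c(1)] by (auto simp: U_def)
  define K where "K = chart_inv c ` cball (snd c q) r"
  define Q where "Q = chart_inv c ` ball (snd c q) r"
  define W where "W = chart_inv c ` ball (snd c q) (r / 2)"
  have cU: "cball (snd c q) r \<subseteq> snd c ` fst c" using r(2) U by blast
  have bU: "ball (snd c q) r \<subseteq> snd c ` fst c" using cU by (meson ball_subset_cball order_trans)
  have "ball (snd c q) (r / 2) \<subseteq> ball (snd c q) r" using r(1) by (intro subset_ball) simp
  then have WQ: "W \<subseteq> Q" and bU2: "ball (snd c q) (r / 2) \<subseteq> snd c ` fst c"
    using bU unfolding W_def Q_def by blast+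
  have "compact K" unfolding K_def
    by (rule compact_continuous_image[OF continuous_on_subset[OF chart_inv_continuous[OF c(1)] cU] compact_cball])
  then have Kc: "closed K" by (rule compact_imp_closed)
  have Qo: "open Q" unfolding Q_def by (rule chart_inv_image_open[OF c(1) open_ball bU])
  have Wo: "open W" unfolding W_def by (rule chart_inv_image_open[OF c(1) open_ball bU2])
  have QK: "Q \<subseteq> K" unfolding Q_def K_def by (rule image_mono[OF ball_subset_cball])
  have qW: "q \<in> W" unfolding W_def using chart_inv_left[OF c] r(1)
    by (metis centre_in_ball half_gt_zero imageI)
  have KN: "K \<subseteq> N" unfolding K_def using UN r(2) by blast
  have Kin: "p \<in> fst c \<and> snd c p \<in> cball (snd c q) r" if "p \<in> K" for p
  proof -
    obtain u where u: "u \<in> cball (snd c q) r" "p = chart_inv c u" using \<open>p \<in> K\<close> unfolding K_def by blast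
    then have "u \<in> snd c ` fst c" using cU by blast
    then show ?thesis using u chart_inv_in[OF c(1)] chart_inv_right[OF c(1)] by simp
  qed
  obtain l where l: "0 < l" "\<And>u v. u \<in> cball (snd c q) r \<Longrightarrow> l * norm v \<le> gnorm c u v"
    using gnorm_bounds[OF c(1) compact_cball cU] by metis
  have far: "\<not> reach I x y (l * (r / 2))" if xy: "x \<in> W" "y \<in> - K" for I x y
  proof
    assume "reach I x y (l * (r / 2))"
    then obtain \<gamma> where \<gamma>: "smooth_curve \<gamma>" "\<gamma> 0 = x" "\<gamma> 1 = y" "riem_length A g \<gamma> < l * (r / 2)"
      unfolding reach_def smooth_path_iff pathstart_def pathfinish_def by blast
    have p: "continuous_on {0..1} \<gamma>" using smooth_curve_path[OF \<gamma>(1)] by (simp add: path_def)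
    define E where "E = {0..1} \<inter> \<gamma> -` (- Q)"
    have "closed E" unfolding E_def using Qo by (intro continuous_closed_preimage[OF p]) auto
    then have "compact E" unfolding E_def by (metis bounded_Int bounded_closed_interval compact_eq_bounded_closed cbox_interval)
    moreover have "1 \<in> E" using \<gamma>(3) xy QK by (auto simp: E_def)
    ultimately obtain \<tau> where \<tau>: "\<tau> \<in> E" "\<And>t. t \<in> E \<Longrightarrow> \<tau> \<le> t"
      using compact_attains_inf[of E] by blast
    have \<tau>01: "\<tau> \<in> {0..1}" "\<gamma> \<tau> \<notin> Q" using \<tau>(1) by (auto simp: E_def)
    have "\<gamma> 0 \<in> Q" using \<gamma>(2) xy WQ by blast
    then have \<tau>0: "0 < \<tau>" using \<tau>01 by (metis atLeastAtMost_iff less_eq_real_def)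
    have "\<gamma> ` {0..<\<tau>} \<subseteq> K"
    proof
      fix p assume "p \<in> \<gamma> ` {0..<\<tau>}"
      then obtain t where t: "0 \<le> t" "t < \<tau>" "p = \<gamma> t" by auto
      then have "t \<notin> E" using \<tau>(2) by force
      then have "\<gamma> t \<in> Q" using t \<tau>01(1) by (auto simp: E_def)
      then show "p \<in> K" using QK t by blast
    qed
    then have "\<gamma> ` closure {0..<\<tau>} \<subseteq> K"
      by (intro image_closure_subset[OF continuous_on_subset[OF p] Kc]) (use \<tau>0 \<tau>01 in auto)
    then have \<gamma>K: "\<gamma> t \<in> K" if "t \<in> {0..\<tau>}" for t using that \<tau>0 by auto
    obtain v where v: "\<And>t. t \<in> {0..1} \<Longrightarrow> \<gamma> t \<in> fst c \<Longrightarrow>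
      ((snd c \<circ> \<gamma>) has_vector_derivative v t) (at t within {0..1})"
      using chart_derivative[OF \<gamma>(1) c(1)] by blast
    have sub: "{0..\<tau>} \<subseteq> {0..1}" using \<tau>01 by auto
    have vt: "((snd c \<circ> \<gamma>) has_vector_derivative v t) (at t within {0..\<tau>})" if t: "t \<in> {0..\<tau>}" for t
      using has_vector_derivative_within_subset[OF v sub] Kin[OF \<gamma>K[OF t]] sub t by blast
    have int: "(v has_integral ((snd c \<circ> \<gamma>) \<tau> - (snd c \<circ> \<gamma>) 0)) {0..\<tau>}"
      by (rule fundamental_theorem_of_calculus[OF _ vt]) (use \<tau>0 in auto)
    have spi: "speed A g \<gamma> integrable_on {0..\<tau>}" by (rule speed_integrable[OF \<gamma>(1) sub])
    have "norm (integral {0..\<tau>} v) \<le> integral {0..\<tau>} (\<lambda>t. speed A g \<gamma> t / l)"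
    proof (rule integral_norm_bound_integral)
      show "v integrable_on {0..\<tau>}" using int by blast
      show "(\<lambda>t. speed A g \<gamma> t / l) integrable_on {0..\<tau>}"
        using integrable_cmul[OF spi, of "inverse l"] by (simp add: divide_inverse mult.commute)
      fix t assume t: "t \<in> {0..\<tau>}"
      have k: "\<gamma> t \<in> fst c" "snd c (\<gamma> t) \<in> cball (snd c q) r" using Kin[OF \<gamma>K[OF t]] by auto
      have t1: "t \<in> {0..1}" using t sub by blast
      have "speed A g \<gamma> t = gnorm c (snd c (\<gamma> t)) (v t)"
        by (rule speed_in_chart[OF smooth_curve_path[OF \<gamma>(1)] c(1) t1 k(1) v[OF t1 k(1)]])
      then show "norm (v t) \<le> speed A g \<gamma> t / l"
        using l(2)[OF k(2), of "v t"] l(1) by (simp add: field_simps)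
    qed
    also have "\<dots> = integral {0..\<tau>} (speed A g \<gamma>) / l" by simp
    also have "\<dots> \<le> riem_length A g \<gamma> / l"
      unfolding riem_length_def
      by (intro divide_right_mono integral_subset_le[OF sub spi])
         (use l(1) speed_integrable[OF \<gamma>(1)] speed_nonneg[OF \<gamma>(1)] in auto)
    also have "\<dots> < r / 2" using \<gamma>(4) l(1) by (simp add: field_simps)
    finally have "norm ((snd c \<circ> \<gamma>) \<tau> - (snd c \<circ> \<gamma>) 0) < r / 2"
      using integral_unique[OF int] by simp
    then have d1: "dist (snd c (\<gamma> 0)) (snd c (\<gamma> \<tau>)) < r / 2" by (simp add: dist_norm norm_minus_commute)
    have d2: "dist (snd c q) (snd c (\<gamma> 0)) < r / 2"
    proof -
      obtain u where u: "u \<in> ball (snd c q) (r / 2)" "\<gamma> 0 = chart_inv c u"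
        using \<gamma>(2) xy(1) unfolding W_def by blast
      then show ?thesis using chart_inv_right[OF c(1), of u] bU2 by auto
    qed
    have "snd c (\<gamma> \<tau>) \<in> ball (snd c q) r"
      using d1 d2 dist_triangle[of "snd c q" "snd c (\<gamma> \<tau>)" "snd c (\<gamma> 0)"] by simp
    moreover have "\<gamma> \<tau> \<in> fst c" using Kin \<gamma>K[of \<tau>] \<tau>0 by auto
    ultimately have "\<gamma> \<tau> \<in> Q" unfolding Q_def by (metis chart_inv_left[OF c(1)] imageI)
    then show False using \<tau>01 by blast
  qed
  show ?thesis
    by (rule exI[of _ W], rule exI[of _ "- K"], rule exI[of _ "l * (r / 2)"])
       (use Wo qW Kc KN l(1) r(1) far in auto)
qed

end

section \<open>The interior of a submanifold with boundary\<close>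

lemma half_space_chartD:
  assumes "half_space_chart Y k U \<phi>"
  shows "openin (top_of_set Y) U" "openin (top_of_set {x. 0 \<le> x $ k}) (\<phi> ` U)"
    "\<exists>\<psi>. homeomorphism U (\<phi> ` U) \<phi> \<psi>" "U \<subseteq> Y" "\<And>p. p \<in> U \<Longrightarrow> 0 \<le> \<phi> p $ k"
proof -
  show 1: "openin (top_of_set Y) U" and 2: "openin (top_of_set {x. 0 \<le> x $ k}) (\<phi> ` U)"
    and "\<exists>\<psi>. homeomorphism U (\<phi> ` U) \<phi> \<psi>"
    using assms unfolding half_space_chart_def by blast+
  show "U \<subseteq> Y" using 1 by (rule openin_imp_subset)
  have "\<phi> ` U \<subseteq> {x. 0 \<le> x $ k}" using 2 by (rule openin_imp_subset)
  then show "0 \<le> \<phi> p $ k" if "p \<in> U" for p using that by blast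
qed

lemma open_pos_part:
  fixes S :: "(real ^ 'n::finite) set"
  assumes "openin (top_of_set {x. 0 \<le> x $ k}) S"
  shows "open (S \<inter> {x. 0 < x $ k})"
proof -
  obtain T where T: "open T" "S = {x. 0 \<le> x $ k} \<inter> T" using assms unfolding openin_open by blast
  have "S \<inter> {x. 0 < x $ k} = T \<inter> {x. 0 < x $ k}" unfolding T(2) by auto
  then show ?thesis using T(1) open_halfspace_component_gt_cart[of 0 k] by (simp add: open_Int)
qed

text \<open>
  Boundary and interior points are distinguished by every half-space chart in the same way: a
  transition map sends a small open set around an interior coordinate point to an open set, by
  invariance of domain, and no open subset of the closed half-space contains a point of its boundary
  hyperplane.
\<close>

lemma intr_in_half_space_chart:
  fixes \<phi> :: "'a::topological_space \<Rightarrow> real ^ 'n::finite"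
  assumes ch: "half_space_chart Y k U \<phi>" and p: "p \<in> U"
  shows "p \<in> intr TYPE('n) Y \<longleftrightarrow> 0 < \<phi> p $ k"
proof
  note D = half_space_chartD[OF ch]
  assume "p \<in> intr TYPE('n) Y"
  then have "p \<notin> bdry TYPE('n) Y" by (simp add: intr_def)
  moreover have "p \<in> Y" using D(4) p by blast
  ultimately have "\<phi> p $ k \<noteq> 0" using ch p unfolding bdry_def by blast
  then show "0 < \<phi> p $ k" using D(5)[OF p] by simp
next
  note D = half_space_chartD[OF ch]
  assume pos: "0 < \<phi> p $ k"
  have "p \<notin> bdry TYPE('n) Y"
  proof
    assume "p \<in> bdry TYPE('n) Y"
    then obtain k' U' and \<phi>' :: "'a \<Rightarrow> real ^ 'n" where ch': "half_space_chart Y k' U' \<phi>'"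
      and p': "p \<in> U'" "\<phi>' p $ k' = 0" unfolding bdry_def by blast
    note D' = half_space_chartD[OF ch']
    obtain \<psi> where \<psi>: "homeomorphism U (\<phi> ` U) \<phi> \<psi>" using D(3) by blast
    obtain \<psi>' where \<psi>': "homeomorphism U' (\<phi>' ` U') \<phi>' \<psi>'" using D'(3) by blast
    define \<Omega> where "\<Omega> = \<phi> ` (U \<inter> U') \<inter> {x. 0 < x $ k}"
    have "openin (top_of_set Y) (U \<inter> U')" using D(1) D'(1) by (rule openin_Int)
    then have "openin (top_of_set U) (U \<inter> U')"
      by (rule openin_subset_trans) (use D(4) in auto)
    then have "openin (top_of_set (\<phi> ` U)) (\<phi> ` (U \<inter> U'))"
      by (rule homeomorphism_imp_open_map[OF \<psi>])
    then have "openin (top_of_set {x. 0 \<le> x $ k}) (\<phi> ` (U \<inter> U'))"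
      using D(2) by (rule openin_trans)
    then have "open \<Omega>" unfolding \<Omega>_def by (rule open_pos_part)
    have \<psi>in: "\<psi> w \<in> U \<inter> U'" and \<phi>\<psi>: "\<phi> (\<psi> w) = w" if w: "w \<in> \<Omega>" for w
    proof -
      obtain q where q: "q \<in> U \<inter> U'" "w = \<phi> q" using w unfolding \<Omega>_def by blast
      then have "\<psi> w = q" using homeomorphism_apply1[OF \<psi>] by blast
      then show "\<psi> w \<in> U \<inter> U'" "\<phi> (\<psi> w) = w" using q by auto
    qed
    have "\<Omega> \<subseteq> \<phi> ` U" unfolding \<Omega>_def by blast
    then have "continuous_on \<Omega> \<psi>"
      using homeomorphism_cont2[OF \<psi>] continuous_on_subset by blast
    moreover have "continuous_on (\<psi> ` \<Omega>) \<phi>'"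
      by (rule continuous_on_subset[OF homeomorphism_cont1[OF \<psi>']]) (use \<psi>in in blast)
    ultimately have "continuous_on \<Omega> (\<phi>' \<circ> \<psi>)" by (rule continuous_on_compose)
    moreover have "inj_on (\<phi>' \<circ> \<psi>) \<Omega>"
    proof (rule inj_on_inverseI[of _ "\<phi> \<circ> \<psi>'"])
      fix w assume w: "w \<in> \<Omega>"
      then show "(\<phi> \<circ> \<psi>') ((\<phi>' \<circ> \<psi>) w) = w"
        using homeomorphism_apply1[OF \<psi>', of "\<psi> w"] \<psi>in[OF w] \<phi>\<psi>[OF w] by simp
    qed
    ultimately have op: "open ((\<phi>' \<circ> \<psi>) ` \<Omega>)"
      using invariance_of_domain[of \<Omega> "\<phi>' \<circ> \<psi>"] \<open>open \<Omega>\<close> by blast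
    have "(\<phi>' \<circ> \<psi>) ` \<Omega> \<subseteq> {x. x $ k' \<ge> 0}" using \<psi>in D'(5) by auto
    then have "(\<phi>' \<circ> \<psi>) ` \<Omega> \<subseteq> interior {x. x $ k' \<ge> 0}" using op by (rule interior_maximal)
    then have int: "(\<phi>' \<circ> \<psi>) ` \<Omega> \<subseteq> {x. x $ k' > 0}" by simp
    have "\<phi> p \<in> \<Omega>" "\<psi> (\<phi> p) = p"
      using p p'(1) pos homeomorphism_apply1[OF \<psi> p] by (auto simp: \<Omega>_def)
    then have "\<phi>' p \<in> (\<phi>' \<circ> \<psi>) ` \<Omega>" by (metis comp_apply imageI)
    then have "0 < \<phi>' p $ k'" using int by blast
    then show False using p'(2) by simp
  qed
  then show "p \<in> intr TYPE('n) Y" using D(4) p by (auto simp: intr_def)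
qed

context riemannian
begin

text \<open>
  Near an interior point a half-space chart followed by a chart of \<open>X\<close> is an injective continuous map
  between open subsets of Euclidean spaces of the same dimension, hence open.
\<close>

lemma intr_open:
  fixes Y :: "'a set"
  assumes "C0_submanifold TYPE('n) Y"
  shows "open (intr TYPE('n) Y)"
proof (subst open_subopen, intro ballI)
  fix p assume p: "p \<in> intr TYPE('n) Y"
  then have "p \<in> Y" by (simp add: intr_def)
  then obtain k U and \<phi> :: "'a \<Rightarrow> real ^ 'n" where ch: "half_space_chart Y k U \<phi>" and pU: "p \<in> U"
    using assms unfolding C0_submanifold_def by blast
  note D = half_space_chartD[OF ch]
  obtain \<psi> where \<psi>: "homeomorphism U (\<phi> ` U) \<phi> \<psi>" using D(3) by blast
  obtain c where c: "c \<in> A" "p \<in> fst c" using chart_at .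
  define \<Omega> where "\<Omega> = \<phi> ` (U \<inter> fst c) \<inter> {x. 0 < x $ k}"
  have "openin (top_of_set U) (U \<inter> fst c)"
    using chart_open[OF c(1)] by (rule openin_open_Int)
  then have "openin (top_of_set (\<phi> ` U)) (\<phi> ` (U \<inter> fst c))"
    by (rule homeomorphism_imp_open_map[OF \<psi>])
  then have "openin (top_of_set {x. 0 \<le> x $ k}) (\<phi> ` (U \<inter> fst c))"
    using D(2) by (rule openin_trans)
  then have "open \<Omega>" unfolding \<Omega>_def by (rule open_pos_part)
  have \<psi>in: "\<psi> w \<in> U \<inter> fst c" and \<phi>\<psi>: "\<phi> (\<psi> w) = w" if w: "w \<in> \<Omega>" for w
  proof -
    obtain q where q: "q \<in> U \<inter> fst c" "w = \<phi> q" using w unfolding \<Omega>_def by blast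
    then have "\<psi> w = q" using homeomorphism_apply1[OF \<psi>] by blast
    then show "\<psi> w \<in> U \<inter> fst c" "\<phi> (\<psi> w) = w" using q by auto
  qed
  let ?f = "snd c \<circ> \<psi>"
  have "\<Omega> \<subseteq> \<phi> ` U" unfolding \<Omega>_def by blast
  then have "continuous_on \<Omega> \<psi>"
    using homeomorphism_cont2[OF \<psi>] continuous_on_subset by blast
  moreover have "continuous_on (\<psi> ` \<Omega>) (snd c)"
    by (rule continuous_on_subset[OF chart_continuous[OF c(1)]]) (use \<psi>in in blast)
  ultimately have "continuous_on \<Omega> ?f" by (rule continuous_on_compose)
  moreover have "inj_on ?f \<Omega>"
  proof (rule inj_on_inverseI[of _ "\<phi> \<circ> chart_inv c"])
    fix w assume w: "w \<in> \<Omega>"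
    then show "(\<phi> \<circ> chart_inv c) (?f w) = w"
      using chart_inv_left[OF c(1), of "\<psi> w"] \<psi>in[OF w] \<phi>\<psi>[OF w] by simp
  qed
  ultimately have op: "open (?f ` \<Omega>)"
    using invariance_of_domain[of \<Omega> ?f] \<open>open \<Omega>\<close> by blast
  have "?f ` \<Omega> \<subseteq> snd c ` fst c" using \<psi>in by auto
  then have "open (chart_inv c ` ?f ` \<Omega>)" using chart_inv_image_open[OF c(1) op] by blast
  moreover have "chart_inv c ` ?f ` \<Omega> = \<psi> ` \<Omega>"
    unfolding image_image by (rule image_cong) (use chart_inv_left[OF c(1)] \<psi>in in auto)
  ultimately have "open (\<psi> ` \<Omega>)" by simp
  moreover have "p \<in> \<psi> ` \<Omega>"
  proof -
    have "\<phi> p \<in> \<Omega>" using pU c(2) p intr_in_half_space_chart[OF ch pU] by (auto simp: \<Omega>_def)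
    then show ?thesis using homeomorphism_apply1[OF \<psi> pU] by (metis imageI)
  qed
  moreover have "\<psi> ` \<Omega> \<subseteq> intr TYPE('n) Y"
  proof
    fix q assume "q \<in> \<psi> ` \<Omega>"
    then obtain w where w: "w \<in> \<Omega>" "q = \<psi> w" by blast
    have "q \<in> U" "\<phi> q = w" using \<psi>in[OF w(1)] \<phi>\<psi>[OF w(1)] w(2) by auto
    moreover have "0 < w $ k" using w(1) by (simp add: \<Omega>_def)
    ultimately show "q \<in> intr TYPE('n) Y" using intr_in_half_space_chart[OF ch, of q] by simp
  qed
  ultimately show "\<exists>T. open T \<and> p \<in> T \<and> T \<subseteq> intr TYPE('n) Y" by blast
qed

end

section \<open>Separation in the plane and arcs of circles\<close>

text \<open>
  A bounded convex open set is the interior of its closure, a convex body, and so is homeomorphic to the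
  interior of a ball.
\<close>

lemma convex_open_bounded_homeomorphic_UNIV:
  fixes V :: "'a::euclidean_space set"
  assumes "convex V" "open V" "bounded V" "V \<noteq> {}"
  shows "V homeomorphic (UNIV :: 'a set)"
proof -
  have int: "interior (closure V) = V"
    using convex_interior_closure[OF assms(1)] assms(2) by (simp add: interior_open)
  have "closure V homeomorphic cball (0::'a) 1"
    by (rule homeomorphic_convex_compact_cball)
       (use assms int in \<open>auto simp: convex_closure compact_closure\<close>)
  then have "interior (closure V) homeomorphic interior (cball (0::'a) 1)"
    by (rule homeomorphic_interiors_same_dimension) simp
  then have "V homeomorphic ball (0::'a) 1" by (simp add: int interior_cball)
  then show ?thesis using homeomorphic_ball_UNIV[of 1 "0::'a"] homeomorphic_trans zero_less_one by blast
qed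

text \<open>
  In Euclidean space a closed set that separates two points has a component that separates them. This
  is transported to \<open>V\<close> by a homeomorphism with the whole space. Working with the closure of \<open>V\<close> would
  not do, because different components of the level set may have common limits on the frontier.
\<close>

lemma separating_level_component:
  fixes V :: "'a::euclidean_space set" and d :: "'a \<Rightarrow> real"
  assumes V: "convex V" "open V" "bounded V" and d: "continuous_on V d"
    and ab: "a \<in> V" "b \<in> V" "d a < s" "s < d b"
  shows "\<exists>C. connected C \<and> C \<subseteq> {w \<in> V. d w = s} \<and> closedin (top_of_set V) C \<and>
    \<not> connected_component (V - C) a b"
proof -
  obtain F F' where hom: "homeomorphism V (UNIV :: 'a set) F F'"
    using convex_open_bounded_homeomorphic_UNIV[OF V] ab(1) unfolding homeomorphic_def by blast
  have inv1: "F' (F w) = w" if "w \<in> V" for w by (rule homeomorphism_apply1[OF hom that])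
  have inv2: "F (F' u) = u" "F' u \<in> V" for u
    using homeomorphism_apply2[OF hom, of u] homeomorphism_image2[OF hom] by auto
  have cont: "continuous_on S F'" for S
    using homeomorphism_cont2[OF hom] continuous_on_subset by blast
  define L where "L = {w \<in> V. d w = s}"
  have "L = V \<inter> d -` {s}" by (auto simp: L_def)
  then have "closedin (top_of_set V) L" using continuous_closedin_preimage[OF d, of "{s}"] by simp
  then have "closedin (top_of_set UNIV) (F ` L)" by (rule homeomorphism_imp_closed_map[OF hom])
  then have clL: "closed (F ` L)" by simp
  have "\<not> connected_component (- (F ` L)) (F a) (F b)"
  proof
    assume "connected_component (- (F ` L)) (F a) (F b)"
    then obtain T where T: "connected T" "T \<subseteq> - (F ` L)" "F a \<in> T" "F b \<in> T"
      unfolding connected_component_def by blast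
    have "connected (F' ` T)" by (rule connected_continuous_image[OF cont T(1)])
    then have "connected (d ` F' ` T)"
      by (rule connected_continuous_image[OF continuous_on_subset[OF d], rotated]) (use inv2 in auto)
    moreover have "d a \<in> d ` F' ` T" "d b \<in> d ` F' ` T"
      using T(3,4) inv1[OF ab(1)] inv1[OF ab(2)] by (metis imageI)+
    ultimately have "s \<in> d ` F' ` T" using ab(3,4) by (meson connectedD_interval less_imp_le)
    then obtain u where u: "u \<in> T" "d (F' u) = s" by blast
    then have "u \<in> F ` L" using inv2[of u] unfolding L_def by (metis (mono_tags, lifting) imageI mem_Collect_eq)
    then show False using T(2) u(1) by blast
  qed
  then obtain C0 where C0: "C0 \<in> components (F ` L)" "\<not> connected_component (- C0) (F a) (F b)"
    using separation_by_component_closed_pointwise[OF clL] by blast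
  define C where "C = F' ` C0"
  have sub: "C0 \<subseteq> F ` L" using C0(1) by (rule in_components_subset)
  have "connected C" unfolding C_def
    by (rule connected_continuous_image[OF cont in_components_connected[OF C0(1)]])
  moreover have "C \<subseteq> L"
  proof
    fix w assume "w \<in> C"
    then obtain v where v: "v \<in> L" "w = F' (F v)" using sub unfolding C_def by blast
    then show "w \<in> L" using inv1[of v] by (simp add: L_def)
  qed
  moreover have "closedin (top_of_set V) C"
  proof -
    have "closedin (top_of_set UNIV) C0" using closed_components[OF clL C0(1)] by simp
    then show ?thesis unfolding C_def by (rule homeomorphism_imp_closed_map[OF homeomorphism_symD[OF hom]])
  qed
  moreover have "\<not> connected_component (V - C) a b"
  proof
    assume "connected_component (V - C) a b"
    then obtain T where T: "connected T" "T \<subseteq> V - C" "a \<in> T" "b \<in> T"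
      unfolding connected_component_def by blast
    have "connected (F ` T)"
      by (rule connected_continuous_image[OF continuous_on_subset[OF homeomorphism_cont1[OF hom]] T(1)])
         (use T(2) in blast)
    moreover have "F ` T \<subseteq> - C0"
    proof
      fix u assume "u \<in> F ` T"
      then obtain w where w: "w \<in> T" "u = F w" by blast
      then have "F' u = w" "w \<notin> C" using inv1 T(2) by blast+
      then show "u \<in> - C0" unfolding C_def by blast
    qed
    ultimately show False using C0(2) T(3,4) unfolding connected_component_def by blast
  qed
  ultimately show ?thesis unfolding L_def by blast
qed

definition circle_pt :: "real ^ 2 \<Rightarrow> real \<Rightarrow> real \<Rightarrow> real ^ 2" where
  "circle_pt q s \<theta> = q + ((s * cos \<theta>) *\<^sub>R axis 1 1 + (s * sin \<theta>) *\<^sub>R axis 2 1)"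

lemma circle_pt_nth: "circle_pt q s \<theta> $ 1 = q $ 1 + s * cos \<theta>" "circle_pt q s \<theta> $ 2 = q $ 2 + s * sin \<theta>"
  by (simp_all add: circle_pt_def axis_def)

lemma circle_pt_surj:
  assumes "dist q w = s" "0 < s"
  shows "\<exists>\<theta>. 0 \<le> \<theta> \<and> \<theta> < 2 * pi \<and> w = circle_pt q s \<theta>"
proof -
  have "(w $ 1 - q $ 1)\<^sup>2 + (w $ 2 - q $ 2)\<^sup>2 = s\<^sup>2"
    using assms by (auto simp: dist_vec_def L2_set_def sum_2 dist_real_def power2_commute)
  then have "((w $ 1 - q $ 1) / s)\<^sup>2 + ((w $ 2 - q $ 2) / s)\<^sup>2 = 1"
    using assms(2) by (simp add: power_divide flip: add_divide_distrib)
  then obtain \<theta> where \<theta>: "0 \<le> \<theta>" "\<theta> < 2 * pi" "(w $ 1 - q $ 1) / s = cos \<theta>" "(w $ 2 - q $ 2) / s = sin \<theta>"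
    using sincos_total_2pi by metis
  then have "w = circle_pt q s \<theta>"
    using assms(2) by (simp add: vec_eq_iff forall_2 circle_pt_nth field_simps)
  then show ?thesis using \<theta> by blast
qed

lemma circle_pt_norm: "norm (circle_pt 0 s \<theta>) = \<bar>s\<bar>"
proof -
  have "(s * cos \<theta>)\<^sup>2 + (s * sin \<theta>)\<^sup>2 = s\<^sup>2"
    using sin_cos_squared_add2[of \<theta>] by (simp add: power_mult_distrib flip: distrib_left)
  then show ?thesis by (simp add: norm_vec_def L2_set_def sum_2 circle_pt_nth)
qed

text \<open>
  If each of the two arcs between the given points of \<open>C\<close> contained a point outside \<open>C\<close>, then the line
  through these two points would miss \<open>C\<close> and have points of \<open>C\<close> on both sides.
\<close>

lemma circle_connected_contains_arc:
  assumes C: "connected C" "\<And>w. w \<in> C \<Longrightarrow> dist q w = s" and s: "0 < s"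
    and uv: "circle_pt q s \<theta>1 \<in> C" "circle_pt q s \<theta>2 \<in> C" and \<theta>: "\<theta>1 \<le> \<theta>2" "\<theta>2 \<le> \<theta>1 + 2 * pi"
  shows "(\<forall>\<tau>\<in>{\<theta>1..\<theta>2}. circle_pt q s \<tau> \<in> C) \<or> (\<forall>\<tau>\<in>{\<theta>2..\<theta>1 + 2 * pi}. circle_pt q s \<tau> \<in> C)"
proof (rule ccontr)
  have per: "circle_pt q s (\<theta>1 + 2 * pi) = circle_pt q s \<theta>1" by (simp add: circle_pt_def)
  assume "\<not> ?thesis"
  then obtain \<theta>3 \<theta>4 where 3: "\<theta>3 \<in> {\<theta>1..\<theta>2}" "circle_pt q s \<theta>3 \<notin> C"
    and 4: "\<theta>4 \<in> {\<theta>2..\<theta>1 + 2 * pi}" "circle_pt q s \<theta>4 \<notin> C" by blast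
  have "\<theta>3 \<noteq> \<theta>1" "\<theta>3 \<noteq> \<theta>2" "\<theta>4 \<noteq> \<theta>2" "\<theta>4 \<noteq> \<theta>1 + 2 * pi" using 3(2) 4(2) uv per by auto
  then have lt: "\<theta>1 < \<theta>3" "\<theta>3 < \<theta>2" "\<theta>2 < \<theta>4" "\<theta>4 < \<theta>1 + 2 * pi" using 3(1) 4(1) by auto
  \<comment> \<open>the linear form \<open>l\<close> has the value \<open>s * cos h\<close> on the circle exactly at the angles \<open>\<theta>3 = m - h\<close> and \<open>\<theta>4 = m + h\<close>\<close>
  define m h where "m = (\<theta>3 + \<theta>4) / 2" and "h = (\<theta>4 - \<theta>3) / 2"
  have h: "0 < h" "h < pi" and mh: "m + h = \<theta>4" "m - h = \<theta>3"
    using lt by (auto simp: m_def h_def field_simps)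
  define l where "l w = (w $ 1 - q $ 1) * cos m + (w $ 2 - q $ 2) * sin m" for w :: "real ^ 2"
  have l: "l (circle_pt q s \<tau>) = s * cos (\<tau> - m)" for \<tau>
    by (simp add: l_def circle_pt_nth cos_diff algebra_simps)
  have "cos h < cos \<bar>\<theta>2 - m\<bar>"
    by (rule cos_monotone_0_pi) (use h mh lt in auto)
  then have c2: "cos h < cos (\<theta>2 - m)" by simp
  have "cos (m - \<theta>1) < cos h"
  proof (cases "m - \<theta>1 \<le> pi")
    case True
    then show ?thesis by (intro cos_monotone_0_pi) (use h mh lt in auto)
  next
    case False
    have "cos (2 * pi - (m - \<theta>1)) < cos h"
      by (intro cos_monotone_0_pi) (use False h mh lt in auto)
    then show ?thesis by (simp add: cos_diff)
  qed
  then have c1: "cos (\<theta>1 - m) < cos h" by (metis cos_minus minus_diff_eq)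
  have "connected (l ` C)"
    by (rule connected_continuous_image[OF _ C(1)]) (auto simp: l_def intro!: continuous_intros)
  moreover have "s * cos (\<theta>1 - m) \<in> l ` C" "s * cos (\<theta>2 - m) \<in> l ` C"
    using uv l by (metis imageI)+
  ultimately have "s * cos h \<in> l ` C"
    by (rule connectedD_interval) (use c1 c2 s in auto)
  then obtain w where w: "w \<in> C" "l w = s * cos h" by auto
  obtain \<tau> where \<tau>: "w = circle_pt q s \<tau>" using circle_pt_surj[OF C(2)[OF w(1)] s] by blast
  have "cos (\<tau> - m) = cos h" using w(2) l s unfolding \<tau> by simp
  then obtain n where n: "n \<in> \<int>" "\<tau> - m = h + 2 * n * pi \<or> \<tau> - m = - h + 2 * n * pi"
    unfolding cos_eq by blast
  have per2: "circle_pt q s (x + 2 * n * pi) = circle_pt q s x" for x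
  proof -
    obtain i where "n = of_int i" using n(1) by (rule Ints_cases)
    then show ?thesis using sin_cos_eq_iff[of "x + 2 * n * pi" x]
      by (simp add: circle_pt_def)
  qed
  have "\<tau> = \<theta>4 + 2 * n * pi \<or> \<tau> = \<theta>3 + 2 * n * pi" using n(2) mh by auto
  then have "w = circle_pt q s \<theta>4 \<or> w = circle_pt q s \<theta>3" using per2 unfolding \<tau> by metis
  then show False using w(1) 3(2) 4(2) by blast
qed

lemma Ck_on_cos_sin: "Ck_on k UNIV (\<lambda>x::real. a * cos x + b * sin x)"
proof (induction k arbitrary: a b)
  case 0
  show ?case by (auto intro!: continuous_intros)
next
  case (Suc k)
  show ?case
  proof (rule Ck_on_real_SucI[OF _ Suc.IH])
    show "((\<lambda>x. a * cos x + b * sin x) has_vector_derivative b * cos x + (- a) * sin x) (at x within UNIV)" for x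
      by (auto simp: has_real_derivative_iff_has_vector_derivative[symmetric] intro!: derivative_eq_intros)
  qed auto
qed

lemma Ck_on_circle_pt:
  fixes S :: "real set"
  assumes S: "\<And>x. x \<in> S \<Longrightarrow> x islimpt S"
  shows "Ck_on k S (\<lambda>t. circle_pt q s (a + t *\<^sub>R b))"
proof -
  have "Ck_on k S (\<lambda>t. s * cos (a + t *\<^sub>R b) + 0 * sin (a + t *\<^sub>R b))"
    by (rule Ck_on_real_compose[OF S _ Ck_on_real_affine[OF S] Ck_on_cos_sin]) auto
  then have c: "Ck_on k S (\<lambda>t. s * cos (a + t *\<^sub>R b))" by simp
  have "Ck_on k S (\<lambda>t. 0 * cos (a + t *\<^sub>R b) + s * sin (a + t *\<^sub>R b))"
    by (rule Ck_on_real_compose[OF S _ Ck_on_real_affine[OF S] Ck_on_cos_sin]) auto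
  then have d: "Ck_on k S (\<lambda>t. s * sin (a + t *\<^sub>R b))" by simp
  show ?thesis unfolding circle_pt_def
    by (rule Ck_on_real_add[OF S Ck_on_real_const[OF S] Ck_on_real_add[OF S
          Ck_on_real_scaleR[OF S c Ck_on_real_const[OF S]] Ck_on_real_scaleR[OF S d Ck_on_real_const[OF S]]]])
qed

text \<open>
  The velocity is again a point of a circle, a quarter turn ahead, which gives its norm at once.
\<close>

lemma circle_pt_has_vector_derivative:
  "((\<lambda>t. circle_pt q s (a + t *\<^sub>R b)) has_vector_derivative circle_pt 0 (b * s) (a + t *\<^sub>R b + pi / 2)) (at t within S)"
proof -
  have "((\<lambda>t. s * cos (a + t * b)) has_vector_derivative - (b * s * sin (a + t * b))) (at t within S)"
    "((\<lambda>t. s * sin (a + t * b)) has_vector_derivative b * s * cos (a + t * b)) (at t within S)"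
    by (auto simp: has_real_derivative_iff_has_vector_derivative[symmetric] intro!: derivative_eq_intros)
  then have "((\<lambda>t. circle_pt q s (a + t * b)) has_vector_derivative
      (- (b * s * sin (a + t * b))) *\<^sub>R axis 1 1 + (b * s * cos (a + t * b)) *\<^sub>R axis 2 1) (at t within S)"
    unfolding circle_pt_def has_vector_derivative_def
    by (auto intro!: derivative_eq_intros simp: algebra_simps)
  moreover have "circle_pt 0 (b * s) (\<theta> + pi / 2) =
      (- (b * s * sin \<theta>)) *\<^sub>R axis 1 1 + (b * s * cos \<theta>) *\<^sub>R axis 2 1" for \<theta>
    by (simp add: circle_pt_def cos_add sin_add)
  ultimately show ?thesis by simp
qed

section \<open>Small crosscuts near a boundary point\<close>

locale riemannian_surface = riemannian A g
  for A :: "('a::{t2_space, second_countable_topology}, 2) chart set" and g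
begin

text \<open>
  \<open>D\<close> itself need not be the image of a smooth path, but it contains a circular arc between any two of
  its points.
\<close>

lemma reach_on_circle:
  fixes D I :: "'a set"
  assumes c: "c \<in> A" and ball: "cball q s \<subseteq> snd c ` fst c" and s: "0 < s"
    and L: "\<And>u v. u \<in> cball q s \<Longrightarrow> gnorm c u v \<le> L * norm v" "0 \<le> L"
    and e: "L * (2 * pi * s) < e"
    and I: "open I" and D: "connected D" "D \<subseteq> I" "D \<subseteq> fst c" "\<And>p. p \<in> D \<Longrightarrow> dist q (snd c p) = s"
    and p: "p1 \<in> D" "p2 \<in> D"
  shows "reach I p1 p2 e"
proof -
  have pi_s: "0 \<le> L * (2 * pi * s)" using L(2) s by simp
  define C where "C = snd c ` D"
  have conC: "connected C" unfolding C_def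
    by (rule connected_continuous_image[OF continuous_on_subset[OF chart_continuous[OF c] D(3)] D(1)])
  have distC: "dist q w = s" if "w \<in> C" for w using that D(4) by (auto simp: C_def)
  have invC: "chart_inv c w \<in> D" if "w \<in> C" for w
    using that chart_inv_left[OF c] D(3) by (auto simp: C_def)
  have arc: "reach I (chart_inv c (circle_pt q s \<alpha>)) (chart_inv c (circle_pt q s \<beta>)) e"
    if ab: "\<alpha> \<le> \<beta>" "\<beta> \<le> \<alpha> + 2 * pi" and inC: "\<And>\<tau>. \<tau> \<in> {\<alpha>..\<beta>} \<Longrightarrow> circle_pt q s \<tau> \<in> C" for \<alpha> \<beta>
  proof (cases "circle_pt q s \<alpha> = circle_pt q s \<beta>")
    case True
    moreover have "chart_inv c (circle_pt q s \<alpha>) \<in> I"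
      using invC[OF inC[of \<alpha>]] ab D(2) by auto
    ultimately show ?thesis using reach_refl[OF I] pi_s e by simp
  next
    case False
    define f where "f = (\<lambda>t. circle_pt q s (\<alpha> + t *\<^sub>R (\<beta> - \<alpha>)))"
    have fC: "f t \<in> C" if t: "t \<in> {0..1}" for t
    proof -
      have "t * (\<beta> - \<alpha>) \<le> 1 * (\<beta> - \<alpha>)" using t ab by (intro mult_right_mono) auto
      then show ?thesis unfolding f_def using t ab by (intro inC) auto
    qed
    have fb: "f t \<in> cball q s" if t: "t \<in> {0..1}" for t using distC[OF fC[OF t]] by simp
    have "reach I (chart_inv c (f 0)) (chart_inv c (f 1)) e"
    proof (rule reach_chart[OF c, where M="2 * pi * s" and L=L])
      show "Ck_on k {0..1} f" for k
        unfolding f_def by (rule Ck_on_circle_pt[OF unit_interval_islimpt])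
      show "f ` {0..1} \<subseteq> snd c ` fst c" using fb ball by blast
      show "(f has_vector_derivative circle_pt 0 ((\<beta> - \<alpha>) * s) (\<alpha> + t *\<^sub>R (\<beta> - \<alpha>) + pi / 2)) (at t within {0..1})" for t
        unfolding f_def by (rule circle_pt_has_vector_derivative)
      show "norm (circle_pt 0 ((\<beta> - \<alpha>) * s) (\<alpha> + t *\<^sub>R (\<beta> - \<alpha>) + pi / 2)) \<le> 2 * pi * s" for t
        using ab s by (simp add: circle_pt_norm abs_mult)
      show "gnorm c (f t) v \<le> L * norm v" if "t \<in> {0..1}" for t v by (rule L(1)[OF fb[OF that]])
      show "chart_inv c (f t) \<in> I" if "t \<in> {0..1}" for t using invC[OF fC[OF that]] D(2) by blast
    qed (use L(2) e False in \<open>auto simp: f_def\<close>)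
    then show ?thesis by (simp add: f_def)
  qed
  have main: "reach I p p' e"
    if pp: "p \<in> D" "p' \<in> D" "snd c p = circle_pt q s \<theta>" "snd c p' = circle_pt q s \<theta>'"
      "\<theta> \<le> \<theta>'" "\<theta>' \<le> \<theta> + 2 * pi" for p p' \<theta> \<theta>'
  proof -
    have inC: "circle_pt q s \<theta> \<in> C" "circle_pt q s \<theta>' \<in> C"
      using pp(1,2) unfolding pp(3,4)[symmetric] C_def by blast+
    have inv: "chart_inv c (circle_pt q s \<theta>) = p" "chart_inv c (circle_pt q s \<theta>') = p'"
      using chart_inv_left[OF c] pp(1-4) D(3) by (metis subsetD)+
    have per: "circle_pt q s (\<theta> + 2 * pi) = circle_pt q s \<theta>" by (simp add: circle_pt_def)
    from circle_connected_contains_arc[OF conC distC s inC pp(5,6)]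
    show ?thesis
    proof
      assume "\<forall>\<tau>\<in>{\<theta>..\<theta>'}. circle_pt q s \<tau> \<in> C"
      then show ?thesis using arc[OF pp(5,6)] inv by simp
    next
      assume "\<forall>\<tau>\<in>{\<theta>'..\<theta> + 2 * pi}. circle_pt q s \<tau> \<in> C"
      then have "reach I p' p e" using arc[of \<theta>' "\<theta> + 2 * pi"] pp(5,6) inv per by simp
      then show ?thesis by (rule reach_sym)
    qed
  qed
  obtain \<theta>1 where \<theta>1: "0 \<le> \<theta>1" "\<theta>1 < 2 * pi" "snd c p1 = circle_pt q s \<theta>1"
    using circle_pt_surj[OF D(4)[OF p(1)] s] by blast
  obtain \<theta>2 where \<theta>2: "0 \<le> \<theta>2" "\<theta>2 < 2 * pi" "snd c p2 = circle_pt q s \<theta>2"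
    using circle_pt_surj[OF D(4)[OF p(2)] s] by blast
  show ?thesis
  proof (cases "\<theta>1 \<le> \<theta>2")
    case True
    then show ?thesis using main[OF p \<theta>1(3) \<theta>2(3)] \<theta>1 \<theta>2 by simp
  next
    case False
    then show ?thesis using reach_sym[OF main[OF p(2,1) \<theta>2(3) \<theta>1(3)]] \<theta>1 \<theta>2 by simp
  qed
qed

text \<open>
  The set \<open>D\<close> is a small crosscut of the interior near \<open>z\<close>: its points are close to each other within
  \<open>I\<close>, and no connected subset of \<open>I\<close> gets from a neighbourhood of \<open>x\<close> or \<open>y\<close> to a neighbourhood of \<open>z\<close>
  without meeting it. It is found as a component, in the coordinates of a half-disc around \<open>z\<close>, of the
  points at a fixed distance from \<open>z\<close> in a chart of \<open>X\<close>.
\<close>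

lemma separating_ring:
  fixes Y :: "'a set"
  assumes Y: "C0_submanifold TYPE(2) Y" and z: "z \<in> bdry TYPE(2) Y" and xy: "x \<noteq> z" "y \<noteq> z" and e: "0 < e"
  defines "I \<equiv> intr TYPE(2) Y"
  shows "\<exists>N Nz D. open N \<and> x \<in> N \<and> y \<in> N \<and> open Nz \<and> z \<in> Nz \<and>
    (\<forall>p\<in>D. \<forall>p'\<in>D. reach I p p' e) \<and>
    (\<forall>P. connected P \<longrightarrow> P \<subseteq> I \<longrightarrow> P \<inter> N \<noteq> {} \<longrightarrow> P \<inter> Nz \<noteq> {} \<longrightarrow> P \<inter> D \<noteq> {})"
proof -
  have Io: "open I" unfolding I_def by (rule intr_open[OF Y])
  have IY: "I \<subseteq> Y" by (auto simp: I_def intr_def)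
  obtain k U and \<phi> :: "'a \<Rightarrow> real ^ 2" where ch: "half_space_chart Y k U \<phi>" and zU: "z \<in> U" and z0: "\<phi> z $ k = 0"
    using z unfolding bdry_def by blast
  note Dc = half_space_chartD[OF ch]
  obtain \<psi> where \<psi>: "homeomorphism U (\<phi> ` U) \<phi> \<psi>" using Dc(3) by blast
  define H where "H = {w :: real ^ 2. 0 \<le> w $ k}"
  have HU: "openin (top_of_set H) (\<phi> ` U)" using Dc(2) by (simp add: H_def)
  have Hc: "closed H" unfolding H_def by (rule closed_halfspace_component_ge_cart)
  define q where "q = \<phi> z"
  have qz: "\<psi> q = z" using homeomorphism_apply1[OF \<psi> zU] by (simp add: q_def)
  have qk: "q $ k = 0" using z0 by (simp add: q_def)
  obtain c where c: "c \<in> A" "z \<in> fst c" using chart_at .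
  \<comment> \<open>closed half-discs \<open>D r\<close> around \<open>q\<close> in the half-space; the largest one avoids the preimages of \<open>x\<close> and \<open>y\<close>\<close>
  define O0 where "O0 = fst c - {x, y}"
  have "open O0" unfolding O0_def by (intro open_Diff chart_open[OF c(1)]) auto
  then have "openin (top_of_set U) (U \<inter> O0)" by (rule openin_open_Int)
  then have "openin (top_of_set (\<phi> ` U)) (\<phi> ` (U \<inter> O0))" by (rule homeomorphism_imp_open_map[OF \<psi>])
  then have G: "openin (top_of_set H) (\<phi> ` (U \<inter> O0))" using HU by (rule openin_trans)
  have "q \<in> \<phi> ` (U \<inter> O0)" using zU c(2) xy by (auto simp: q_def O0_def)
  then obtain R where R: "0 < R" "cball q R \<inter> H \<subseteq> \<phi> ` (U \<inter> O0)"
    using G unfolding openin_contains_cball by blast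
  define D where "D r = cball q r \<inter> H" for r
  have DU: "D r \<subseteq> \<phi> ` U" if "r \<le> R" for r
    using R(2) that subset_cball[OF that, of q] by (auto simp: D_def)
  have \<psi>U: "\<psi> w \<in> U" and \<phi>\<psi>: "\<phi> (\<psi> w) = w" and \<psi>O: "\<psi> w \<in> O0" if w: "w \<in> D R" for w
  proof -
    obtain p where p: "p \<in> U" "p \<in> O0" "w = \<phi> p" using w R(2) by (auto simp: D_def)
    then have "\<psi> w = p" using homeomorphism_apply1[OF \<psi>] by blast
    then show "\<psi> w \<in> U" "\<phi> (\<psi> w) = w" "\<psi> w \<in> O0" using p by auto
  qed
  have Dcomp: "compact (D r)" for r unfolding D_def by (rule compact_Int_closed[OF compact_cball Hc])
  have \<psi>cont: "continuous_on (D R) \<psi>"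
    by (rule continuous_on_subset[OF homeomorphism_cont2[OF \<psi>] DU]) simp
  have Dmono: "D r \<subseteq> D R" if "r \<le> R" for r using subset_cball[OF that, of q] by (auto simp: D_def)
  have I_iff: "\<psi> w \<in> I \<longleftrightarrow> 0 < w $ k" if "w \<in> D R" for w
    unfolding I_def using intr_in_half_space_chart[OF ch \<psi>U[OF that]] \<phi>\<psi>[OF that] by simp
  define d where "d w = dist (snd c z) (snd c (\<psi> w))" for w
  have dcont: "continuous_on (D R) d"
    unfolding d_def
    by (intro continuous_on_dist continuous_on_const continuous_on_compose2[OF chart_continuous[OF c(1)] \<psi>cont])
       (use \<psi>O in \<open>auto simp: O0_def\<close>)
  have d0: "d q = 0" by (simp add: d_def qz)
  have qD: "q \<in> D r" if "0 \<le> r" for r using that qk by (simp add: D_def H_def)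
  have dpos: "0 < d w" if w: "w \<in> D R" "w \<noteq> q" for w
  proof (rule ccontr)
    assume "\<not> 0 < d w"
    then have "snd c z = snd c (\<psi> w)" by (simp add: d_def)
    then have "z = \<psi> w"
      using chart_inj[OF c(1)] c(2) \<psi>O[OF w(1)] unfolding O0_def inj_on_def by blast
    then show False using \<phi>\<psi>[OF w(1)] w(2) by (simp add: q_def)
  qed
  \<comment> \<open>\<open>d\<close> is bounded away from \<open>0\<close> on the outer half of the half-disc, by compactness and injectivity of the two charts\<close>
  obtain m where m: "0 < m" "\<And>w. w \<in> D R \<Longrightarrow> R / 2 \<le> dist q w \<Longrightarrow> m \<le> d w"
  proof (cases "D R - ball q (R / 2) = {}")
    case True
    then show ?thesis using that[of 1] by force
  next
    case False
    have "compact (D R - ball q (R / 2))" using Dcomp by (rule compact_diff) simp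
    moreover have "continuous_on (D R - ball q (R / 2)) d"
      by (rule continuous_on_subset[OF dcont]) auto
    ultimately obtain w0 where w0: "w0 \<in> D R - ball q (R / 2)" "\<And>w. w \<in> D R - ball q (R / 2) \<Longrightarrow> d w0 \<le> d w"
      using continuous_attains_inf False by metis
    have "w0 \<noteq> q" using w0(1) R(1) by auto
    then have "0 < d w0" using dpos w0(1) by blast
    then show ?thesis by (rule that) (use w0(2) in auto)
  qed
  have "open (snd c ` fst c)" "snd c z \<in> snd c ` fst c" using chart_image_open[OF c(1)] c(2) by auto
  then obtain r0 where r0: "0 < r0" "cball (snd c z) r0 \<subseteq> snd c ` fst c" using open_contains_cball by blast
  obtain L where L: "0 < L" "\<And>u v. u \<in> cball (snd c z) r0 \<Longrightarrow> gnorm c u v \<le> L * norm v"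
    using gnorm_bounds[OF c(1) compact_cball r0(2)] by metis
  \<comment> \<open>a radius below all values of \<open>d\<close> in the outer half of the half-disc, and with circumference of length less than \<open>e\<close>\<close>
  define s where "s = min (min (m / 2) r0) (e / (4 * pi * L))"
  have s: "0 < s" "s < m" "s \<le> r0"
  proof -
    have "0 < e / (4 * pi * L)" using e L(1) by simp
    then show "0 < s" using m(1) r0(1) by (simp add: s_def)
    have "s \<le> m / 2" by (simp add: s_def)
    then show "s < m" using m(1) by simp
    show "s \<le> r0" by (simp add: s_def)
  qed
  have se: "L * (2 * pi * s) < e"
  proof -
    have "L * (2 * pi * s) \<le> L * (2 * pi * (e / (4 * pi * L)))"
      using L(1) by (intro mult_left_mono) (auto simp: s_def)
    also have "\<dots> = e / 2" using L(1) by simp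
    finally show ?thesis using e by simp
  qed
  obtain r where r: "0 < r" "\<And>w. w \<in> D R \<Longrightarrow> dist w q < r \<Longrightarrow> d w < s"
  proof -
    have "continuous (at q within D R) d"
      using dcont qD[of R] R(1) by (simp add: continuous_on_eq_continuous_within)
    then obtain r where r: "0 < r" "\<And>w. w \<in> D R \<Longrightarrow> dist w q < r \<Longrightarrow> dist (d w) (d q) < s"
      using s(1) unfolding continuous_within_eps_delta by metis
    show ?thesis by (rule that[OF r(1)]) (use r(2) d0 in \<open>fastforce simp: dist_real_def\<close>)
  qed
  define r' where "r' = min (r / 2) (R / 2)"
  have r': "0 < r'" "r' < r" "r' \<le> R / 2" using r(1) R(1) by (auto simp: r'_def)
  define V where "V = ball q R \<inter> {w. 0 < w $ k}"
  define B where "B = ball q r' \<inter> {w. 0 < w $ k}"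
  define K where "K = {w \<in> V. R / 2 \<le> dist q w}"
  have VD: "V \<subseteq> D R" by (auto simp: V_def D_def H_def)
  have BV: "B \<subseteq> V" using r'(3) R(1) by (auto simp: B_def V_def)
  have convpos: "convex {w :: real ^ 2. 0 < w $ k}"
    using convex_halfspace_gt[of 0 "axis k 1 :: real ^ 2"] by (simp add: inner_axis')
  have V: "convex V" "open V" "bounded V"
    unfolding V_def using convpos
    by (auto intro: convex_Int bounded_Int open_Int open_halfspace_component_gt_cart)
  have ds: "d w < s" if "w \<in> B" for w
  proof -
    have "w \<in> D R" using that BV VD by blast
    moreover have "dist w q < r" using that r'(2) by (simp add: B_def dist_commute)
    ultimately show ?thesis by (rule r(2))
  qed
  define a where "a = q + (r' / 2) *\<^sub>R axis k 1"
  define b where "b = q + (3 * R / 4) *\<^sub>R axis k 1"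
  have aB: "a \<in> B" using r' qk by (simp add: a_def B_def dist_norm norm_axis_1 axis_nth)
  have bK: "b \<in> K" using R(1) qk by (simp add: b_def K_def V_def dist_norm norm_axis_1 axis_nth)
  have "s < d b" using m(2)[of b] bK VD s(2) by (auto simp: K_def)
  then obtain C where C: "connected C" "C \<subseteq> {w \<in> V. d w = s}" "closedin (top_of_set V) C"
    "\<not> connected_component (V - C) a b"
    using separating_level_component[OF V continuous_on_subset[OF dcont VD], of a b s]
      aB BV bK ds[OF aB] by (auto simp: K_def)
  have Kcon: "connected K"
  proof -
    \<comment> \<open>the radial retraction of the half-disc onto its outer part\<close>
    define F where "F w = q + max 1 (R / 2 / dist q w) *\<^sub>R (w - q)" for w
    have Vq: "0 < dist q w" if "w \<in> V" for w using that qk by (auto simp: V_def)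
    have dF: "dist q (F w) = max (dist q w) (R / 2)" if "w \<in> V" for w
    proof -
      have "dist q (F w) = \<bar>max 1 (R / 2 / dist q w)\<bar> * dist q w"
        by (simp add: F_def dist_norm norm_minus_commute)
      also have "\<dots> = max (dist q w) (R / 2)"
        using Vq[OF that] R(1) by (auto simp: max_def field_simps)
      finally show ?thesis .
    qed
    have "F w \<in> K" if w: "w \<in> V" for w
    proof -
      have "0 < max 1 (R / 2 / dist q w) * w $ k" using w by (intro mult_pos_pos) (auto simp: V_def)
      then have "0 < F w $ k" using qk by (simp add: F_def)
      then show ?thesis using dF[OF w] w R(1) by (auto simp: K_def V_def)
    qed
    moreover have "F w = w" if "w \<in> K" for w
    proof -
      have "R / 2 / dist q w \<le> 1" using that Vq[of w] by (simp add: K_def)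
      then show ?thesis by (simp add: F_def)
    qed
    moreover have "K \<subseteq> V" by (auto simp: K_def)
    ultimately have "F ` V = K" by force
    moreover have "continuous_on V F" unfolding F_def
      by (intro continuous_intros) (use Vq in force)
    ultimately show ?thesis using connected_continuous_image[OF _ convex_connected[OF V(1)], of F] by simp
  qed
  \<comment> \<open>the side of the crosscut that contains the points near z; it stays within the inner half of the half-disc\<close>
  define Q where "Q = connected_component_set (V - C) a"
  have dC: "w \<in> V" "d w = s" if "w \<in> C" for w using C(2) that by auto
  have BQ: "B \<subseteq> Q" unfolding Q_def
  proof (rule connected_component_maximal[OF aB])
    show "connected B" unfolding B_def by (intro convex_connected convex_Int convpos convex_ball)
    show "B \<subseteq> V - C" using BV ds dC(2) by force
  qed
  have QV: "Q \<subseteq> V - C" unfolding Q_def by (rule connected_component_subset)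
  have KC: "K \<subseteq> V - C"
    using m(2) VD s(2) dC(2) by (force simp: K_def)
  have QK: "Q \<inter> K = {}"
  proof (rule ccontr)
    assume "Q \<inter> K \<noteq> {}"
    then obtain w where w: "w \<in> Q" "w \<in> K" by blast
    have "connected_component (V - C) a w" using w(1) by (simp add: Q_def)
    moreover have "connected_component (V - C) w b"
      unfolding connected_component_def using Kcon KC w(2) bK by blast
    ultimately show False using C(4) connected_component_trans by metis
  qed
  then have Qd: "dist q w < R / 2" if "w \<in> Q" for w using that QV by (force simp: K_def)
  have "open (V - C)"
    using C(3) V(2) by (metis closedin_def openin_open_eq topspace_euclidean_subtopology)
  then have Qo: "open Q" unfolding Q_def by (rule open_connected_component)
  have openY: "openin (top_of_set Y) (\<psi> ` S)" if S: "openin (top_of_set H) S" "S \<subseteq> D R" for S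
  proof -
    have "openin (top_of_set (\<phi> ` U)) S"
      by (rule openin_subset_trans[OF S(1)]) (use S(2) DU[of R] openin_imp_subset[OF HU] in auto)
    then have "openin (top_of_set U) (\<psi> ` S)" by (rule homeomorphism_imp_open_map[OF homeomorphism_symD[OF \<psi>]])
    then show ?thesis using Dc(1) by (rule openin_trans)
  qed
  \<comment> \<open>otherwise \<open>\<psi> ` Q\<close> would cut out of the connected set \<open>P\<close> a nonempty proper subset that is open and closed\<close>
  have cross: "P \<inter> \<psi> ` C \<noteq> {}"
    if P: "connected P" "P \<subseteq> I" "P \<inter> (- \<psi> ` D R) \<noteq> {}" "P \<inter> \<psi> ` B \<noteq> {}" for P
  proof
    assume no: "P \<inter> \<psi> ` C = {}"
    have PY: "P \<subseteq> Y" using P(2) IY by blast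
    have QDR: "Q \<subseteq> D R" using QV VD by blast
    have "openin (top_of_set H) Q"
      using Qo QDR by (auto simp: openin_open D_def)
    then have "openin (top_of_set Y) (\<psi> ` Q)" by (rule openY) (rule QDR)
    then obtain T where T: "open T" "\<psi> ` Q = Y \<inter> T" unfolding openin_open by blast
    have op: "openin (top_of_set P) (P \<inter> \<psi> ` Q)"
      unfolding T(2) using PY T(1) by (auto simp: openin_open)
    have clQ: "closure Q \<subseteq> D (R / 2)"
    proof (rule closure_minimal)
      show "Q \<subseteq> D (R / 2)" using Qd QDR by (force simp: D_def)
      show "closed (D (R / 2))" by (rule compact_imp_closed[OF Dcomp])
    qed
    have clQR: "closure Q \<subseteq> D R" using clQ Dmono[of "R / 2"] R(1) by auto
    have "compact (closure Q)"
      using compact_Int_closed[OF Dcomp[of "R / 2"] closed_closure[of Q]] clQ by (simp only: Int_absorb1)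
    then have "compact (\<psi> ` closure Q)"
      by (rule compact_continuous_image[OF continuous_on_subset[OF \<psi>cont clQR]])
    then have clo: "closed (\<psi> ` closure Q)" by (rule compact_imp_closed)
    have "P \<inter> \<psi> ` closure Q \<subseteq> \<psi> ` Q"
    proof
      fix p assume "p \<in> P \<inter> \<psi> ` closure Q"
      then obtain w where w: "w \<in> closure Q" "p = \<psi> w" "p \<in> P" by blast
      have wR: "w \<in> D R" using w(1) clQR by blast
      have "0 < w $ k" using I_iff[OF wR] w(2,3) P(2) by blast
      moreover have "dist q w \<le> R / 2" using w(1) clQ by (auto simp: D_def)
      ultimately have "w \<in> V" using R(1) by (simp add: V_def)
      moreover have "w \<notin> C" using no w(2,3) by blast
      moreover obtain T where T: "closed T" "Q = (V - C) \<inter> T"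
        using closedin_connected_component[of "V - C" a] unfolding Q_def closedin_closed by blast
      moreover have "closure Q \<subseteq> T" using T by (intro closure_minimal) auto
      ultimately have "w \<in> Q" using w(1) by blast
      then show "p \<in> \<psi> ` Q" using w(2) by blast
    qed
    then have "P \<inter> \<psi> ` Q = P \<inter> \<psi> ` closure Q" using closure_subset[of Q] by blast
    then have cl: "closedin (top_of_set P) (P \<inter> \<psi> ` Q)" using clo by (simp add: closedin_closed_Int)
    have "P \<inter> \<psi> ` Q = {} \<or> P \<inter> \<psi> ` Q = P"
      using P(1) op cl unfolding connected_clopen by blast
    moreover have "P \<inter> \<psi> ` Q \<noteq> {}" using P(4) BQ by blast
    moreover have "P \<inter> \<psi> ` Q \<noteq> P" using P(3) QDR by blast
    ultimately show False by blast
  qed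
  define N where "N = - \<psi> ` D R"
  have "closed (\<psi> ` D R)" by (intro compact_imp_closed compact_continuous_image[OF \<psi>cont Dcomp])
  then have N: "open N" "x \<in> N" "y \<in> N" using \<psi>O by (auto simp: N_def O0_def)
  have "openin (top_of_set H) (H \<inter> ball q r')" by (rule openin_open_Int[OF open_ball])
  moreover have "H \<inter> ball q r' \<subseteq> D R" using r'(3) R(1) by (auto simp: D_def)
  ultimately have "openin (top_of_set Y) (\<psi> ` (H \<inter> ball q r'))" by (rule openY)
  then obtain Nz where Nz: "open Nz" "\<psi> ` (H \<inter> ball q r') = Y \<inter> Nz" unfolding openin_open by blast
  have "z \<in> \<psi> ` (H \<inter> ball q r')" using qz qk r'(1) by (force simp: H_def)
  then have zN: "z \<in> Nz" using Nz(2) by blast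
  have NzB: "P \<inter> \<psi> ` B \<noteq> {}" if P: "P \<subseteq> I" "P \<inter> Nz \<noteq> {}" for P
  proof -
    obtain p where p: "p \<in> P" "p \<in> Nz" using P(2) by blast
    then have "p \<in> \<psi> ` (H \<inter> ball q r')" using Nz(2) P(1) IY by blast
    then obtain w where w: "w \<in> H \<inter> ball q r'" "p = \<psi> w" by blast
    have "w \<in> D R" using w(1) r'(3) R(1) by (auto simp: D_def)
    then have "0 < w $ k" using I_iff p(1) P(1) w(2) by blast
    then have "w \<in> B" using w(1) by (simp add: B_def)
    then show ?thesis using w(2) p(1) by blast
  qed
  have small: "reach I p p' e" if pp: "p \<in> \<psi> ` C" "p' \<in> \<psi> ` C" for p p'
  proof (rule reach_on_circle[OF c(1) _ s(1) _ _ se Io _ _ _ _ pp])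
    have CD: "C \<subseteq> D R" using dC(1) VD by blast
    show "cball (snd c z) s \<subseteq> snd c ` fst c" using r0(2) s(3) subset_cball by blast
    show "gnorm c u v \<le> L * norm v" if "u \<in> cball (snd c z) s" for u v
      using L(2)[of u v] that s(3) by auto
    show "0 \<le> L" using L(1) by simp
    show "connected (\<psi> ` C)"
      by (rule connected_continuous_image[OF continuous_on_subset[OF \<psi>cont CD] C(1)])
    show "\<psi> ` C \<subseteq> I" using I_iff CD dC(1) by (auto simp: V_def)
    show "\<psi> ` C \<subseteq> fst c" using \<psi>O CD by (auto simp: O0_def)
    show "dist (snd c z) (snd c p) = s" if "p \<in> \<psi> ` C" for p
      using that dC(2) by (auto simp: d_def)
  qed
  have meet: "P \<inter> \<psi> ` C \<noteq> {}" if "connected P" "P \<subseteq> I" "P \<inter> N \<noteq> {}" "P \<inter> Nz \<noteq> {}" for P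
    by (rule cross[OF that(1,2) that(3)[unfolded N_def] NzB[OF that(2,4)]])
  show ?thesis
    by (intro exI[of _ N] exI[of _ Nz] exI[of _ "\<psi> ` C"] conjI N Nz(1) zN ballI allI impI small meet)
qed

end

section \<open>Curves that are Lipschitz for the metric \<open>\<rho>\<^sub>Y\<close>\<close>

lemma compact_functions_into:
  assumes "compact (Y :: 'a::topological_space set)"
  shows "compact {q :: 'i \<Rightarrow> 'a. \<forall>t. q t \<in> Y}"
proof -
  have "compactin (product_topology (\<lambda>i::'i. euclidean) UNIV) (PiE UNIV (\<lambda>i. Y))"
    unfolding compactin_PiE using assms by simp
  then have "compact (PiE (UNIV :: 'i set) (\<lambda>i. Y))"
    by (simp add: euclidean_product_topology)
  moreover have "PiE (UNIV :: 'i set) (\<lambda>i. Y) = {q. \<forall>t. q t \<in> Y}" by (auto simp: PiE_def Pi_def)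
  ultimately show ?thesis by simp
qed

text \<open>
  Cluster points replace convergent subsequences, since the function space in question need not be sequentially compact.
\<close>

lemma compact_sequence_cluster_point:
  assumes "compact S" "\<And>n::nat. q n \<in> S"
  shows "\<exists>p\<in>S. \<forall>W E. open W \<longrightarrow> p \<in> W \<longrightarrow> eventually E sequentially \<longrightarrow> (\<exists>n. E n \<and> q n \<in> W)"
proof -
  have "filtermap q sequentially \<noteq> bot" by (simp add: filtermap_bot_iff)
  moreover have "eventually (\<lambda>x. x \<in> S) (filtermap q sequentially)"
    using assms(2) by (simp add: eventually_filtermap)
  ultimately obtain p where p: "p \<in> S" "inf (nhds p) (filtermap q sequentially) \<noteq> bot"
    using assms(1) unfolding compact_filter by blast
  have "\<exists>n. E n \<and> q n \<in> W" if W: "open W" "p \<in> W" "eventually E sequentially" for W E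
  proof (rule ccontr)
    assume no: "\<not> (\<exists>n. E n \<and> q n \<in> W)"
    have "eventually (\<lambda>x. x \<in> W) (nhds p)" using W(1,2) by (rule eventually_nhds_in_open)
    moreover have "eventually (\<lambda>x. x \<notin> W) (filtermap q sequentially)"
      unfolding eventually_filtermap using W(3) by (rule eventually_mono) (use no in blast)
    ultimately have "eventually (\<lambda>x. False) (inf (nhds p) (filtermap q sequentially))"
      unfolding eventually_inf by blast
    then show False using p(2) by (simp add: trivial_limit_def)
  qed
  then show ?thesis using p(1) by blast
qed

context riemannian
begin

lemma reach_endpoints: "reach I x y a \<Longrightarrow> x \<in> I \<and> y \<in> I \<and> 0 < a"
  unfolding reach_def smooth_path_iff using riem_length_nonneg
  by (metis le_less_trans pathfinish_in_path_image pathstart_in_path_image subsetD)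

lemma intr_dist_less_iff:
  fixes Y :: "'a set"
  shows "intr_dist A g Y x y < ennreal a \<longleftrightarrow> reach (intr TYPE('n) Y) x y a"
proof -
  have "ennreal (riem_length A g \<gamma>) < ennreal a \<longleftrightarrow> riem_length A g \<gamma> < a" if "smooth_path A \<gamma>" for \<gamma>
    using that riem_length_nonneg[of \<gamma>] by (simp add: smooth_path_iff ennreal_less_iff)
  then show ?thesis
    unfolding intr_dist_def INF_less_iff reach_def by auto
qed

text \<open>
  The two lemmas \<open>rho_near\<close> and \<open>rho_leI\<close> express the lower limit that defines \<open>\<rho>\<^sub>Y\<close> by short paths
  between nearby interior points.
\<close>

lemma rho_near:
  fixes Y :: "'a set"
  assumes r: "rho A g Y x y < ennreal a" and P: "open P" "x \<in> P" and Q: "open Q" "y \<in> Q"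
  shows "\<exists>x'\<in>P. \<exists>y'\<in>Q. reach (intr TYPE('n) Y) x' y' a"
proof (rule ccontr)
  assume no: "\<not> ?thesis"
  have "eventually (\<lambda>p. p \<in> P \<times> Q) (nhds (x, y))"
    by (rule eventually_nhds_in_open) (use P Q in \<open>auto intro: open_Times\<close>)
  then have "eventually (\<lambda>p. ennreal a \<le> (case p of (x', y') \<Rightarrow> intr_dist A g Y x' y')) (nhds (x, y))"
  proof (rule eventually_mono)
    fix p assume "p \<in> P \<times> Q"
    then obtain x' y' where p: "p = (x', y')" "x' \<in> P" "y' \<in> Q" by blast
    then have "\<not> intr_dist A g Y x' y' < ennreal a" using no intr_dist_less_iff by blast
    then show "ennreal a \<le> (case p of (x', y') \<Rightarrow> intr_dist A g Y x' y')" by (simp add: p(1) not_less)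
  qed
  then have "eventually (\<lambda>p. ennreal a \<le> (case p of (x', y') \<Rightarrow> intr_dist A g Y x' y'))
     (inf (nhds (x, y)) (principal (intr TYPE('n) Y \<times> intr TYPE('n) Y)))"
    unfolding eventually_inf_principal by (rule eventually_mono) blast
  then have "ennreal a \<le> rho A g Y x y" unfolding rho_def by (rule Liminf_bounded)
  then show False using r by simp
qed

lemma rho_leI:
  fixes Y :: "'a set"
  assumes "\<And>a P Q. r < a \<Longrightarrow> open P \<Longrightarrow> x \<in> P \<Longrightarrow> open Q \<Longrightarrow> y \<in> Q \<Longrightarrow>
      \<exists>x'\<in>P. \<exists>y'\<in>Q. reach (intr TYPE('n) Y) x' y' a"
    and r: "0 \<le> r"
  shows "rho A g Y x y \<le> ennreal r"
proof (rule ccontr)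
  assume "\<not> ?thesis"
  then obtain m where m: "ennreal r < m" "m < rho A g Y x y" using dense not_le by metis
  have "m < top" using order_less_le_trans[OF m(2) top_greatest] .
  then obtain a where a: "m = ennreal a" "0 \<le> a" unfolding less_top_ennreal by blast
  have ra: "r < a" using m(1) r by (simp add: a(1) ennreal_less_iff)
  let ?I = "intr TYPE('n) Y"
  have "eventually (\<lambda>p. m < (case p of (x', y') \<Rightarrow> intr_dist A g Y x' y'))
     (inf (nhds (x, y)) (principal (?I \<times> ?I)))"
    using m(2) unfolding rho_def by (rule less_LiminfD)
  then have "eventually (\<lambda>p. p \<in> ?I \<times> ?I \<longrightarrow> m < (case p of (x', y') \<Rightarrow> intr_dist A g Y x' y')) (nhds (x, y))"
    unfolding eventually_inf_principal .
  then obtain S where S: "open S" "(x, y) \<in> S"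
    "\<And>p. p \<in> S \<Longrightarrow> p \<in> ?I \<times> ?I \<Longrightarrow> m < (case p of (x', y') \<Rightarrow> intr_dist A g Y x' y')"
    unfolding eventually_nhds by blast
  obtain P Q where PQ: "open P" "open Q" "(x, y) \<in> P \<times> Q" "P \<times> Q \<subseteq> S"
    using open_prod_elim[OF S(1,2)] by metis
  then obtain x' y' where xy: "x' \<in> P" "y' \<in> Q" "reach ?I x' y' a"
    using assms(1)[OF ra, of P Q] by blast
  have "(x', y') \<in> ?I \<times> ?I" using reach_endpoints[OF xy(3)] by blast
  then have "m < intr_dist A g Y x' y'" using S(3)[of "(x', y')"] PQ(4) xy(1,2) by auto
  then show False using xy(3) a(1) intr_dist_less_iff by (metis less_asym)
qed

lemma rho_less_imp_near:
  fixes Y :: "'a set"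
  assumes N: "open N" "q \<in> N"
  shows "\<exists>\<delta>>0. \<forall>q'. rho A g Y q q' < ennreal \<delta> \<or> rho A g Y q' q < ennreal \<delta> \<longrightarrow> q' \<in> N"
proof -
  obtain W V \<delta> where W: "open W" "q \<in> W" "open V" "- N \<subseteq> V" "0 < \<delta>"
    "\<And>I x y. x \<in> W \<Longrightarrow> y \<in> V \<Longrightarrow> \<not> reach I x y \<delta>"
    using length_lower_bound[OF N] by blast
  have "q' \<in> N" if "rho A g Y q q' < ennreal \<delta> \<or> rho A g Y q' q < ennreal \<delta>" for q'
  proof (rule ccontr)
    assume "q' \<notin> N"
    then have V: "q' \<in> V" using W(4) by blast
    from that show False
    proof
      assume "rho A g Y q q' < ennreal \<delta>"
      from rho_near[OF this W(1,2) W(3) V] show False using W(6) by blast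
    next
      assume "rho A g Y q' q < ennreal \<delta>"
      from rho_near[OF this W(3) V W(1,2)] show False using W(6) reach_sym by blast
    qed
  qed
  then show ?thesis using W(5) by blast
qed

text \<open>
  Points close in \<open>\<rho>\<^sub>Y\<close> are close in the topology of the manifold, by \<open>rho_less_imp_near\<close>. Both
  directions of \<open>\<rho>\<^sub>Y\<close> occur, for parameters on either side of a given one.
\<close>

lemma rho_lipschitz_continuous:
  fixes Y :: "'a set"
  assumes p: "\<And>s t. 0 \<le> s \<Longrightarrow> s \<le> t \<Longrightarrow> t \<le> 1 \<Longrightarrow> rho A g Y (p s) (p t) \<le> ennreal ((t - s) * r)"
    and r: "0 \<le> r"
  shows "continuous_on {0..1} p"
  unfolding continuous_on_topological
proof (intro ballI allI impI)
  fix t0 :: real and N assume t0: "t0 \<in> {0..1}" and N: "open N" "p t0 \<in> N"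
  obtain \<delta> where \<delta>: "0 < \<delta>"
    "\<And>q'. rho A g Y (p t0) q' < ennreal \<delta> \<or> rho A g Y q' (p t0) < ennreal \<delta> \<Longrightarrow> q' \<in> N"
    using rho_less_imp_near[OF N] by metis
  have "p t \<in> N" if t: "t \<in> {0..1}" "t \<in> ball t0 (\<delta> / (r + 1))" for t
  proof -
    have "\<bar>t - t0\<bar> * r \<le> \<bar>t - t0\<bar> * (r + 1)" by (intro mult_left_mono) auto
    also have "\<dots> < \<delta>" using t(2) r by (simp add: dist_real_def abs_minus_commute field_simps)
    finally have small: "ennreal (\<bar>t - t0\<bar> * r) < ennreal \<delta>" using \<delta>(1) by (simp add: ennreal_lessI)
    show ?thesis
    proof (cases "t0 \<le> t")
      case True
      then have "rho A g Y (p t0) (p t) \<le> ennreal (\<bar>t - t0\<bar> * r)" using p[of t0 t] t t0 by simp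
      then show ?thesis using small \<delta>(2) by (meson le_less_trans)
    next
      case False
      then have "rho A g Y (p t) (p t0) \<le> ennreal (\<bar>t - t0\<bar> * r)" using p[of t t0] t t0 by simp
      then show ?thesis using small \<delta>(2) by (meson le_less_trans)
    qed
  qed
  moreover have "t0 \<in> ball t0 (\<delta> / (r + 1))" using \<delta>(1) r by simp
  ultimately show "\<exists>T. open T \<and> t0 \<in> T \<and> (\<forall>y\<in>{0..1}. y \<in> T \<longrightarrow> p y \<in> N)"
    using open_ball by blast
qed

lemma reach_continuum:
  assumes I: "open I" and r: "reach I x y a"
  shows "\<exists>P. connected P \<and> P \<subseteq> I \<and> x \<in> P \<and> y \<in> P \<and> (\<forall>p\<in>P. reach I x p a)"
proof -
  obtain \<gamma> where \<gamma>: "smooth_curve \<gamma>" "path_image \<gamma> \<subseteq> I" "\<gamma> 0 = x" "\<gamma> 1 = y" "riem_length A g \<gamma> < a"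
    using r unfolding reach_def smooth_path_iff pathstart_def pathfinish_def by blast
  have "reach I x p a" if p: "p \<in> path_image \<gamma>" for p
  proof -
    obtain t where t: "t \<in> {0..1}" "p = \<gamma> t" using p unfolding path_image_def by blast
    have "integral {0..t} (speed A g \<gamma>) \<le> riem_length A g \<gamma>" unfolding riem_length_def
      by (rule integral_subset_le)
         (use t speed_integrable[OF \<gamma>(1)] speed_nonneg[OF \<gamma>(1)] in auto)
    then have "reach I (\<gamma> 0) (\<gamma> t) a"
      using t \<gamma>(5) by (intro reach_subpath[OF I \<gamma>(1,2)]) auto
    then show ?thesis using t \<gamma>(3) by simp
  qed
  moreover have "connected (path_image \<gamma>)" using smooth_curve_path[OF \<gamma>(1)] by (rule connected_path_image)
  moreover have "x \<in> path_image \<gamma>" "y \<in> path_image \<gamma>" unfolding path_image_def using \<gamma>(3,4) by force+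
  ultimately show ?thesis using \<gamma>(2) by blast
qed

text \<open>
  A path is parametrized proportionally to arc length by choosing, for each \<open>t\<close>, some time at which the
  fraction \<open>t\<close> of the length has been covered. The choice need not be continuous or monotone: only the
  bound on the length between two parameters is used.
\<close>

lemma reach_parametrized:
  assumes I: "open I" and r: "reach I x y a"
  shows "\<exists>q. q 0 = x \<and> q 1 = y \<and> (\<forall>t. q t \<in> I) \<and>
    (\<forall>s t a'. 0 \<le> s \<longrightarrow> s \<le> t \<longrightarrow> t \<le> (1::real) \<longrightarrow> (t - s) * a < a' \<longrightarrow> reach I (q s) (q t) a')"
proof -
  obtain \<gamma> where \<gamma>: "smooth_curve \<gamma>" "path_image \<gamma> \<subseteq> I" "\<gamma> 0 = x" "\<gamma> 1 = y" "riem_length A g \<gamma> < a"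
    using r unfolding reach_def smooth_path_iff pathstart_def pathfinish_def by blast
  define l where "l = riem_length A g \<gamma>"
  define J where "J u = integral {0..u} (speed A g \<gamma>)" for u
  have l: "0 \<le> l" "l < a" using riem_length_nonneg[OF \<gamma>(1)] \<gamma>(5) by (auto simp: l_def)
  have spi: "speed A g \<gamma> integrable_on {0..1}" by (rule speed_integrable[OF \<gamma>(1)]) simp
  have J: "J 0 = 0" "J 1 = l" by (simp_all add: J_def l_def riem_length_def)
  have Jc: "continuous_on {0..1} J" unfolding J_def by (rule indefinite_integral_continuous_1[OF spi])
  have "\<exists>u\<in>{0..1}. J u = t * l \<and> (t = 0 \<longrightarrow> u = 0) \<and> (t = 1 \<longrightarrow> u = 1)" if t: "t \<in> {0..1}" for t
  proof -
    consider "t = 0" | "t = 1" | "0 < t" "t < 1" using t by fastforce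
    then show ?thesis
    proof cases
      case 1 then show ?thesis using J by (intro bexI[of _ 0]) auto
    next
      case 2 then show ?thesis using J by (intro bexI[of _ 1]) auto
    next
      case 3
      have "t * l \<le> 1 * l" using t l by (intro mult_right_mono) auto
      then have "\<exists>u\<ge>0. u \<le> 1 \<and> J u = t * l"
        by (intro IVT' Jc) (use J t l in auto)
      then show ?thesis using 3 by auto
    qed
  qed
  then obtain \<tau> where \<tau>: "\<And>t. t \<in> {0..1} \<Longrightarrow> \<tau> t \<in> {0..1} \<and> J (\<tau> t) = t * l \<and>
      (t = 0 \<longrightarrow> \<tau> t = 0) \<and> (t = 1 \<longrightarrow> \<tau> t = 1)" by metis
  have Jdiff: "integral {u..v} (speed A g \<gamma>) = J v - J u" if "0 \<le> u" "u \<le> v" "v \<le> 1" for u v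
  proof -
    have "speed A g \<gamma> integrable_on {0..v}" by (rule speed_integrable[OF \<gamma>(1)]) (use that in auto)
    from Henstock_Kurzweil_Integration.integral_combine[OF that(1,2) this] show ?thesis by (simp add: J_def)
  qed
  \<comment> \<open>the value outside \<open>[0,1]\<close> only has to lie in \<open>I\<close>, so that the curves belong to one compact space of functions\<close>
  define q where "q t = (if t \<in> {0..1} then \<gamma> (\<tau> t) else x)" for t
  have q01: "q 0 = x" "q 1 = y" using \<tau>[of 0] \<tau>[of 1] \<gamma>(3,4) by (simp_all add: q_def)
  have qI: "q t \<in> I" for t
    using \<tau>[of t] \<gamma>(2) reach_endpoints[OF r] by (auto simp: q_def path_image_def)
  have "reach I (q s) (q t) a'" if st: "0 \<le> s" "s \<le> t" "t \<le> 1" and a': "(t - s) * a < a'" for s t a'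
  proof -
    have s: "s \<in> {0..1}" and t: "t \<in> {0..1}" using st by auto
    have "(t - s) * l \<le> (t - s) * a" using st l by (intro mult_left_mono) auto
    then have small: "(t - s) * l < a'" using a' by simp
    have nn: "0 \<le> (t - s) * l" using st l by simp
    show ?thesis
    proof (cases "\<tau> s \<le> \<tau> t")
      case True
      have "integral {\<tau> s..\<tau> t} (speed A g \<gamma>) < a'"
        using Jdiff[of "\<tau> s" "\<tau> t"] True \<tau>[OF s] \<tau>[OF t] small by (simp add: algebra_simps)
      then have "reach I (\<gamma> (\<tau> s)) (\<gamma> (\<tau> t)) a'"
        using reach_subpath[OF I \<gamma>(1,2), of "\<tau> s" "\<tau> t" a'] True \<tau>[OF s] \<tau>[OF t] by simp
      then show ?thesis using s t by (simp add: q_def)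
    next
      case False
      have "integral {\<tau> t..\<tau> s} (speed A g \<gamma>) < a'"
        using Jdiff[of "\<tau> t" "\<tau> s"] False \<tau>[OF s] \<tau>[OF t] small nn by (simp add: algebra_simps)
      then have "reach I (\<gamma> (\<tau> t)) (\<gamma> (\<tau> s)) a'"
        using reach_subpath[OF I \<gamma>(1,2), of "\<tau> t" "\<tau> s" a'] False \<tau>[OF s] \<tau>[OF t] by simp
      then show ?thesis using s t by (simp add: q_def reach_sym)
    qed
  qed
  then show ?thesis using q01 qI by blast
qed

text \<open>
  Take interior paths from points tending to \<open>x\<close> to points tending to \<open>y\<close> with lengths tending to
  \<open>\<rho>\<^sub>Y(x,y)\<close>, parametrized proportionally to arc length. By Tychonoff's theorem they have a pointwise
  cluster point, and lower semicontinuity of \<open>\<rho>\<^sub>Y\<close> passes the Lipschitz bound on to it.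
\<close>

lemma rho_lipschitz_curve:
  fixes Y :: "'a set"
  assumes Y: "C0_submanifold TYPE('n) Y" "compact Y" and xy: "rho A g Y x y = ennreal r" "0 \<le> r"
  shows "\<exists>p. p 0 = x \<and> p 1 = y \<and> (\<forall>t. p t \<in> Y) \<and>
    (\<forall>s t. 0 \<le> s \<longrightarrow> s \<le> t \<longrightarrow> t \<le> (1::real) \<longrightarrow> rho A g Y (p s) (p t) \<le> ennreal ((t - s) * r))"
proof -
  define I where "I = intr TYPE('n) Y"
  have Io: "open I" unfolding I_def by (rule intr_open[OF Y(1)])
  have IY: "I \<subseteq> Y" by (auto simp: I_def intr_def)
  define a where "a n = r + 1 / real (Suc n)" for n
  obtain P where P: "\<And>n::nat. open (P n)" "\<And>n. x \<in> P n"
    "\<And>S. open S \<Longrightarrow> x \<in> S \<Longrightarrow> eventually (\<lambda>n. P n \<subseteq> S) sequentially"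
    using countable_basis_at_decseq[of x] by blast
  obtain Q where Q: "\<And>n::nat. open (Q n)" "\<And>n. y \<in> Q n"
    "\<And>S. open S \<Longrightarrow> y \<in> S \<Longrightarrow> eventually (\<lambda>n. Q n \<subseteq> S) sequentially"
    using countable_basis_at_decseq[of y] by blast
  have "\<exists>q. q 0 \<in> P n \<and> q 1 \<in> Q n \<and> (\<forall>t. q t \<in> I) \<and>
    (\<forall>s t a'. 0 \<le> s \<longrightarrow> s \<le> t \<longrightarrow> t \<le> (1::real) \<longrightarrow> (t - s) * a n < a' \<longrightarrow> reach I (q s) (q t) a')" for n
  proof -
    have "rho A g Y x y < ennreal (a n)" using xy by (simp add: a_def ennreal_less_iff)
    from rho_near[OF this P(1,2) Q(1,2)] obtain x' y' where "x' \<in> P n" "y' \<in> Q n" "reach I x' y' (a n)"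
      unfolding I_def by blast
    then show ?thesis using reach_parametrized[OF Io, of x' y' "a n"] by blast
  qed
  then obtain q where q: "\<And>n. q n 0 \<in> P n" "\<And>n. q n 1 \<in> Q n" "\<And>n t. q n t \<in> I"
    "\<And>n s t a'. 0 \<le> s \<Longrightarrow> s \<le> t \<Longrightarrow> t \<le> (1::real) \<Longrightarrow> (t - s) * a n < a' \<Longrightarrow> reach I (q n s) (q n t) a'"
    by metis
  have "q n \<in> {q. \<forall>t. q t \<in> Y}" for n using q(3) IY by blast
  from compact_sequence_cluster_point[OF compact_functions_into[OF Y(2)], of q, OF this]
  obtain p where p: "\<And>t. p t \<in> Y"
    and freq: "\<And>W E. open W \<Longrightarrow> p \<in> W \<Longrightarrow> eventually E sequentially \<Longrightarrow> \<exists>n. E n \<and> q n \<in> W"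
    by blast
  have proj: "open {f :: real \<Rightarrow> 'a. f t \<in> S}" if "open S" for t S
    using open_vimage[OF that continuous_on_product_coordinates[of t]] by (simp add: vimage_def)
  have p0: "p 0 = x"
  proof (rule ccontr)
    assume "p 0 \<noteq> x"
    then obtain U V where UV: "open U" "open V" "p 0 \<in> U" "x \<in> V" "U \<inter> V = {}"
      unfolding separation_t2 by blast
    have "p \<in> {f. f 0 \<in> U}" using UV(3) by simp
    from freq[OF proj[OF UV(1)] this P(3)[OF UV(2,4)]]
    obtain n where "P n \<subseteq> V" "q n 0 \<in> U" by blast
    then show False using q(1)[of n] UV(5) by blast
  qed
  have p1: "p 1 = y"
  proof (rule ccontr)
    assume "p 1 \<noteq> y"
    then obtain U V where UV: "open U" "open V" "p 1 \<in> U" "y \<in> V" "U \<inter> V = {}"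
      unfolding separation_t2 by blast
    have "p \<in> {f. f 1 \<in> U}" using UV(3) by simp
    from freq[OF proj[OF UV(1)] this Q(3)[OF UV(2,4)]]
    obtain n where "Q n \<subseteq> V" "q n 1 \<in> U" by blast
    then show False using q(2)[of n] UV(5) by blast
  qed
  have "rho A g Y (p s) (p t) \<le> ennreal ((t - s) * r)" if st: "0 \<le> s" "s \<le> t" "t \<le> 1" for s t
  proof (rule rho_leI)
    fix a' S T assume a': "(t - s) * r < a'" and S: "open S" "p s \<in> S" and T: "open T" "p t \<in> T"
    have "a \<longlonglongrightarrow> r + 0" unfolding a_def
      by (intro tendsto_add tendsto_const LIMSEQ_Suc[OF lim_1_over_n])
    then have "(\<lambda>n. (t - s) * a n) \<longlonglongrightarrow> (t - s) * r" by (intro tendsto_mult tendsto_const) simp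
    then have "eventually (\<lambda>n. (t - s) * a n < a') sequentially" using a' by (rule order_tendstoD(2))
    moreover have "p \<in> {f. f s \<in> S} \<inter> {f. f t \<in> T}" using S(2) T(2) by simp
    ultimately obtain n where "(t - s) * a n < a'" "q n s \<in> S" "q n t \<in> T"
      using freq[OF open_Int[OF proj[OF S(1)] proj[OF T(1)]]] by blast
    then show "\<exists>x'\<in>S. \<exists>y'\<in>T. reach (intr TYPE('n) Y) x' y' a'"
      using q(4)[OF st] unfolding I_def by blast
  qed (use st xy in simp)
  then show ?thesis using p0 p1 p by blast
qed

end

section \<open>Triangle inequality and shortest paths\<close>

context riemannian_surface
begin

text \<open>
  The path near \<open>x\<close> and the path near \<open>y\<close> end at different points close to \<open>z\<close>. They are connected at
  cost \<open>e\<close>: within a small neighbourhood if \<open>z\<close> is an interior point, and along the crosscut of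
  \<open>separating_ring\<close>, which both of them meet, if \<open>z\<close> is a boundary point. The degenerate cases are
  split off because the crosscut separates \<open>z\<close> from other points.
\<close>

lemma rho_triangle_less:
  fixes Y :: "'a set"
  assumes Y: "C0_submanifold TYPE(2) Y" and z: "z \<in> Y"
    and xz: "rho A g Y x z < ennreal a" and zy: "rho A g Y z y < ennreal b"
  shows "rho A g Y x y \<le> ennreal (a + b)"
proof -
  have ab: "0 < a" "0 < b" using xz zy by (metis ennreal_neg not_less not_less_zero)+
  define I where "I = intr TYPE(2) Y"
  have Io: "open I" unfolding I_def by (rule intr_open[OF Y])
  consider "x = z" | "y = z" | "x \<noteq> z" "y \<noteq> z" by blast
  then show ?thesis
  proof cases
    case 1
    then have "rho A g Y x y \<le> ennreal b" using zy by simp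
    also have "\<dots> \<le> ennreal (a + b)" using ab by (simp add: ennreal_leI)
    finally show ?thesis .
  next
    case 2
    then have "rho A g Y x y \<le> ennreal a" using xz by simp
    also have "\<dots> \<le> ennreal (a + b)" using ab by (simp add: ennreal_leI)
    finally show ?thesis .
  next
    case 3
    show ?thesis
    proof (rule rho_leI)
      fix a' P Q assume a': "a + b < a'" and P: "open P" "x \<in> P" and Q: "open Q" "y \<in> Q"
      define e where "e = a' - (a + b)"
      have e: "0 < e" using a' by (simp add: e_def)
      show "\<exists>x'\<in>P. \<exists>y'\<in>Q. reach (intr TYPE(2) Y) x' y' a'"
      proof (cases "z \<in> I")
        case True
        obtain N where N: "open N" "z \<in> N" "\<And>p p'. p \<in> N \<Longrightarrow> p' \<in> N \<Longrightarrow> reach I p p' e"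
          using reach_nbhd[OF Io True e] by blast
        obtain x' z' where x': "x' \<in> P" "z' \<in> N" "reach I x' z' a"
          using rho_near[OF xz P N(1,2)] unfolding I_def by blast
        obtain z'' y' where y': "z'' \<in> N" "y' \<in> Q" "reach I z'' y' b"
          using rho_near[OF zy N(1,2) Q] unfolding I_def by blast
        have "reach I x' y' (a + e + b)"
          by (rule reach_trans[OF reach_trans[OF x'(3) N(3)[OF x'(2) y'(1)]] y'(3)])
        then show ?thesis using x'(1) y'(2) by (auto simp: e_def I_def)
      next
        case False
        then have "z \<in> bdry TYPE(2) Y" using z by (simp add: I_def intr_def)
        from separating_ring[OF Y this 3 e, folded I_def] obtain N Nz D where
          N: "open N" "x \<in> N" "y \<in> N" "open Nz" "z \<in> Nz"
          and D: "\<forall>p\<in>D. \<forall>p'\<in>D. reach I p p' e"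
          and meet: "\<forall>K. connected K \<longrightarrow> K \<subseteq> I \<longrightarrow> K \<inter> N \<noteq> {} \<longrightarrow> K \<inter> Nz \<noteq> {} \<longrightarrow> K \<inter> D \<noteq> {}"
          by (elim exE conjE)
        have hit: "\<exists>d\<in>D. reach I u d l" if u: "u \<in> N" "w \<in> Nz" "reach I u w l" for u w l
        proof -
          obtain K where K: "connected K" "K \<subseteq> I" "u \<in> K" "w \<in> K" "\<And>p. p \<in> K \<Longrightarrow> reach I u p l"
            using reach_continuum[OF Io u(3)] by blast
          then have "K \<inter> D \<noteq> {}" using meet u(1,2) by blast
          then show ?thesis using K(5) by blast
        qed
        obtain x' z' where x': "x' \<in> P \<inter> N" "z' \<in> Nz" "reach I x' z' a"
          using rho_near[OF xz open_Int[OF P(1) N(1)] _ N(4,5)] P(2) N(2) unfolding I_def by blast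
        obtain z'' y' where y': "z'' \<in> Nz" "y' \<in> Q \<inter> N" "reach I z'' y' b"
          using rho_near[OF zy N(4,5) open_Int[OF Q(1) N(1)]] Q(2) N(3) unfolding I_def by blast
        obtain d where d: "d \<in> D" "reach I x' d a" using hit[OF _ x'(2,3)] x'(1) by blast
        obtain d' where d': "d' \<in> D" "reach I y' d' b" using hit[OF _ y'(1) reach_sym[OF y'(3)]] y'(2) by blast
        have "reach I x' y' (a + e + b)"
          by (rule reach_trans[OF reach_trans[OF d(2) D[rule_format, OF d(1) d'(1)]] reach_sym[OF d'(2)]])
        then show ?thesis using x'(1) y'(2) by (auto simp: e_def I_def)
      qed
    qed (use ab in simp)
  qed
qed

lemma rho_triangle:
  fixes Y :: "'a set"
  assumes Y: "C0_submanifold TYPE(2) Y" and z: "z \<in> Y"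
    and xz: "rho A g Y x z \<le> ennreal a" and zy: "rho A g Y z y \<le> ennreal b" and ab: "0 \<le> a" "0 \<le> b"
  shows "rho A g Y x y \<le> ennreal (a + b)"
proof (rule ennreal_le_epsilon)
  fix e :: real assume e: "0 < e"
  have "rho A g Y x z < ennreal (a + e / 2)"
    by (rule le_less_trans[OF xz]) (use ab e in \<open>simp add: ennreal_less_iff\<close>)
  moreover have "rho A g Y z y < ennreal (b + e / 2)"
    by (rule le_less_trans[OF zy]) (use ab e in \<open>simp add: ennreal_less_iff\<close>)
  ultimately have "rho A g Y x y \<le> ennreal (a + e / 2 + (b + e / 2))"
    by (rule rho_triangle_less[OF Y z])
  then have "rho A g Y x y \<le> ennreal (a + b + e)" by (simp add: algebra_simps)
  then show "rho A g Y x y \<le> ennreal (a + b) + ennreal e" using ab e by (simp add: ennreal_plus)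
qed

text \<open>
  The curves from \<open>x\<close> to \<open>z\<close> and from \<open>z\<close> to \<open>y\<close> together are Lipschitz with constant \<open>r = \<rho>\<^sub>Y(x,y)\<close>, by
  the triangle inequality at \<open>z\<close>. Since \<open>r\<close> is also the distance of the end points, no pair of
  parameters can have a smaller distance than the bound allows.
\<close>

lemma shortest_path_through:
  fixes Y :: "'a set"
  assumes Y: "C0_submanifold TYPE(2) Y" "compact Y"
    and xzy: "x \<in> Y" "z \<in> Y" "y \<in> Y" "x \<noteq> y" and t0: "0 < t0" "t0 < 1" and r: "0 \<le> r"
    and xy: "rho A g Y x y = ennreal r"
    and xz: "rho A g Y x z = ennreal (t0 * r)" and zy: "rho A g Y z y = ennreal ((1 - t0) * r)"
  shows "\<exists>\<gamma>. shortest_path A g Y x y \<gamma> \<and> \<gamma> t0 = z"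
proof -
  have r12: "0 \<le> t0 * r" "0 \<le> (1 - t0) * r" using t0 r by auto
  obtain p1 where p1: "p1 0 = x" "p1 1 = z" "\<And>t. p1 t \<in> Y"
    "\<And>s t. 0 \<le> s \<Longrightarrow> s \<le> t \<Longrightarrow> t \<le> (1::real) \<Longrightarrow> rho A g Y (p1 s) (p1 t) \<le> ennreal ((t - s) * (t0 * r))"
    using rho_lipschitz_curve[OF Y xz r12(1)] by blast
  obtain p2 where p2: "p2 0 = z" "p2 1 = y" "\<And>t. p2 t \<in> Y"
    "\<And>s t. 0 \<le> s \<Longrightarrow> s \<le> t \<Longrightarrow> t \<le> (1::real) \<Longrightarrow> rho A g Y (p2 s) (p2 t) \<le> ennreal ((t - s) * ((1 - t0) * r))"
    using rho_lipschitz_curve[OF Y zy r12(2)] by blast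
  define p where "p t = (if t \<le> t0 then p1 (t / t0) else p2 ((t - t0) / (1 - t0)))" for t
  have pz: "p t0 = z" and p01: "p 0 = x" "p 1 = y" using t0 p1(1,2) p2(1,2) by (simp_all add: p_def)
  have pY: "p t \<in> Y" for t using p1(3) p2(3) by (simp add: p_def)
  have left: "rho A g Y (p s) (p t) \<le> ennreal ((t - s) * r)" if st: "0 \<le> s" "s \<le> t" "t \<le> t0" for s t
  proof -
    have "(t / t0 - s / t0) * (t0 * r) = (t - s) * r" using t0 by (simp add: field_simps)
    moreover have "rho A g Y (p1 (s / t0)) (p1 (t / t0)) \<le> ennreal ((t / t0 - s / t0) * (t0 * r))"
      by (rule p1(4)) (use st t0 in \<open>auto intro: divide_right_mono\<close>)
    moreover have "p s = p1 (s / t0)" "p t = p1 (t / t0)" using st by (simp_all add: p_def)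
    ultimately show ?thesis by (simp only:)
  qed
  have p2': "p t = p2 ((t - t0) / (1 - t0))" if "t0 \<le> t" for t
    using that p1(2) p2(1) t0 by (auto simp: p_def)
  have right: "rho A g Y (p s) (p t) \<le> ennreal ((t - s) * r)" if st: "t0 \<le> s" "s \<le> t" "t \<le> 1" for s t
  proof -
    have "((t - t0) / (1 - t0) - (s - t0) / (1 - t0)) * ((1 - t0) * r) = (t - s) * r"
      using t0 by (simp flip: diff_divide_distrib)
    moreover have "rho A g Y (p2 ((s - t0) / (1 - t0))) (p2 ((t - t0) / (1 - t0)))
        \<le> ennreal (((t - t0) / (1 - t0) - (s - t0) / (1 - t0)) * ((1 - t0) * r))"
      by (rule p2(4)) (use st t0 in \<open>auto intro: divide_right_mono\<close>)
    moreover have "p s = p2 ((s - t0) / (1 - t0))" "p t = p2 ((t - t0) / (1 - t0))"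
      using p2' st by simp_all
    ultimately show ?thesis by (simp only:)
  qed
  have lip: "rho A g Y (p s) (p t) \<le> ennreal ((t - s) * r)" if st: "0 \<le> s" "s \<le> t" "t \<le> 1" for s t
  proof -
    consider "t \<le> t0" | "t0 \<le> s" | "s \<le> t0" "t0 \<le> t" by linarith
    then show ?thesis
    proof cases
      case 3
      have "rho A g Y (p s) (p t) \<le> ennreal ((t0 - s) * r + (t - t0) * r)"
        by (rule rho_triangle[OF Y(1) pY left right]) (use st 3 r in auto)
      then show ?thesis by (simp add: algebra_simps)
    qed (use left right st in auto)
  qed
  have cont: "continuous_on {0..1} p" by (rule rho_lipschitz_continuous[OF lip r])
  have eq: "rho A g Y (p s) (p t) = ennreal (t - s) * rho A g Y x y" if st: "0 \<le> s" "s < t" "t \<le> 1" for s t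
  proof -
    have up: "rho A g Y (p s) (p t) \<le> ennreal ((t - s) * r)" using lip st by simp
    obtain v where v: "rho A g Y (p s) (p t) = ennreal v" "0 \<le> v"
      using up by (cases "rho A g Y (p s) (p t)") (auto simp: top_unique)
    have v1: "v \<le> (t - s) * r" using up v st r by (simp add: ennreal_le_iff)
    have 1: "rho A g Y x (p s) \<le> ennreal (s * r)" using lip[of 0 s] p01(1) st by simp
    have 2: "rho A g Y (p t) y \<le> ennreal ((1 - t) * r)" using lip[of t 1] p01(2) st by simp
    have "rho A g Y x (p t) \<le> ennreal (s * r + v)"
      by (rule rho_triangle[OF Y(1) pY 1]) (use v st r in auto)
    then have "rho A g Y x y \<le> ennreal (s * r + v + (1 - t) * r)"
      by (rule rho_triangle[OF Y(1) pY _ 2]) (use v st r in auto)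
    moreover have "0 \<le> s * r + v + (1 - t) * r" using v st r by simp
    ultimately have "r \<le> s * r + v + (1 - t) * r" unfolding xy by (simp only: ennreal_le_iff)
    then have "v = (t - s) * r" using v1 by (simp add: algebra_simps)
    then show ?thesis using v(1) st r by (simp add: xy ennreal_mult)
  qed
  have "\<not> p constant_on {0..1}"
  proof
    assume "p constant_on {0..1}"
    then have "p 0 = p 1" unfolding constant_on_def by fastforce
    then show False using p01 xzy(4) by simp
  qed
  then have "shortest_path A g Y x y p"
    unfolding shortest_path_def nonconst_path_def path_def path_image_def pathstart_def pathfinish_def
    using xzy cont pY p01 eq by auto
  then show ?thesis using pz by blast
qed

lemma property_circ_transfer:
  fixes Y1 Y2 :: "'a set"
  assumes Y1: "C0_submanifold TYPE(2) Y1" "compact Y1" "condition_i A g Y1" "property_circ A g Y1"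
    and iso: "boundaries_isometric A g Y1 Y2"
  shows "property_circ A g Y2"
  unfolding property_circ_def
proof (intro ballI allI impI subsetI)
  fix x y \<gamma> w
  assume x: "x \<in> bdry TYPE(2) Y2" and y: "y \<in> bdry TYPE(2) Y2"
    and sp: "shortest_path A g Y2 x y \<gamma>" and "w \<in> \<gamma> ` {0<..<1}"
  then obtain t0 where t0: "0 < t0" "t0 < 1" "w = \<gamma> t0" by auto
  show "w \<in> intr TYPE(2) Y2"
  proof (rule ccontr)
    assume w: "w \<notin> intr TYPE(2) Y2"
    have ends: "\<gamma> 0 = x" "\<gamma> 1 = y" "x \<noteq> y" "path_image \<gamma> \<subseteq> Y2"
      and len: "\<And>s t. 0 \<le> s \<Longrightarrow> s < t \<Longrightarrow> t \<le> 1 \<Longrightarrow>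
        rho A g Y2 (\<gamma> s) (\<gamma> t) = ennreal (t - s) * rho A g Y2 x y"
      using sp unfolding shortest_path_def pathstart_def pathfinish_def by blast+
    have "\<gamma> t0 \<in> path_image \<gamma>" using t0 by (simp add: path_image_def)
    then have "w \<in> Y2" using ends(4) t0(3) by blast
    then have wb: "w \<in> bdry TYPE(2) Y2" using w by (simp add: intr_def)
    have d1: "rho A g Y2 x w = ennreal t0 * rho A g Y2 x y"
      using len[of 0 t0] t0 ends(1) by simp
    have d2: "rho A g Y2 w y = ennreal (1 - t0) * rho A g Y2 x y"
      using len[of t0 1] t0 ends(2) by simp
    obtain f where f: "f ` bdry TYPE(2) Y1 = bdry TYPE(2) Y2"
      "\<And>u v. u \<in> bdry TYPE(2) Y1 \<Longrightarrow> v \<in> bdry TYPE(2) Y1 \<Longrightarrow> rho A g Y2 (f u) (f v) = rho A g Y1 u v"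
      using iso unfolding boundaries_isometric_def by blast
    obtain x1 where x1: "x1 \<in> bdry TYPE(2) Y1" "x = f x1" using x f(1) by blast
    obtain y1 where y1: "y1 \<in> bdry TYPE(2) Y1" "y = f y1" using y f(1) by blast
    obtain z1 where z1: "z1 \<in> bdry TYPE(2) Y1" "w = f z1" using wb f(1) by blast
    have inY: "x1 \<in> Y1" "y1 \<in> Y1" "z1 \<in> Y1" using x1(1) y1(1) z1(1) by (auto simp: bdry_def)
    have "rho A g Y1 x1 y1 < \<infinity>" using Y1(3) inY unfolding condition_i_def by blast
    then obtain r where r: "rho A g Y1 x1 y1 = ennreal r" "0 \<le> r"
      by (cases "rho A g Y1 x1 y1") auto
    have "x1 \<noteq> y1" using ends(3) x1(2) y1(2) by blast
    moreover have "rho A g Y1 x1 z1 = ennreal (t0 * r)"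
      using d1 f(2) x1 y1 z1 r t0 by (simp add: ennreal_mult)
    moreover have "rho A g Y1 z1 y1 = ennreal ((1 - t0) * r)"
      using d2 f(2) x1 y1 z1 r t0 by (simp add: ennreal_mult)
    ultimately obtain \<delta> where \<delta>: "shortest_path A g Y1 x1 y1 \<delta>" "\<delta> t0 = z1"
      using shortest_path_through[OF Y1(1,2) inY(1,3,2) _ t0(1,2) r(2,1)] by blast
    have "\<delta> ` {0<..<1} \<subseteq> intr TYPE(2) Y1"
      using Y1(4) x1(1) y1(1) \<delta>(1) unfolding property_circ_def by blast
    moreover have "\<delta> t0 \<in> \<delta> ` {0<..<1}" using t0 by simp
    ultimately have "z1 \<in> intr TYPE(2) Y1" using \<delta>(2) by blast
    then show False using z1(1) by (simp add: intr_def)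
  qed
qed

end

theorem theorem3p7:
  fixes A :: "('a::{t2_space, second_countable_topology}, 2) chart set"
    and g :: "('a, 2) chart \<Rightarrow> real ^ 2 \<Rightarrow> real ^ 2 ^ 2"
    and Y\<^sub>1 Y\<^sub>2 :: "'a set"
  assumes "riemannian_manifold A g"
    and "connected (UNIV :: 'a set)"
    and "C0_submanifold TYPE(2) Y\<^sub>1" and "compact Y\<^sub>1" and "connected Y\<^sub>1"
    and "bdry TYPE(2) Y\<^sub>1 \<noteq> {}"
    and "condition_i A g Y\<^sub>1"
    and "property_circ A g Y\<^sub>1"
    and "C0_submanifold TYPE(2) Y\<^sub>2" and "compact Y\<^sub>2" and "connected Y\<^sub>2"
    and "bdry TYPE(2) Y\<^sub>2 \<noteq> {}"
    and "condition_i A g Y\<^sub>2"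
    and "boundaries_isometric A g Y\<^sub>1 Y\<^sub>2"
  shows "property_circ A g Y\<^sub>2"
proof -
  interpret riemannian_surface A g by unfold_locales (rule assms(1))
  show ?thesis by (rule property_circ_transfer) (fact assms)+
qed

end
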